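(* Let $\Gamma$ be a finite simplicial graph with at least $3$ vertices, let $A_\Gamma$ be its right-angled Artin group, and let $S\subset \mathrm{Aut}(A_\Gamma)$ be the set of all transvections and all partial conjugations. Let $\mathrm{Aut}^*(A_\Gamma)$ be the subgroup of $\mathrm{Aut}(A_\Gamma)$ generated by $S$. Then the commutativity graph $K(\mathrm{Aut}^*(A_\Gamma),S)$ is connected. Hence, $\mathrm{Aut}(A_\Gamma)$ is not relatively hyperbolic.
   Context: Right-angled Artin group: for a finite simplicial graph $\Gamma$ with vertex set $V$ and edge set $E$, $A_\Gamma=\langle v\in V\mid [u,v]=1 \text{ for } \{u,v\}\in E\rangle$. Links and stars: $\mathrm{lk}(v)$ is the full subgraph of $\Gamma$ spanned by the vertices adjacent to $v$; $\mathrm{st}(v)$ is the full subgraph spanned by $v$ and the vertices adjacent to $v$. Write $v\le w$ if $\mathrm{lk}(v)\subset \mathrm{st}(w)$. Transvections: for distinct vertices $v,w$ with $v\le w$, the right transvection $R_{vw}$ is the automorphism of $A_\Gamma$ sending $v\mapsto vw$ and fixing all other vertices; the left transvection $L_{vw}$ sends $v\mapsto wv$ and fixes all other vertices. Partial conjugations: for a vertex $v$ and a connected component $C$ of $\Gamma-\mathrm{st}(v)$ (the full subgraph spanned by the vertices not in $\mathrm{st}(v)$), $P_v^C$ is the automorphism sending $u\mapsto vuv^{-1}$ for every vertex $u\in C$ and fixing all other vertices. All these automorphisms have infinite order. Commutativity graph: for a group $G$ and a generating set $S$ of $G$ consisting of infinite order elements, $K(G,S)$ is the simplicial graph with vertex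 set $S$ in which two distinct vertices $s,s'$ are joined by an edge if there exist non-zero integers $n_s,n_{s'}$ such that $\langle s^{n_s},(s')^{n_{s'}}\rangle$ is abelian. Relative hyperbolicity (Bowditch): let $G$ be a finitely generated group, $\mathcal H$ a finite collection of proper finitely generated subgroups of $G$, and $\Lambda$ the Cayley graph of $G$ with respect to a finite generating set. The coned-off Cayley graph $\hat\Lambda(G,\mathcal H)$ is obtained from $\Lambda$ by adding, for each coset $gH$ with $g\in G$, $H\in\mathcal H$, a new vertex $v(gH)$ joined by an edge to each element of $gH$. $G$ is relatively hyperbolic with respect to $\mathcal H$ if $\hat\Lambda(G,\mathcal H)$ is $\delta$-hyperbolic for some $\delta$ and is fine, meaning that for each integer $k$ every edge is contained in only finitely many simple cycles of length $k$. $G$ is not relatively hyperbolic if it is not relatively hyperbolic with respect to any finite collection of proper finitely generated subgroups. *)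

theory Defs
  imports
    "Graph_Theory.Graph_Theory"
    "HOL-Algebra.Bij"
    "HOL-Algebra.Elementary_Groups"
begin

section \<open>Groups given by generators and relators\<close>

text \<open>A letter \<open>(x, True)\<close> stands for the generator \<open>x\<close>, and \<open>(x, False)\<close> for its formal inverse.\<close>

type_synonym 'x word = "('x \<times> bool) list"

definition words :: "'x set \<Rightarrow> 'x word set" where
  "words X = lists (X \<times> UNIV)"

inductive_set pres_rel :: "'x set \<Rightarrow> 'x word set \<Rightarrow> ('x word \<times> 'x word) set"
  for X :: "'x set" and R :: "'x word set" where
  refl: "w \<in> words X \<Longrightarrow> (w, w) \<in> pres_rel X R"
| sym: "(u, w) \<in> pres_rel X R \<Longrightarrow> (w, u) \<in> pres_rel X R"
| trans: "(u, v) \<in> pres_rel X R \<Longrightarrow> (v, w) \<in> pres_rel X R \<Longrightarrow> (u, w) \<in> pres_rel X R"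
| cancel: "u \<in> words X \<Longrightarrow> w \<in> words X \<Longrightarrow> x \<in> X \<Longrightarrow>
    (u @ [(x, b), (x, \<not> b)] @ w, u @ w) \<in> pres_rel X R"
| relator: "u \<in> words X \<Longrightarrow> w \<in> words X \<Longrightarrow> r \<in> R \<Longrightarrow> r \<in> words X \<Longrightarrow>
    (u @ r @ w, u @ w) \<in> pres_rel X R"

definition presented_group :: "'x set \<Rightarrow> 'x word set \<Rightarrow> 'x word set monoid" where
  "presented_group X R =
    \<lparr>carrier = words X // pres_rel X R,
     mult = (\<lambda>A B. \<Union>a\<in>A. \<Union>b\<in>B. pres_rel X R `` {a @ b}),
     one = pres_rel X R `` {[]}\<rparr>"

lemma words_append [simp]: "u @ w \<in> words X \<longleftrightarrow> u \<in> words X \<and> w \<in> words X"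
  by (auto simp: words_def)

lemma words_Nil [simp]: "[] \<in> words X"
  by (simp add: words_def)

lemma words_Cons [simp]: "(x, b) # w \<in> words X \<longleftrightarrow> x \<in> X \<and> w \<in> words X"
  by (auto simp: words_def)

lemma pres_rel_in_words: "(u, w) \<in> pres_rel X R \<Longrightarrow> u \<in> words X \<and> w \<in> words X"
  by (induction rule: pres_rel.induct) auto

lemma equiv_pres_rel: "equiv (words X) (pres_rel X R)"
  by (rule equivI)
    (auto simp: refl_on_def sym_def trans_def dest: pres_rel_in_words
      intro: pres_rel.refl pres_rel.sym pres_rel.trans)

lemma pres_rel_append_left:
  "(u, w) \<in> pres_rel X R \<Longrightarrow> v \<in> words X \<Longrightarrow> (v @ u, v @ w) \<in> pres_rel X R"
proof (induction rule: pres_rel.induct)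
  case (cancel u w x b)
  then show ?case using pres_rel.cancel[of "v @ u" X w x b R] by simp
next
  case (relator u w r)
  then show ?case using pres_rel.relator[of "v @ u" X w r R] by simp
qed (auto intro: pres_rel.refl pres_rel.sym pres_rel.trans)

lemma pres_rel_append_right:
  "(u, w) \<in> pres_rel X R \<Longrightarrow> v \<in> words X \<Longrightarrow> (u @ v, w @ v) \<in> pres_rel X R"
proof (induction rule: pres_rel.induct)
  case (cancel u w x b)
  then show ?case using pres_rel.cancel[of u X "w @ v" x b R] by simp
next
  case (relator u w r)
  then show ?case using pres_rel.relator[of u X "w @ v" r R] by simp
qed (auto intro: pres_rel.refl pres_rel.sym pres_rel.trans)

lemma presented_group_mult:
  assumes "u \<in> words X" "w \<in> words X"
  shows "pres_rel X R `` {u} \<otimes>\<^bsub>presented_group X R\<^esub> pres_rel X R `` {w} = pres_rel X R `` {u @ w}"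
proof -
  have "congruent2 (pres_rel X R) (pres_rel X R) (\<lambda>a b. pres_rel X R `` {a @ b})"
  proof (rule congruent2I[OF equiv_pres_rel equiv_pres_rel])
    fix a b c assume "c \<in> words X" "(a, b) \<in> pres_rel X R"
    then show "pres_rel X R `` {a @ c} = pres_rel X R `` {b @ c}"
      by (intro equiv_class_eq[OF equiv_pres_rel] pres_rel_append_right)
  next
    fix a b c assume "c \<in> words X" "(a, b) \<in> pres_rel X R"
    then show "pres_rel X R `` {c @ a} = pres_rel X R `` {c @ b}"
      by (intro equiv_class_eq[OF equiv_pres_rel] pres_rel_append_left)
  qed
  from UN_equiv_class2[OF equiv_pres_rel equiv_pres_rel this assms]
  show ?thesis by (simp add: presented_group_def)
qed

lemma pres_rel_left_inverse:
  "w \<in> words X \<Longrightarrow> (map (\<lambda>(x, b). (x, \<not> b)) (rev w) @ w, []) \<in> pres_rel X R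
    \<and> map (\<lambda>(x, b). (x, \<not> b)) (rev w) \<in> words X"
proof (induction w)
  case Nil
  then show ?case by (simp add: pres_rel.refl)
next
  case (Cons l w)
  obtain x b where l: "l = (x, b)" by (cases l)
  let ?v = "map (\<lambda>(x, b). (x, \<not> b)) (rev w)"
  have x: "x \<in> X" "w \<in> words X" and IH: "(?v @ w, []) \<in> pres_rel X R" "?v \<in> words X"
    using Cons l by auto
  have "(?v @ [(x, \<not> b), (x, \<not> \<not> b)] @ w, ?v @ w) \<in> pres_rel X R"
    using x IH by (intro pres_rel.cancel) auto
  then show ?case
    using x IH l by (auto intro: pres_rel.trans)
qed

lemma group_presented_group: "group (presented_group X R)"
proof (rule groupI)
  let ?G = "presented_group X R"
  have car: "A \<in> carrier ?G \<longleftrightarrow> (\<exists>w\<in>words X. A = pres_rel X R `` {w})" for A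
    by (auto simp: presented_group_def quotient_def)
  have one: "\<one>\<^bsub>?G\<^esub> = pres_rel X R `` {[]}"
    by (simp add: presented_group_def)
  show "\<one>\<^bsub>?G\<^esub> \<in> carrier ?G" unfolding car one by auto
  show "A \<otimes>\<^bsub>?G\<^esub> B \<in> carrier ?G" if "A \<in> carrier ?G" "B \<in> carrier ?G" for A B
  proof -
    from that obtain a b where "a \<in> words X" "b \<in> words X"
      "A = pres_rel X R `` {a}" "B = pres_rel X R `` {b}" unfolding car by blast
    then show ?thesis unfolding car
      by (auto simp: presented_group_mult intro!: bexI[of _ "a @ b"])
  qed
  show "A \<otimes>\<^bsub>?G\<^esub> B \<otimes>\<^bsub>?G\<^esub> C = A \<otimes>\<^bsub>?G\<^esub> (B \<otimes>\<^bsub>?G\<^esub> C)"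
    if "A \<in> carrier ?G" "B \<in> carrier ?G" "C \<in> carrier ?G" for A B C
    using that unfolding car by (auto simp: presented_group_mult)
  show "\<one>\<^bsub>?G\<^esub> \<otimes>\<^bsub>?G\<^esub> A = A" if "A \<in> carrier ?G" for A
    using that unfolding car one by (auto simp: presented_group_mult)
  show "\<exists>B\<in>carrier ?G. B \<otimes>\<^bsub>?G\<^esub> A = \<one>\<^bsub>?G\<^esub>" if A: "A \<in> carrier ?G" for A
  proof -
    from A obtain w where w: "w \<in> words X" "A = pres_rel X R `` {w}" unfolding car by blast
    let ?v = "map (\<lambda>(x, b). (x, \<not> b)) (rev w)"
    have v: "(?v @ w, []) \<in> pres_rel X R" "?v \<in> words X"
      using pres_rel_left_inverse[OF w(1)] by blast+
    have "pres_rel X R `` {?v} \<otimes>\<^bsub>?G\<^esub> A = \<one>\<^bsub>?G\<^esub>"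
      unfolding w(2) one presented_group_mult[OF v(2) w(1)]
      by (rule equiv_class_eq[OF equiv_pres_rel v(1)])
    moreover have "pres_rel X R `` {?v} \<in> carrier ?G" unfolding car using v(2) by blast
    ultimately show ?thesis by blast
  qed
qed


section \<open>Right-angled Artin groups and their automorphisms\<close>

text \<open>A finite simplicial graph is a \<^locale>\<open>pair_graph\<close>: finite, symmetric and loop-free.
  Every edge is represented by its two orientations.\<close>

definition raag_relators :: "'v pair_pre_digraph \<Rightarrow> 'v word set" where
  "raag_relators \<Gamma> =
     {[(u, True), (v, True), (u, False), (v, False)] | u v. (u, v) \<in> parcs \<Gamma>}"

definition raag :: "'v pair_pre_digraph \<Rightarrow> 'v word set monoid" where
  "raag \<Gamma> = presented_group (pverts \<Gamma>) (raag_relators \<Gamma>)"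

definition raag_gen :: "'v pair_pre_digraph \<Rightarrow> 'v \<Rightarrow> 'v word set" where
  "raag_gen \<Gamma> v = pres_rel (pverts \<Gamma>) (raag_relators \<Gamma>) `` {[(v, True)]}"

text \<open>Links and stars are full subgraphs, so they are given by their vertex sets.\<close>

definition lk :: "'v pair_pre_digraph \<Rightarrow> 'v \<Rightarrow> 'v set" where
  "lk \<Gamma> v = {u \<in> pverts \<Gamma>. (v, u) \<in> parcs \<Gamma>}"

definition st :: "'v pair_pre_digraph \<Rightarrow> 'v \<Rightarrow> 'v set" where
  "st \<Gamma> v = insert v (lk \<Gamma> v)"

text \<open>In a symmetric digraph the strongly connected components are the connected components.\<close>

definition components_minus_star :: "'v pair_pre_digraph \<Rightarrow> 'v \<Rightarrow> 'v set set" where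
  "components_minus_star \<Gamma> v =
     pre_digraph.sccs_verts (with_proj \<Gamma> \<restriction> (pverts \<Gamma> - st \<Gamma> v))"

definition right_transvections :: "'v pair_pre_digraph \<Rightarrow> ('v word set \<Rightarrow> 'v word set) set" where
  "right_transvections \<Gamma> = {\<phi> \<in> carrier (AutoGroup (raag \<Gamma>)).
     \<exists>v\<in>pverts \<Gamma>. \<exists>w\<in>pverts \<Gamma>. v \<noteq> w \<and> lk \<Gamma> v \<subseteq> st \<Gamma> w \<and>
       \<phi> (raag_gen \<Gamma> v) = raag_gen \<Gamma> v \<otimes>\<^bsub>raag \<Gamma>\<^esub> raag_gen \<Gamma> w \<and>
       (\<forall>u\<in>pverts \<Gamma> - {v}. \<phi> (raag_gen \<Gamma> u) = raag_gen \<Gamma> u)}"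

definition left_transvections :: "'v pair_pre_digraph \<Rightarrow> ('v word set \<Rightarrow> 'v word set) set" where
  "left_transvections \<Gamma> = {\<phi> \<in> carrier (AutoGroup (raag \<Gamma>)).
     \<exists>v\<in>pverts \<Gamma>. \<exists>w\<in>pverts \<Gamma>. v \<noteq> w \<and> lk \<Gamma> v \<subseteq> st \<Gamma> w \<and>
       \<phi> (raag_gen \<Gamma> v) = raag_gen \<Gamma> w \<otimes>\<^bsub>raag \<Gamma>\<^esub> raag_gen \<Gamma> v \<and>
       (\<forall>u\<in>pverts \<Gamma> - {v}. \<phi> (raag_gen \<Gamma> u) = raag_gen \<Gamma> u)}"

definition partial_conjugations :: "'v pair_pre_digraph \<Rightarrow> ('v word set \<Rightarrow> 'v word set) set" where
  "partial_conjugations \<Gamma> = {\<phi> \<in> carrier (AutoGroup (raag \<Gamma>)).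
     \<exists>v\<in>pverts \<Gamma>. \<exists>C\<in>components_minus_star \<Gamma> v.
       (\<forall>u\<in>C. \<phi> (raag_gen \<Gamma> u) =
          raag_gen \<Gamma> v \<otimes>\<^bsub>raag \<Gamma>\<^esub> raag_gen \<Gamma> u \<otimes>\<^bsub>raag \<Gamma>\<^esub> inv\<^bsub>raag \<Gamma>\<^esub> raag_gen \<Gamma> v) \<and>
       (\<forall>u\<in>pverts \<Gamma> - C. \<phi> (raag_gen \<Gamma> u) = raag_gen \<Gamma> u)}"

definition transvections_and_partial_conjugations ::
    "'v pair_pre_digraph \<Rightarrow> ('v word set \<Rightarrow> 'v word set) set" where
  "transvections_and_partial_conjugations \<Gamma> =
     right_transvections \<Gamma> \<union> left_transvections \<Gamma> \<union> partial_conjugations \<Gamma>"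

definition Aut_star :: "'v pair_pre_digraph \<Rightarrow> ('v word set \<Rightarrow> 'v word set) monoid" where
  "Aut_star \<Gamma> =
     subgroup_generated (AutoGroup (raag \<Gamma>)) (transvections_and_partial_conjugations \<Gamma>)"


section \<open>The commutativity graph\<close>

definition commutativity_graph :: "'a monoid \<Rightarrow> 'a set \<Rightarrow> 'a pair_pre_digraph" where
  "commutativity_graph G S =
     \<lparr>pverts = S,
      parcs = {(s, t). s \<in> S \<and> t \<in> S \<and> s \<noteq> t \<and>
        (\<exists>(m :: int) (n :: int). m \<noteq> 0 \<and> n \<noteq> 0 \<and>
          comm_group (subgroup_generated G {s [^]\<^bsub>G\<^esub> m, t [^]\<^bsub>G\<^esub> n}))}\<rparr>"


section \<open>Relative hyperbolicity\<close>

definition cayley_graph :: "'a monoid \<Rightarrow> 'a set \<Rightarrow> 'a pair_pre_digraph" where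
  "cayley_graph G X =
     \<lparr>pverts = carrier G,
      parcs = {(g, h). g \<in> carrier G \<and> h \<in> carrier G \<and> g \<noteq> h \<and>
        (\<exists>x\<in>X. h = g \<otimes>\<^bsub>G\<^esub> x \<or> g = h \<otimes>\<^bsub>G\<^esub> x)}\<rparr>"

text \<open>The cone vertex \<open>v(gH)\<close> is \<open>Inr (gH)\<close>. No collision occurs: a left coset determines
  the subgroup of which it is a coset.\<close>

definition coned_off_cayley_graph ::
    "'a monoid \<Rightarrow> 'a set \<Rightarrow> 'a set set \<Rightarrow> ('a + 'a set) pair_pre_digraph" where
  "coned_off_cayley_graph G X \<H> =
     \<lparr>pverts = Inl ` carrier G \<union> {Inr (g <#\<^bsub>G\<^esub> H) | g H. g \<in> carrier G \<and> H \<in> \<H>},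
      parcs = {(Inl g, Inl h) | g h. (g, h) \<in> parcs (cayley_graph G X)}
        \<union> {(Inl k, Inr (g <#\<^bsub>G\<^esub> H)) | k g H. g \<in> carrier G \<and> H \<in> \<H> \<and> k \<in> g <#\<^bsub>G\<^esub> H}
        \<union> {(Inr (g <#\<^bsub>G\<^esub> H), Inl k) | k g H. g \<in> carrier G \<and> H \<in> \<H> \<and> k \<in> g <#\<^bsub>G\<^esub> H}\<rparr>"

definition geodesic :: "('a, 'b) pre_digraph \<Rightarrow> 'a \<Rightarrow> 'b awalk \<Rightarrow> 'a \<Rightarrow> bool" where
  "geodesic G u p v \<longleftrightarrow> pre_digraph.awalk G u p v \<and>
     (\<forall>q. pre_digraph.awalk G u q v \<longrightarrow> length p \<le> length q)"

text \<open>Slim geodesic triangles (Rips). Only vertices are considered, as corners and as points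
  on the sides; passing to the geometric realization changes \<open>\<delta>\<close> by a bounded amount.\<close>

definition delta_hyperbolic :: "nat \<Rightarrow> ('a, 'b) pre_digraph \<Rightarrow> bool" where
  "delta_hyperbolic \<delta> G \<longleftrightarrow>
     (\<forall>a b c p q r. geodesic G a p b \<and> geodesic G b q c \<and> geodesic G a r c \<longrightarrow>
       (\<forall>x \<in> set (pre_digraph.awalk_verts G a p).
         \<exists>y \<in> set (pre_digraph.awalk_verts G b q) \<union> set (pre_digraph.awalk_verts G a r).
         \<exists>s. pre_digraph.awalk G x s y \<and> length s \<le> \<delta>))"

text \<open>In a symmetric digraph each undirected cycle of length \<open>k\<close> appears at most \<open>2 * k\<close> times
  here (choice of base point and direction), so finiteness is unaffected.\<close>

definition fine_graph :: "('a, 'b) pre_digraph \<Rightarrow> bool" where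
  "fine_graph G \<longleftrightarrow>
     (\<forall>k. \<forall>e \<in> arcs G. finite {c. pre_digraph.cycle G c \<and> length c = k \<and> e \<in> set c})"

definition fin_gen_subgroup :: "'a monoid \<Rightarrow> 'a set \<Rightarrow> bool" where
  "fin_gen_subgroup G H \<longleftrightarrow> subgroup H G \<and> (\<exists>F. finite F \<and> F \<subseteq> H \<and> generate G F = H)"

text \<open>Finite generation of \<open>G\<close> is part of the definition through the existence of \<open>X\<close>.\<close>

definition relatively_hyperbolic_wrt :: "'a monoid \<Rightarrow> 'a set set \<Rightarrow> bool" where
  "relatively_hyperbolic_wrt G \<H> \<longleftrightarrow>
     (\<exists>X. finite X \<and> X \<subseteq> carrier G \<and> generate G X = carrier G \<and>
       (\<exists>\<delta>. delta_hyperbolic \<delta> (with_proj (coned_off_cayley_graph G X \<H>))) \<and>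
       fine_graph (with_proj (coned_off_cayley_graph G X \<H>)))"

definition relatively_hyperbolic :: "'a monoid \<Rightarrow> bool" where
  "relatively_hyperbolic G \<longleftrightarrow>
     (\<exists>\<H>. finite \<H> \<and> (\<forall>H\<in>\<H>. fin_gen_subgroup G H \<and> H \<noteq> carrier G) \<and>
       relatively_hyperbolic_wrt G \<H>)"

end

theory Submission
  imports Defs
begin

text \<open>
  Every transvection and partial conjugation multiplies or conjugates vertices by powers of a single
  vertex, its acting letter. Two of them commute if they have the same acting letter, or if they fix each
  other's acting letters and these letters are adjacent, or if they act on different sides or on
  different vertices. Such commutations connect all acting letters.

  Suppose that a group is hyperbolic relative to proper subgroups, and let it act on the fine hyperbolic
  coned-off graph. In a fine graph two vertices have a finite common stabilizer. Hence the
  stabilizer \<open>P\<close> of a cone vertex is a proper subgroup such that \<open>c, t c t\<^sup>-\<^sup>1 \<in> P\<close> with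
  \<open>c\<close> of infinite order implies \<open>t \<in> P\<close>; in particular, \<open>P\<close> contains everything that
  commutes with \<open>c\<close>. A free abelian subgroup of rank two fixes a cone vertex: along a long geodesic
  joining two points of an orbit, many of its elements have the same shift, so that their quotients
  move a common point by a bounded amount, and by fineness one of them fixes a vertex.

  Two independent commuting elements of \<open>S\<close> therefore lie in such a \<open>P\<close>, and then so does all of
  \<open>S\<close> by connectedness. If \<open>\<Gamma>\<close> is not complete, then \<open>P\<close> contains the normal subgroup
  of inner automorphisms, and if \<open>\<Gamma>\<close> is complete, then it contains all conjugates of a
  transvection, by way of a chain of commuting transvections of the free abelian group. Either way
  \<open>P\<close> is the whole automorphism group. This avoids both a generating set of \<open>Aut(A\<^sub>\<Gamma>)\<close> and the
  invariance of relative hyperbolicity under passage to subgroups of finite index.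
\<close>

section \<open>Fine hyperbolic graphs with a group action\<close>

text \<open>The stabilizers of cone vertices may be infinite, so a point can have infinitely many
  translates close to it, and the usual counting in hyperbolic groups breaks down. Angles replace
  local finiteness: the angle at \<open>y\<close> between two of its neighbours is the length of a
  shortest path between them that avoids \<open>y\<close>, and fineness says that an edge makes a
  bounded angle with only finitely many edges at the same vertex. Every edge ends in a group
  element, whose stabilizer is trivial, so edges have trivial stabilizers; finitely many orbits of
  edges make the bounds uniform. Rank two enters through a count: the monomials in two generators
  grow quadratically, the possible shifts along a geodesic only linearly. The split into complete
  and non-complete graphs is forced, since inner automorphisms are trivial when the Artin group is
  abelian. Three vertices are essential there: for two adjacent vertices the automorphism group is
  GL(2,Z), which is virtually free and hence hyperbolic.\<close>

definition off :: "'p rel \<Rightarrow> 'p \<Rightarrow> 'p rel" where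
  "off E y = E \<inter> (- {y}) \<times> (- {y})"

definition avoid :: "'p rel \<Rightarrow> 'p \<Rightarrow> nat \<Rightarrow> 'p \<Rightarrow> 'p \<Rightarrow> bool" where
  "avoid E y L u v \<longleftrightarrow> (\<exists>k\<le>L. (u, v) \<in> off E y ^^ k)"

text \<open>A ball around the edge from \<open>y\<close> to \<open>u\<close> in the angle metric at
  \<open>y\<close>. Closing up paths that avoid \<open>y\<close> turns its elements into cycles
  through this edge, which is how fineness makes it finite.\<close>

definition angle_nbrs :: "'p rel \<Rightarrow> 'p \<Rightarrow> 'p \<Rightarrow> nat \<Rightarrow> 'p set" where
  "angle_nbrs E y u L = {u'. (y, u') \<in> E \<and> avoid E y L u u'}"

definition gdist :: "'p rel \<Rightarrow> 'p \<Rightarrow> 'p \<Rightarrow> nat" where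
  "gdist E x y = (LEAST k. (x, y) \<in> E ^^ k)"

lemma relpow_sym:
  assumes "sym E" "(x, y) \<in> E ^^ k"
  shows "(y, x) \<in> E ^^ k"
  using assms(2)
proof (induction k arbitrary: y)
  case (Suc k)
  then obtain z where "(x, z) \<in> E ^^ k" "(z, y) \<in> E" by auto
  then show ?case using Suc.IH assms(1) by (meson relpow_Suc_I2 symE)
qed auto

text \<open>Either the walk never visits \<open>x\<close>, or it splits at a visit. For
  \<open>k = 0\<close> the first alternative holds even if \<open>u = x\<close>.\<close>

lemma relpow_decompose:
  assumes "(u, t) \<in> E ^^ k"
  shows "(u, t) \<in> off E x ^^ k \<or> (\<exists>j\<le>k. (u, x) \<in> E ^^ j \<and> (x, t) \<in> E ^^ (k - j))"
  using assms
proof (induction k arbitrary: t)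
  case (Suc k)
  then obtain s where s: "(u, s) \<in> E ^^ k" "(s, t) \<in> E" by auto
  consider "t = x" | "s = x" | "t \<noteq> x" "s \<noteq> x" by blast
  then show ?case
  proof cases
    case 1
    then show ?thesis using Suc.prems by (intro disjI2 exI[of _ "Suc k"]) auto
  next
    case 2
    then show ?thesis using s by (intro disjI2 exI[of _ k]) auto
  next
    case 3
    from Suc.IH[OF s(1)] show ?thesis
    proof
      assume "(u, s) \<in> off E x ^^ k"
      then show ?thesis using 3 s(2) by (auto simp: off_def)
    next
      assume "\<exists>j\<le>k. (u, x) \<in> E ^^ j \<and> (x, s) \<in> E ^^ (k - j)"
      then obtain j where "j \<le> k" "(u, x) \<in> E ^^ j" "(x, s) \<in> E ^^ (k - j)" by blast
      then show ?thesis using s(2)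
        by (intro disjI2 exI[of _ j]) (auto simp: Suc_diff_le)
    qed
  qed
qed auto

lemma avoid_mono: "avoid E y L u v \<Longrightarrow> L \<le> L' \<Longrightarrow> avoid E y L' u v"
  unfolding avoid_def by (meson le_trans)

lemma avoid_trans:
  assumes "avoid E y L u v" "avoid E y L' v w"
  shows "avoid E y (L + L') u w"
proof -
  obtain k k' where "k \<le> L" "(u, v) \<in> off E y ^^ k" "k' \<le> L'" "(v, w) \<in> off E y ^^ k'"
    using assms unfolding avoid_def by blast
  then have "k + k' \<le> L + L'" "(u, w) \<in> off E y ^^ (k + k')"
    by (auto simp: relpow_add)
  then show ?thesis unfolding avoid_def by blast
qed

lemma avoid_sym: "sym E \<Longrightarrow> avoid E y L u v \<Longrightarrow> avoid E y L v u"
  unfolding avoid_def using relpow_sym[of "off E y"]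
  by (metis off_def sym_Int symI mem_Sigma_iff symD)

section \<open>Distance and geodesics in a connected symmetric graph\<close>

locale sym_conn =
  fixes V :: "'p set" and E :: "'p rel"
  assumes sub: "E \<subseteq> V \<times> V"
    and sym_E: "sym E"
    and conn: "x \<in> V \<Longrightarrow> y \<in> V \<Longrightarrow> \<exists>k. (x, y) \<in> E ^^ k"
begin

abbreviation "d \<equiv> gdist E"

lemma gdist_le: "(x, y) \<in> E ^^ k \<Longrightarrow> d x y \<le> k"
  unfolding gdist_def by (rule Least_le)

lemma gdist_walk: "x \<in> V \<Longrightarrow> y \<in> V \<Longrightarrow> (x, y) \<in> E ^^ d x y"
  unfolding gdist_def using conn LeastI_ex by metis

lemma gdist_triangle:
  assumes "x \<in> V" "y \<in> V" "z \<in> V"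
  shows "d x z \<le> d x y + d y z"
  using relcompI[OF gdist_walk[OF assms(1,2)] gdist_walk[OF assms(2,3)]]
  by (intro gdist_le) (simp add: relpow_add)

lemma gdist_sym: "x \<in> V \<Longrightarrow> y \<in> V \<Longrightarrow> d x y = d y x"
  using gdist_le relpow_sym[OF sym_E] gdist_walk by (meson le_antisym)

lemma gdist_self [simp]: "d x x = 0"
  using gdist_le[of x x 0] by simp

lemma gdist_0: "x \<in> V \<Longrightarrow> y \<in> V \<Longrightarrow> d x y = 0 \<longleftrightarrow> x = y"
  using gdist_walk[of x y] by auto

lemma first_step:
  assumes "x \<in> V" "t \<in> V" "x \<noteq> t"
  obtains u where "(x, u) \<in> E" "u \<in> V" "d u t + 1 = d x t"
proof -
  have "d x t \<noteq> 0" using assms gdist_0 by auto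
  then obtain k where k: "d x t = Suc k" using not0_implies_Suc by blast
  then have "(x, t) \<in> E ^^ Suc k" using gdist_walk[OF assms(1,2)] by simp
  then obtain u where u: "(x, u) \<in> E" "(u, t) \<in> E ^^ k" by (meson relpow_Suc_D2)
  then have uV: "u \<in> V" using sub by auto
  have "d u t \<le> k" using u gdist_le by blast
  moreover have "d x t \<le> Suc (d u t)"
    using gdist_walk[OF uV assms(2)] u(1) by (intro gdist_le) (meson relpow_Suc_I2)
  ultimately show ?thesis using that u uV k by simp
qed

text \<open>A return to \<open>x\<close> on a shortest walk from \<open>u\<close> to
  \<open>t\<close> would give \<open>d x t \<le> d u t\<close>, against
  \<open>d u t + 1 = d x t\<close>.\<close>

lemma avoid_first_step:
  assumes "x \<in> V" "t \<in> V" "u \<in> V" "d u t + 1 = d x t"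
  shows "avoid E x (d u t) u t"
proof -
  have "\<not> (\<exists>j\<le>d u t. (u, x) \<in> E ^^ j \<and> (x, t) \<in> E ^^ (d u t - j))"
  proof
    assume "\<exists>j\<le>d u t. (u, x) \<in> E ^^ j \<and> (x, t) \<in> E ^^ (d u t - j)"
    then have "d x t \<le> d u t" using gdist_le by (meson diff_le_self le_trans)
    then show False using assms by simp
  qed
  then show ?thesis
    using relpow_decompose[OF gdist_walk[OF assms(3,2)], of x] unfolding avoid_def by blast
qed

lemma avoid_or_through:
  assumes "(u, t) \<in> E ^^ k"
  shows "avoid E x k u t \<or> (\<exists>j\<le>k. (u, x) \<in> E ^^ j \<and> (x, t) \<in> E ^^ (k - j))"
  using relpow_decompose[OF assms, of x] unfolding avoid_def by blast

text \<open>A geodesic is an isometric function on the indices up to \<open>n\<close>, with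
  arbitrary values beyond; reversals and translates are then plain compositions.\<close>

definition geo :: "(nat \<Rightarrow> 'p) \<Rightarrow> nat \<Rightarrow> bool" where
  "geo \<gamma> n \<longleftrightarrow> (\<forall>i\<le>n. \<gamma> i \<in> V) \<and> (\<forall>i j. i \<le> j \<longrightarrow> j \<le> n \<longrightarrow> d (\<gamma> i) (\<gamma> j) = j - i)"

lemma relpow_fun:
  assumes "(x, y) \<in> E ^^ k"
  obtains f where "f 0 = x" "f k = y" "\<And>i. i < k \<Longrightarrow> (f i, f (Suc i)) \<in> E"
  using assms by (auto simp: relpow_fun_conv)

lemma relpow_subwalk:
  assumes "\<And>i. i < k \<Longrightarrow> (f i, f (Suc i)) \<in> E" "i \<le> j" "j \<le> k"
  shows "(f i, f j) \<in> E ^^ (j - i)"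
  using assms by (auto simp: relpow_fun_conv intro!: exI[of _ "\<lambda>l. f (i + l)"])

lemma geo_exists:
  assumes "x \<in> V" "y \<in> V"
  obtains \<gamma> where "geo \<gamma> (d x y)" "\<gamma> 0 = x" "\<gamma> (d x y) = y"
    "\<And>i. i < d x y \<Longrightarrow> (\<gamma> i, \<gamma> (Suc i)) \<in> E"
proof -
  obtain f where f: "f 0 = x" "f (d x y) = y" "\<And>i. i < d x y \<Longrightarrow> (f i, f (Suc i)) \<in> E"
    using relpow_fun[OF gdist_walk[OF assms]] by blast
  have fV: "f i \<in> V" if "i \<le> d x y" for i
  proof (cases i)
    case 0
    then show ?thesis using f assms by simp
  next
    case (Suc j)
    then have "(f j, f i) \<in> E" using f(3)[of j] that by simp
    then show ?thesis using sub by auto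
  qed
  have le: "d (f i) (f j) \<le> j - i" if "i \<le> j" "j \<le> d x y" for i j
    using relpow_subwalk[of "d x y" f i j] f that gdist_le by auto
  \<comment> \<open>The three pieces of the walk have lengths at most \<open>i\<close>,
    \<open>j - i\<close> and \<open>d x y - j\<close>. These add up to the distance of the ends, so
    each bound is attained.\<close>
  have "d (f i) (f j) = j - i" if ij: "i \<le> j" "j \<le> d x y" for i j
  proof -
    have "d x y \<le> d x (f i) + d (f i) (f j) + d (f j) y"
      using gdist_triangle[of x "f i" y] gdist_triangle[of "f i" "f j" y] assms fV ij by fastforce
    moreover have "d x (f i) \<le> i" using le[of 0 i] f ij by auto
    moreover have "d (f j) y \<le> d x y - j" using le[of j "d x y"] f ij by auto
    ultimately show ?thesis using le[OF ij] ij by linarith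
  qed
  then show ?thesis using that f fV unfolding geo_def by blast
qed

lemma avoid_of_fun:
  assumes "\<And>i. i < k \<Longrightarrow> (f i, f (Suc i)) \<in> E" "\<And>i. i \<le> k \<Longrightarrow> f i \<noteq> y"
  shows "avoid E y k (f 0) (f k)"
proof -
  have "(f 0, f k) \<in> off E y ^^ k"
    unfolding relpow_fun_conv using assms by (intro exI[of _ f]) (auto simp: off_def)
  then show ?thesis unfolding avoid_def by blast
qed

text \<open>A finite form of Koenig's lemma.\<close>

lemma many_exits:
  fixes R K :: nat
  shows "\<exists>M. \<forall>x\<in>V. \<forall>T. finite T \<and> M \<le> card T \<and> T \<subseteq> V \<and> (\<forall>t\<in>T. d x t \<le> R) \<longrightarrow>
    (\<exists>y\<in>V. \<exists>T'\<subseteq>T. \<exists>e. d x y \<le> R \<and> K \<le> card T' \<and> inj_on e T' \<and>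
      (\<forall>t\<in>T'. (y, e t) \<in> E \<and> d (e t) t + 1 = d y t \<and> d y t \<le> R))"
proof (induction R)
  case 0
  have "card T \<le> 1" if "x \<in> V" "T \<subseteq> V" "\<forall>t\<in>T. d x t \<le> 0" for x T
  proof -
    have "T \<subseteq> {x}" using that gdist_0 by blast
    then show ?thesis by (metis card_mono finite.emptyI finite_insert is_singletonI is_singleton_altdef)
  qed
  \<comment> \<open>Only \<open>x\<close> itself is at distance 0, so no set of two targets
    qualifies.\<close>
  then show ?case by (intro exI[of _ 2]) fastforce
next
  case (Suc R)
  then obtain M where M: "\<forall>x\<in>V. \<forall>T. finite T \<and> M \<le> card T \<and> T \<subseteq> V \<and> (\<forall>t\<in>T. d x t \<le> R) \<longrightarrow>
    (\<exists>y\<in>V. \<exists>T'\<subseteq>T. \<exists>e. d x y \<le> R \<and> K \<le> card T' \<and> inj_on e T' \<and>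
      (\<forall>t\<in>T'. (y, e t) \<in> E \<and> d (e t) t + 1 = d y t \<and> d y t \<le> R))"
    by blast
  show ?case
  \<comment> \<open>Deleting \<open>x\<close> costs at most one target, and more than
    \<open>K * M\<close> remain. Either their first steps from \<open>x\<close> take at least
    \<open>K\<close> values, and \<open>y = x\<close> serves, or at least \<open>M\<close> targets
    share a first step \<open>u\<close> and lie within \<open>R\<close> of it.\<close>
  proof (intro exI[of _ "K * M + 2"] ballI allI impI, elim conjE)
    fix x T assume x: "x \<in> V" and T: "finite T" "K * M + 2 \<le> card T" "T \<subseteq> V" "\<forall>t\<in>T. d x t \<le> Suc R"
    define T0 where "T0 = T - {x}"
    have T0: "finite T0" "K * M + 1 \<le> card T0" "T0 \<subseteq> V" "\<forall>t\<in>T0. d x t \<le> Suc R"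
      using T by (auto simp: T0_def card_Diff_singleton_if)
    have "\<forall>t\<in>T0. \<exists>u. (x, u) \<in> E \<and> u \<in> V \<and> d u t + 1 = d x t"
      using first_step x T0(3) unfolding T0_def by (metis Diff_iff insertI1 subsetD)
    then obtain e where e: "\<And>t. t \<in> T0 \<Longrightarrow> (x, e t) \<in> E \<and> e t \<in> V \<and> d (e t) t + 1 = d x t"
      by metis
    show "\<exists>y\<in>V. \<exists>T'\<subseteq>T. \<exists>e. d x y \<le> Suc R \<and> K \<le> card T' \<and> inj_on e T' \<and>
      (\<forall>t\<in>T'. (y, e t) \<in> E \<and> d (e t) t + 1 = d y t \<and> d y t \<le> Suc R)"
    proof (cases "K \<le> card (e ` T0)")
      case True
      obtain T' where T': "T' \<subseteq> T0" "inj_on e T'" "e ` T' = e ` T0"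
        using subset_image_inj[of "e ` T0" e T0] by auto
      then have "K \<le> card T'" using True by (metis card_image)
      moreover have "T' \<subseteq> T" "\<forall>t\<in>T'. (x, e t) \<in> E \<and> d (e t) t + 1 = d x t \<and> d x t \<le> Suc R"
        using T'(1) e T0(4) unfolding T0_def by blast+
      moreover have "d x x \<le> Suc R" by simp
      ultimately show ?thesis using x T'(2) by blast
    next
      case False
      have "\<exists>u\<in>e ` T0. M \<le> card {t\<in>T0. e t = u}"
      proof (rule ccontr)
        assume "\<not> ?thesis"
        then have "\<And>u. u \<in> e ` T0 \<Longrightarrow> card {t\<in>T0. e t = u} \<le> M" by fastforce
        moreover have "card T0 = (\<Sum>u\<in>e ` T0. card {t\<in>T0. e t = u})"
          using card_eq_sum[of T0] sum.image_gen[of T0 "\<lambda>_. 1::nat" e] T0(1) by simp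
        ultimately have "card T0 \<le> card (e ` T0) * M"
          using sum_bounded_above[of "e ` T0" "\<lambda>u. card {t\<in>T0. e t = u}" M] by simp
        also have "\<dots> \<le> K * M" using False by simp
        finally show False using T0(2) by simp
      qed
      then obtain u where u: "u \<in> e ` T0" "M \<le> card {t\<in>T0. e t = u}" by blast
      let ?T = "{t\<in>T0. e t = u}"
      have uV: "u \<in> V" "d x u \<le> 1"
        using u e gdist_le[of x u 1] by auto
      have "\<forall>t\<in>?T. d u t \<le> R" using e T0 by fastforce
      then obtain y T' e' where y: "y \<in> V" "T' \<subseteq> ?T" "d u y \<le> R" "K \<le> card T'" "inj_on e' T'"
        "\<forall>t\<in>T'. (y, e' t) \<in> E \<and> d (e' t) t + 1 = d y t \<and> d y t \<le> R"
        using M[rule_format, of u ?T] u(2) uV(1) T0(1,3) finite_subset[of ?T T0] by blast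
      have "d x y \<le> Suc R" using gdist_triangle[of x u y] x y uV by linarith
      moreover have "T' \<subseteq> T" using y(2) unfolding T0_def by blast
      moreover have "\<forall>t\<in>T'. (y, e' t) \<in> E \<and> d (e' t) t + 1 = d y t \<and> d y t \<le> Suc R"
        using y(6) le_SucI by blast
      ultimately show ?thesis using y(1,4,5) by blast
    qed
  qed
qed

end


text \<open>In the application \<open>U\<close> consists of the group elements, as opposed to the
  cone vertices. Since every edge has an end in \<open>U\<close>, edge stabilizers are trivial. The
  bound \<open>F\<close> depends only on the length and is shared by all edges.\<close>

locale free_action = sym_conn V E + group G
  for V :: "'p set" and E :: "'p rel" and G :: "('a, 'm) monoid_scheme" (structure) +
  fixes act :: "'a \<Rightarrow> 'p \<Rightarrow> 'p" and U :: "'p set"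
  assumes act_V: "a \<in> carrier G \<Longrightarrow> x \<in> V \<Longrightarrow> act a x \<in> V"
    and act_one: "x \<in> V \<Longrightarrow> act \<one> x = x"
    and act_mult: "a \<in> carrier G \<Longrightarrow> b \<in> carrier G \<Longrightarrow> x \<in> V \<Longrightarrow> act (a \<otimes> b) x = act a (act b x)"
    and act_E: "a \<in> carrier G \<Longrightarrow> (x, y) \<in> E \<Longrightarrow> (act a x, act a y) \<in> E"
    and free: "a \<in> carrier G \<Longrightarrow> x \<in> U \<Longrightarrow> x \<in> V \<Longrightarrow> act a x = x \<Longrightarrow> a = \<one>"
    and edge_U: "(x, y) \<in> E \<Longrightarrow> x \<in> U \<or> y \<in> U"
    and uniformly_fine: "\<exists>F. \<forall>L y u. (y, u) \<in> E \<longrightarrow> finite (angle_nbrs E y u L) \<and> card (angle_nbrs E y u L) \<le> F L"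
begin

lemma edge_V: "(x, y) \<in> E \<Longrightarrow> x \<in> V \<and> y \<in> V"
  using sub by auto

lemma act_inv: "a \<in> carrier G \<Longrightarrow> x \<in> V \<Longrightarrow> act (inv a) (act a x) = x"
  using act_mult[of "inv a" a x] act_one by simp

lemma act_inv2: "a \<in> carrier G \<Longrightarrow> x \<in> V \<Longrightarrow> act a (act (inv a) x) = x"
  using act_mult[of a "inv a" x] act_one by simp

lemma act_inj: "a \<in> carrier G \<Longrightarrow> x \<in> V \<Longrightarrow> y \<in> V \<Longrightarrow> act a x = act a y \<Longrightarrow> x = y"
  by (metis act_inv)

lemma act_relpow:
  assumes "a \<in> carrier G" "(x, y) \<in> E ^^ k"
  shows "(act a x, act a y) \<in> E ^^ k"
  using assms(2)
proof (induction k arbitrary: y)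
  case (Suc k)
  then show ?case using act_E[OF assms(1)] by auto
qed auto

lemma act_off:
  assumes "a \<in> carrier G" "y \<in> V" "(u, v) \<in> off E y ^^ k"
  shows "(act a u, act a v) \<in> off E (act a y) ^^ k"
  using assms(3)
proof (induction k arbitrary: v)
  case (Suc k)
  then obtain w where w: "(u, w) \<in> off E y ^^ k" "(w, v) \<in> off E y" by auto
  then have "(act a w, act a v) \<in> off E (act a y)"
    unfolding off_def using act_E[OF assms(1)] act_inj[OF assms(1)] assms(2) edge_V by auto
  then show ?case using Suc.IH[OF w(1)] by auto
qed auto

lemma act_avoid:
  "a \<in> carrier G \<Longrightarrow> y \<in> V \<Longrightarrow> avoid E y L u v \<Longrightarrow> avoid E (act a y) L (act a u) (act a v)"
  unfolding avoid_def using act_off by blast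

lemma act_gdist:
  assumes "a \<in> carrier G" "x \<in> V" "y \<in> V"
  shows "d (act a x) (act a y) = d x y"
proof (rule antisym)
  show le: "d (act a x) (act a y) \<le> d x y"
    using assms by (intro gdist_le act_relpow gdist_walk)
  have "(act (inv a) (act a x), act (inv a) (act a y)) \<in> E ^^ d (act a x) (act a y)"
    using assms act_V by (intro act_relpow gdist_walk) auto
  then show "d x y \<le> d (act a x) (act a y)"
    using assms by (intro gdist_le) (simp add: act_inv)
qed

lemma edge_stabilizer:
  assumes "(x, y) \<in> E" "a \<in> carrier G" "act a x = x" "act a y = y"
  shows "a = \<one>"
  using edge_U[OF assms(1)] free[OF assms(2)] assms edge_V by blast

lemma act_eq_imp:
  assumes "a \<in> carrier G" "b \<in> carrier G" "x \<in> V" "act a x = act b x"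
  shows "act (inv a \<otimes> b) x = x"
  using assms act_mult[of "inv a" b x] act_inv[of a x] by simp

lemma act_nat_pow:
  assumes "c \<in> carrier G" "y \<in> V" "act c y = y"
  shows "act (c [^] (n :: nat)) y = y"
  using assms by (induction n) (auto simp: act_one act_mult)

lemma act_inv_fix:
  assumes "c \<in> carrier G" "y \<in> V" "act c y = y"
  shows "act (inv c) y = y"
  using assms act_inv by metis

text \<open>Two vertices have a finite common stabilizer: it permutes the geodesics between them.\<close>

lemma infinite_order_fixes_one:
  assumes c: "c \<in> carrier G" "\<And>n :: nat. c [^] n = \<one> \<Longrightarrow> n = 0"
    and y: "y \<in> V" "act c y = y" and z: "z \<in> V" "act c z = z"
  shows "y = z"
proof (rule ccontr)
  assume "y \<noteq> z"
  then obtain u where u: "(y, u) \<in> E" "u \<in> V" "d u z + 1 = d y z"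
    using first_step y z by metis
  have av: "avoid E y (d u z) u z" using avoid_first_step[OF y(1) z(1) u(2,3)] .
  obtain F where F: "\<And>L y u. (y, u) \<in> E \<Longrightarrow> finite (angle_nbrs E y u L)"
    using uniformly_fine by blast
  let ?f = "\<lambda>n :: nat. act (c [^] n) u"
  have fx: "act (c [^] n) y = y" "act (c [^] n) z = z" for n :: nat
    using act_nat_pow c(1) y z by auto
  have "?f n \<in> angle_nbrs E y u (d u z + d u z)" for n
  proof -
    \<comment> \<open>A geodesic from \<open>u\<close> to \<open>z\<close>, followed backwards by
      its image, joins \<open>u\<close> to its image without meeting \<open>y\<close>; this bounds
      the angle.\<close>
    have "avoid E y (d u z) (?f n) z"
      using act_avoid[OF _ y(1) av, of "c [^] n"] c(1) fx[of n] by simp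
    then have "avoid E y (d u z + d u z) u (?f n)"
      using avoid_trans[OF av] avoid_sym[OF sym_E] by blast
    moreover have "(y, ?f n) \<in> E" using act_E[of "c [^] n", OF _ u(1)] c(1) fx[of n] by simp
    ultimately show ?thesis unfolding angle_nbrs_def by simp
  qed
  then have "range ?f \<subseteq> angle_nbrs E y u (d u z + d u z)" by blast
  then have "finite (range ?f)" using F[OF u(1)] finite_subset by blast
  \<comment> \<open>Powers that agree on \<open>u\<close> agree on the edge from \<open>y\<close> to
    \<open>u\<close>, whose stabilizer is trivial.\<close>
  moreover have "inj ?f"
  proof (rule injI)
    fix m n :: nat assume eq: "?f m = ?f n"
    have "act (inv (c [^] m) \<otimes> c [^] n) u = u"
      using act_eq_imp[of "c [^] m" "c [^] n" u] eq c(1) u(2) by simp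
    moreover have "act (inv (c [^] m) \<otimes> c [^] n) y = y"
      using act_eq_imp[of "c [^] m" "c [^] n" y] fx c(1) y by simp
    ultimately have "inv (c [^] m) \<otimes> c [^] n = \<one>"
      using edge_stabilizer[OF u(1), of "inv (c [^] m) \<otimes> c [^] n"] c(1) by simp
    then have e: "c [^] m = c [^] n"
      using c(1) by (metis inv_equality inv_inv nat_pow_closed inv_closed)
    have "k = 0" if "c [^] i = c [^] (i + k)" for i k :: nat
      using that c by (metis l_cancel_one nat_pow_closed nat_pow_mult)
    then show "m = n"
      using e by (metis le_iff_add nat_le_linear add.right_neutral)
  qed
  ultimately show False using finite_imageD infinite_UNIV_nat by blast
qed

text \<open>If \<open>g\<close> moves \<open>y\<close>, then the first edges at \<open>y\<close> towards most points \<open>b p\<close> lie at a large angle from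
  the geodesic between \<open>y\<close> and \<open>g y\<close>, and so do their images at \<open>g y\<close>; this contradicts that
  \<open>b p\<close> and \<open>g b p = b g p\<close> are close.\<close>

lemma many_almost_fixed_imp_fixed:
  fixes C \<rho> :: nat
  shows "\<exists>M. \<forall>p\<in>V. \<forall>g\<in>carrier G. \<forall>B\<subseteq>carrier G. finite B \<and> M \<le> card B \<and>
      (\<forall>b\<in>B. g \<otimes> b = b \<otimes> g \<and> d p (act b p) \<le> C) \<and> d p (act g p) \<le> \<rho> \<longrightarrow>
    (\<exists>y\<in>V. act g y = y \<or> (\<exists>b\<in>B. \<exists>b'\<in>B. b \<noteq> b' \<and> act b y = act b' y))"
proof -
  obtain F where F: "\<And>L y u. (y, u) \<in> E \<Longrightarrow> finite (angle_nbrs E y u L) \<and> card (angle_nbrs E y u L) \<le> F L"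
    using uniformly_fine by blast
  \<comment> \<open>\<open>D\<close> bounds the distance from \<open>y\<close> to
    \<open>act g y\<close>. \<open>L\<close> is the length of a path built below, from
    \<open>f\<close> to \<open>act g y\<close>, on to \<open>act g t\<close>, then to
    \<open>t\<close> and to \<open>e t\<close>. \<open>K\<close> exceeds the number of
    \<open>bad\<close> elements plus those caught by a small angle at \<open>y\<close> or at
    \<open>act g y\<close>.\<close>
  define D where "D = 2 * C + \<rho>"
  define L where "L = D + C + \<rho> + C"
  define K where "K = Suc \<rho> + F L + F L + 1"
  obtain M where M: "\<forall>x\<in>V. \<forall>T. finite T \<and> M \<le> card T \<and> T \<subseteq> V \<and> (\<forall>t\<in>T. d x t \<le> C) \<longrightarrow>
    (\<exists>y\<in>V. \<exists>T'\<subseteq>T. \<exists>e. d x y \<le> C \<and> K \<le> card T' \<and> inj_on e T' \<and>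
      (\<forall>t\<in>T'. (y, e t) \<in> E \<and> d (e t) t + 1 = d y t \<and> d y t \<le> C))"
    using many_exits[of C K] by blast
  have "\<exists>y\<in>V. act g y = y \<or> (\<exists>b\<in>B. \<exists>b'\<in>B. b \<noteq> b' \<and> act b y = act b' y)"
    if p: "p \<in> V" and g: "g \<in> carrier G" and B: "B \<subseteq> carrier G" "finite B" "M \<le> card B"
      and comm: "\<And>b. b \<in> B \<Longrightarrow> g \<otimes> b = b \<otimes> g" and dB: "\<And>b. b \<in> B \<Longrightarrow> d p (act b p) \<le> C"
      and dg: "d p (act g p) \<le> \<rho>" for p g B
  proof (rule ccontr)
    assume neg: "\<not> ?thesis"
    then have gy: "\<And>y. y \<in> V \<Longrightarrow> act g y \<noteq> y"
      and inj: "\<And>y b b'. y \<in> V \<Longrightarrow> b \<in> B \<Longrightarrow> b' \<in> B \<Longrightarrow> act b y = act b' y \<Longrightarrow> b = b'" by blast+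
    let ?T = "(\<lambda>b. act b p) ` B"
    have injp: "inj_on (\<lambda>b. act b p) B" using inj[OF p] by (auto intro: inj_onI)
    have T: "finite ?T" "M \<le> card ?T" "?T \<subseteq> V" "\<forall>t\<in>?T. d p t \<le> C"
      using B dB act_V p by (auto simp: card_image[OF injp])
    obtain y T' e where y: "y \<in> V" "d p y \<le> C" and T': "T' \<subseteq> ?T" "K \<le> card T'" "inj_on e T'"
      and e: "\<And>t. t \<in> T' \<Longrightarrow> (y, e t) \<in> E \<and> d (e t) t + 1 = d y t \<and> d y t \<le> C"
      using M[rule_format, OF p, of ?T] T by blast
    let ?z = "act g y"
    have z: "?z \<in> V" "?z \<noteq> y" using act_V gy g y by auto
    have yz: "d y ?z \<le> D"
    proof -
      have "d y ?z \<le> d y p + d p (act g p) + d (act g p) ?z"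
        using gdist_triangle[of y p ?z] gdist_triangle[of p "act g p" ?z] y z p act_V g by fastforce
      moreover have "d y p = d p y" using gdist_sym y p by blast
      ultimately show ?thesis using y dg act_gdist[OF g p y(1)] unfolding D_def by linarith
    qed
    obtain f where f: "(y, f) \<in> E" "f \<in> V" "d f ?z + 1 = d y ?z"
      using first_step y z by metis
    have avf: "avoid E y D f ?z"
      using avoid_first_step[OF y(1) z(1) f(2,3)] f(3) yz avoid_mono by fastforce
    obtain f' where f': "(?z, f') \<in> E" "f' \<in> V" "d f' y + 1 = d ?z y"
      using first_step y z by metis
    have avf': "avoid E ?z D f' y"
      using avoid_first_step[OF z(1) y(1) f'(2,3)] f'(3) yz avoid_mono gdist_sym[OF y(1) z(1)] by fastforce
    \<comment> \<open>The translate of this path by \<open>b\<close> joins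
      \<open>t = act b p\<close> to \<open>act g t\<close>, because \<open>b\<close> commutes with
      \<open>g\<close>.\<close>
    obtain \<sigma> where \<sigma>: "\<sigma> 0 = p" "\<sigma> (d p (act g p)) = act g p" "geo \<sigma> (d p (act g p))"
      "\<And>i. i < d p (act g p) \<Longrightarrow> (\<sigma> i, \<sigma> (Suc i)) \<in> E"
      using geo_exists[OF p act_V[OF g p]] by metis
    have \<sigma>V: "\<sigma> i \<in> V" if "i \<le> d p (act g p)" for i using \<sigma>(3) that unfolding geo_def by blast
    define B' where "B' = {b\<in>B. act b p \<in> T'}"
    define bad where "bad = {b\<in>B'. \<exists>i\<le>d p (act g p). act b (\<sigma> i) = y}"
    have cardB': "K \<le> card B'"
    proof -
      have "T' = (\<lambda>b. act b p) ` B'" using T'(1) unfolding B'_def by blast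
      moreover have "finite B'" using B unfolding B'_def by simp
      ultimately show ?thesis using T'(2) card_image_le[of B' "\<lambda>b. act b p"] by simp
    qed
    \<comment> \<open>The index at which a translate meets \<open>y\<close> determines the
      translating element, since distinct elements of \<open>B\<close> never agree on a
      vertex.\<close>
    have cardbad: "card bad \<le> Suc \<rho>"
    proof -
      have "\<forall>b\<in>bad. \<exists>i. i \<le> d p (act g p) \<and> act b (\<sigma> i) = y" unfolding bad_def by blast
      then obtain i where i: "\<And>b. b \<in> bad \<Longrightarrow> i b \<le> d p (act g p) \<and> act b (\<sigma> (i b)) = y" by metis
      have "inj_on i bad"
      proof (rule inj_onI)
        fix b b' assume bb: "b \<in> bad" "b' \<in> bad" "i b = i b'"
        then have "act b (\<sigma> (i b)) = act b' (\<sigma> (i b))" using i by metis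
        then show "b = b'" using inj \<sigma>V i bb unfolding bad_def B'_def by blast
      qed
      moreover have "i ` bad \<subseteq> {..\<rho>}" using i dg by fastforce
      ultimately show ?thesis using card_inj_on_le[of i bad "{..\<rho>}"] by simp
    qed
    let ?N1 = "angle_nbrs E y f L" and ?N2 = "angle_nbrs E ?z f' L"
    let ?e = "\<lambda>b. e (act b p)"
    \<comment> \<open>Consider the image under \<open>g\<close> of a geodesic from
      \<open>e t\<close> to \<open>t\<close>. If it misses \<open>y\<close>, it is part of a path
      from \<open>f\<close> to \<open>e t\<close> avoiding \<open>y\<close>. If it reaches
      \<open>y\<close>, its part before \<open>y\<close> misses \<open>act g y\<close> and bounds
      the angle there.\<close>
    have key: "?e b \<in> ?N1 \<or> act g (?e b) \<in> ?N2" if b: "b \<in> B' - bad" for b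
    proof -
      have bB: "b \<in> B" "b \<in> carrier G" using b B unfolding B'_def by auto
      define t where "t = act b p"
      have t: "t \<in> V" "t \<in> T'" using b act_V bB p unfolding B'_def t_def by auto
      have gt: "act g t = act b (act g p)"
        using act_mult[OF g bB(2) p] act_mult[OF bB(2) g p] comm[OF bB(1)] unfolding t_def by simp
      have et: "(y, e t) \<in> E" "d (e t) t + 1 = d y t" "d y t \<le> C" "e t \<in> V" using e[OF t(2)] edge_V by auto
      have a1: "avoid E y C (e t) t"
        using avoid_first_step[OF y(1) t(1) et(4,2)] et avoid_mono by fastforce
      have w: "avoid E y (d p (act g p)) (act b (\<sigma> 0)) (act b (\<sigma> (d p (act g p))))"
        using b \<sigma>(4) act_E[OF bB(2)] unfolding bad_def
        by (intro avoid_of_fun) auto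
      have a2: "avoid E y \<rho> t (act g t)"
        using avoid_mono[OF w[unfolded \<sigma>(1,2), folded t_def gt] dg] .
      have gV: "act g t \<in> V" "act g (e t) \<in> V" using act_V g t et by auto
      have gw: "(act g (e t), act g t) \<in> E ^^ d (e t) t"
        using gdist_walk[OF gV(2,1)] act_gdist[OF g et(4) t(1)] by simp
      from avoid_or_through[OF gw, of y] show ?thesis
      proof
        assume miss: "avoid E y (d (e t) t) (act g (e t)) (act g t)"
        show ?thesis
        proof (cases "act g (e t) = y")
          \<comment> \<open>A walk of length 0 counts as avoiding every vertex, so
            \<open>miss\<close> does not exclude this case. Here \<open>y\<close> itself is the
            neighbour of \<open>act g y\<close> in question.\<close>
          case True
          have "avoid E ?z L f' y" using avf' avoid_mono unfolding L_def by (metis add.assoc le_add1)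
          then show ?thesis using True act_E[OF g et(1)] unfolding angle_nbrs_def t_def by simp
        next
          case False
          have "(?z, act g (e t)) \<in> off E y ^^ 1"
            using act_E[OF g et(1)] z(2) False by (simp add: off_def)
          then have "avoid E y 1 ?z (act g (e t))" unfolding avoid_def by blast
          from avoid_trans[OF this miss] have "avoid E y C ?z (act g t)"
            using et avoid_mono by fastforce
          then have "avoid E y (D + C) f (act g t)" using avoid_trans[OF avf] by blast
          then have "avoid E y (D + C + \<rho>) f t"
            using avoid_trans[OF _ avoid_sym[OF sym_E a2]] by blast
          then have "avoid E y L f (e t)"
            unfolding L_def using avoid_trans[OF _ avoid_sym[OF sym_E a1]] by blast
          then show ?thesis using et unfolding angle_nbrs_def t_def by simp
        qed
      next
        assume "\<exists>j\<le>d (e t) t. (act g (e t), y) \<in> E ^^ j \<and> (y, act g t) \<in> E ^^ (d (e t) t - j)"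
        then obtain j where j: "j \<le> d (e t) t" "(act g (e t), y) \<in> E ^^ j"
          "(y, act g t) \<in> E ^^ (d (e t) t - j)" by blast
        \<comment> \<open>A visit to \<open>act g y\<close> before \<open>y\<close> would put
          \<open>act g t\<close> within \<open>d (e t) t\<close> of it, one less than the distance
          from \<open>y\<close> to \<open>t\<close>.\<close>
        have "\<not> (\<exists>i\<le>j. (act g (e t), ?z) \<in> E ^^ i \<and> (?z, y) \<in> E ^^ (j - i))"
        proof
          assume "\<exists>i\<le>j. (act g (e t), ?z) \<in> E ^^ i \<and> (?z, y) \<in> E ^^ (j - i)"
          then obtain i where "(?z, y) \<in> E ^^ (j - i)" by blast
          then have "(?z, act g t) \<in> E ^^ ((j - i) + (d (e t) t - j))"
            using j(3) by (auto simp: relpow_add)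
          then have "d ?z (act g t) \<le> d (e t) t" using gdist_le j(1) by fastforce
          then show False using act_gdist[OF g y(1) t(1)] et(2) by simp
        qed
        then have "avoid E ?z j (act g (e t)) y" using avoid_or_through[OF j(2)] by blast
        then have "avoid E ?z C (act g (e t)) y" using j(1) et avoid_mono by fastforce
        then have "avoid E ?z (D + C) f' (act g (e t))"
          using avoid_trans[OF avf'] avoid_sym[OF sym_E] by blast
        then have "avoid E ?z L f' (act g (e t))" using avoid_mono unfolding L_def by (metis add.assoc le_add1)
        then show ?thesis using act_E[OF g et(1)] unfolding angle_nbrs_def t_def by simp
      qed
    qed
    have finB': "finite B'" using B unfolding B'_def by simp
    have inje: "inj_on ?e B'"
      using T'(3) inj[OF p] unfolding B'_def inj_on_def by blast
    have injge: "inj_on (\<lambda>b. act g (?e b)) B'"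
    proof (rule inj_onI)
      fix b b' assume bb: "b \<in> B'" "b' \<in> B'" "act g (?e b) = act g (?e b')"
      then have "?e b = ?e b'"
        using act_inj[OF g] e edge_V unfolding B'_def by blast
      then show "b = b'" using inje bb by (meson inj_onD)
    qed
    let ?B1 = "{b \<in> B'. ?e b \<in> ?N1}" and ?B2 = "{b \<in> B'. act g (?e b) \<in> ?N2}"
    have "card ?B1 \<le> card ?N1"
      using F[OF f(1), of L] inj_on_subset[OF inje, of ?B1] by (intro card_inj_on_le) auto
    moreover have "card ?B2 \<le> card ?N2"
      using F[OF f'(1), of L] inj_on_subset[OF injge, of ?B2] by (intro card_inj_on_le) auto
    ultimately have "card ?B1 \<le> F L" "card ?B2 \<le> F L"
      using F[OF f(1), of L] F[OF f'(1), of L] by linarith+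
    moreover have "card B' \<le> card (bad \<union> ?B1 \<union> ?B2)"
      using key finB' by (intro card_mono) (auto simp: bad_def)
    moreover have "card (bad \<union> ?B1 \<union> ?B2) \<le> card bad + card ?B1 + card ?B2"
      by (meson add_le_mono1 card_Un_le le_trans)
    ultimately show False using cardB' cardbad unfolding K_def by linarith
  qed
  then show ?thesis by (intro exI[of _ M]) blast
qed

end


section \<open>Slim triangles and fixed points of abelian subgroups\<close>

locale hyperbolic_action = free_action V E G act U
  for V :: "'p set" and E :: "'p rel" and G :: "('a, 'm) monoid_scheme" (structure)
    and act :: "'a \<Rightarrow> 'p \<Rightarrow> 'p" and U :: "'p set" +
  fixes \<delta> :: nat
  assumes slim: "\<lbrakk>geo \<alpha> l; geo \<beta> m; geo \<kappa> n; \<alpha> 0 = \<kappa> 0; \<alpha> l = \<beta> 0; \<beta> m = \<kappa> n; i \<le> l\<rbrakk> \<Longrightarrow>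
    (\<exists>j\<le>m. d (\<alpha> i) (\<beta> j) \<le> \<delta>) \<or> (\<exists>j\<le>n. d (\<alpha> i) (\<kappa> j) \<le> \<delta>)"
begin

lemma geo_rev:
  assumes "geo \<gamma> n"
  shows "geo (\<lambda>i. \<gamma> (n - i)) n"
  unfolding geo_def
proof (intro conjI allI impI)
  fix i j assume ij: "i \<le> j" "j \<le> n"
  then have "d (\<gamma> (n - j)) (\<gamma> (n - i)) = j - i" using assms unfolding geo_def by auto
  then show "d (\<gamma> (n - i)) (\<gamma> (n - j)) = j - i"
    using gdist_sym[of "\<gamma> (n - i)" "\<gamma> (n - j)"] assms unfolding geo_def by simp
qed (use assms in \<open>auto simp: geo_def\<close>)

lemma geo_V: "geo \<gamma> n \<Longrightarrow> i \<le> n \<Longrightarrow> \<gamma> i \<in> V"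
  unfolding geo_def by blast

lemma geo_d: "geo \<gamma> n \<Longrightarrow> i \<le> j \<Longrightarrow> j \<le> n \<Longrightarrow> d (\<gamma> i) (\<gamma> j) = j - i"
  unfolding geo_def by blast

lemma act_geo: "geo \<gamma> n \<Longrightarrow> a \<in> carrier G \<Longrightarrow> geo (\<lambda>i. act a (\<gamma> i)) n"
  unfolding geo_def using act_gdist act_V by simp

text \<open>The diagonal \<open>\<kappa>\<close> cuts the quadrilateral into two slim triangles. The
  bounds on \<open>i\<close> keep \<open>\<gamma> i\<close> farther than \<open>2 * \<delta>\<close>
  from the short sides \<open>\<alpha>\<close> and \<open>\<beta>\<close>, so only the opposite side
  is left.\<close>

lemma quadrilateral:
  assumes \<gamma>: "geo \<gamma> n" and \<gamma>': "geo \<gamma>' n'"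
    and R: "d (\<gamma> 0) (\<gamma>' 0) \<le> R" "d (\<gamma> n) (\<gamma>' n') \<le> R"
    and i: "R + 2 * \<delta> < i" "i + R + 2 * \<delta> < n"
  shows "\<exists>j\<le>n'. d (\<gamma> i) (\<gamma>' j) \<le> 2 * \<delta>"
proof -
  have V: "\<gamma> 0 \<in> V" "\<gamma> n \<in> V" "\<gamma>' 0 \<in> V" "\<gamma>' n' \<in> V" "\<gamma> i \<in> V"
    using geo_V \<gamma> \<gamma>' i by auto
  obtain \<alpha> where \<alpha>: "geo \<alpha> (d (\<gamma> 0) (\<gamma>' 0))" "\<alpha> 0 = \<gamma> 0" "\<alpha> (d (\<gamma> 0) (\<gamma>' 0)) = \<gamma>' 0"
    using geo_exists V by metis
  obtain \<beta> where \<beta>: "geo \<beta> (d (\<gamma> n) (\<gamma>' n'))" "\<beta> 0 = \<gamma> n" "\<beta> (d (\<gamma> n) (\<gamma>' n')) = \<gamma>' n'"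
    using geo_exists V by metis
  obtain \<kappa> where \<kappa>: "geo \<kappa> (d (\<gamma> 0) (\<gamma>' n'))" "\<kappa> 0 = \<gamma> 0" "\<kappa> (d (\<gamma> 0) (\<gamma>' n')) = \<gamma>' n'"
    using geo_exists V by metis
  have far\<beta>: "2 * \<delta> < d (\<gamma> i) (\<beta> j)" if j: "j \<le> d (\<gamma> n) (\<gamma>' n')" for j
  proof -
    have "n - i \<le> d (\<gamma> i) (\<beta> j) + d (\<beta> j) (\<gamma> n)"
      using geo_d[OF \<gamma>, of i n] i gdist_triangle[OF V(5) geo_V[OF \<beta>(1) j] V(2)] by simp
    moreover have "d (\<beta> j) (\<gamma> n) = j"
      using geo_d[OF \<beta>(1) _ j, of 0] \<beta>(2) gdist_sym[OF V(2) geo_V[OF \<beta>(1) j]] by simp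
    ultimately show ?thesis using i R j by linarith
  qed
  have far\<alpha>: "2 * \<delta> < d (\<gamma> i) (\<alpha> j)" if j: "j \<le> d (\<gamma> 0) (\<gamma>' 0)" for j
  proof -
    have "i \<le> d (\<gamma> 0) (\<alpha> j) + d (\<alpha> j) (\<gamma> i)"
      using geo_d[OF \<gamma>, of 0 i] i gdist_triangle[OF V(1) geo_V[OF \<alpha>(1) j] V(5)] by simp
    moreover have "d (\<gamma> 0) (\<alpha> j) = j" using geo_d[OF \<alpha>(1) _ j, of 0] \<alpha>(2) by simp
    moreover have "d (\<alpha> j) (\<gamma> i) = d (\<gamma> i) (\<alpha> j)" using gdist_sym V(5) geo_V[OF \<alpha>(1) j] by blast
    ultimately show ?thesis using i R j by linarith
  qed
  have "(\<exists>j\<le>d (\<gamma> n) (\<gamma>' n'). d (\<gamma> i) (\<beta> j) \<le> \<delta>) \<or> (\<exists>j\<le>d (\<gamma> 0) (\<gamma>' n'). d (\<gamma> i) (\<kappa> j) \<le> \<delta>)"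
    using slim[OF \<gamma> \<beta>(1) \<kappa>(1), of i] \<beta> \<kappa> i by simp
  then obtain j where j: "j \<le> d (\<gamma> 0) (\<gamma>' n')" "d (\<gamma> i) (\<kappa> j) \<le> \<delta>"
    using far\<beta> by fastforce
  have \<kappa>j: "\<kappa> j \<in> V" using geo_V[OF \<kappa>(1)] j by simp
  have "(\<exists>l\<le>n'. d (\<kappa> j) (\<gamma>' (n' - l)) \<le> \<delta>) \<or> (\<exists>l\<le>d (\<gamma> 0) (\<gamma>' 0). d (\<kappa> j) (\<alpha> l) \<le> \<delta>)"
    using slim[OF \<kappa>(1) geo_rev[OF \<gamma>'] \<alpha>(1), of j] \<alpha> \<kappa> j by simp
  then show ?thesis
  proof
    assume "\<exists>l\<le>n'. d (\<kappa> j) (\<gamma>' (n' - l)) \<le> \<delta>"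
    then obtain l where l: "l \<le> n'" "d (\<kappa> j) (\<gamma>' (n' - l)) \<le> \<delta>" by blast
    then have "d (\<gamma> i) (\<gamma>' (n' - l)) \<le> 2 * \<delta>"
      using j(2) gdist_triangle[OF V(5) \<kappa>j geo_V[OF \<gamma>', of "n' - l"]] by simp
    then show ?thesis by (meson diff_le_self)
  next
    assume "\<exists>l\<le>d (\<gamma> 0) (\<gamma>' 0). d (\<kappa> j) (\<alpha> l) \<le> \<delta>"
    then obtain l where l: "l \<le> d (\<gamma> 0) (\<gamma>' 0)" "d (\<kappa> j) (\<alpha> l) \<le> \<delta>" by blast
    then have "d (\<gamma> i) (\<alpha> l) \<le> 2 * \<delta>"
      using j(2) gdist_triangle[OF V(5) \<kappa>j geo_V[OF \<alpha>(1) l(1)]] by simp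
    then show ?thesis using far\<alpha>[OF l(1)] by simp
  qed
qed

lemma many_in_fibre:
  assumes "finite A" "finite S" "f ` A \<subseteq> S" "M * card S < card A"
  obtains s where "s \<in> S" "M \<le> card {a\<in>A. f a = s}"
proof -
  have "\<exists>s\<in>S. M \<le> card {a\<in>A. f a = s}"
  proof (rule ccontr)
    assume "\<not> ?thesis"
    then have "\<And>s. s \<in> S \<Longrightarrow> card {a\<in>A. f a = s} \<le> M" by fastforce
    moreover have "card A = (\<Sum>s\<in>S. card {a\<in>A. f a = s})"
      using card_eq_sum[of A] sum.group[OF assms(1-3), of "\<lambda>_. 1::nat"] by simp
    ultimately show False
      using sum_bounded_above[of S "\<lambda>s. card {a\<in>A. f a = s}" M] assms(4) by (simp add: mult.commute)
  qed
  then show ?thesis using that by blast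
qed

text \<open>A long geodesic from \<open>x\<close> to \<open>z x\<close> with \<open>z\<close> in the abelian group is almost preserved by all
  short elements \<open>g\<^sup>i h\<^sup>j\<close>, and each shifts its middle part by a bounded amount. There are
  quadratically many such elements but only linearly many possible shifts, so many elements have the
  same shift, and their quotients almost fix a point of the geodesic.\<close>

lemma abelian_rank_two_fixes:
  assumes A: "subgroup A G" and comm: "\<And>a b. a \<in> A \<Longrightarrow> b \<in> A \<Longrightarrow> a \<otimes> b = b \<otimes> a"
    and tf: "\<And>a n. a \<in> A \<Longrightarrow> a \<noteq> \<one> \<Longrightarrow> a [^] (n :: nat) = \<one> \<Longrightarrow> n = 0"
    and gh: "g \<in> A" "h \<in> A" and inj: "inj (\<lambda>(i :: nat, j :: nat). g [^] i \<otimes> h [^] j)"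
    and x: "x \<in> V"
  shows "\<exists>y\<in>V. \<forall>a\<in>A. act a y = y"
proof -
  have AG: "a \<in> A \<Longrightarrow> a \<in> carrier G" for a using A subgroup.mem_carrier by metis
  let ?w = "\<lambda>(i :: nat, j :: nat). g [^] i \<otimes> h [^] j"
  have powA: "a [^] (i :: nat) \<in> A" if "a \<in> A" for a i
    using that by (induction i) (auto simp: A subgroup.one_closed subgroup.m_closed)
  have wA: "?w ij \<in> A" for ij using powA gh A subgroup.m_closed by (cases ij) fastforce
  define N where "N a = d x (act a x)" for a
  have Nmult: "N (a \<otimes> b) \<le> N a + N b" if "a \<in> A" "b \<in> A" for a b
  proof -
    have "N (a \<otimes> b) \<le> N a + d (act a x) (act a (act b x))"
      unfolding N_def using that AG act_mult x act_V gdist_triangle[of x "act a x" "act a (act b x)"] by simp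
    then show ?thesis using act_gdist that AG x act_V unfolding N_def by simp
  qed
  have Npow: "N (a [^] (i :: nat)) \<le> i * N a" if "a \<in> A" for a i
  proof (induction i)
    case 0
    then show ?case using act_one x by (simp add: N_def)
  next
    case (Suc i)
    then show ?case using Nmult[OF powA[OF that, of i] that] by simp
  qed
  have g1: "g \<noteq> \<one>"
  proof
    assume "g = \<one>"
    then have "?w (0, 0) = ?w (1, 0)" by simp
    then show False using inj by (metis injD prod.inject zero_neq_one)
  qed
  have quot: "inv b \<otimes> b' \<noteq> \<one>" if "b \<in> A" "b' \<in> A" "b \<noteq> b'" for b b'
    using that AG by (metis inv_equality inv_inv inv_closed)
  have "\<exists>y\<in>V. \<exists>c\<in>A. c \<noteq> \<one> \<and> act c y = y"
  proof (cases "\<exists>C. \<forall>a\<in>A. N a \<le> C")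
    \<comment> \<open>With bounded displacements every element almost fixes \<open>x\<close>, and
      \<open>M\<close> powers of \<open>g\<close>, written with second exponent 0, can serve as
      \<open>B\<close>.\<close>
    case True
    then obtain C where C: "\<And>a. a \<in> A \<Longrightarrow> N a \<le> C" by blast
    obtain M where M: "\<forall>p\<in>V. \<forall>g\<in>carrier G. \<forall>B\<subseteq>carrier G. finite B \<and> M \<le> card B \<and>
        (\<forall>b\<in>B. g \<otimes> b = b \<otimes> g \<and> d p (act b p) \<le> C) \<and> d p (act g p) \<le> C \<longrightarrow>
        (\<exists>y\<in>V. act g y = y \<or> (\<exists>b\<in>B. \<exists>b'\<in>B. b \<noteq> b' \<and> act b y = act b' y))"
      using many_almost_fixed_imp_fixed[of C C] by blast
    define B where "B = ?w ` ({..<M} \<times> {0})"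
    have "card B = M" unfolding B_def
      using card_image[OF inj_on_subset[OF inj subset_UNIV], of "{..<M} \<times> {0}"] by (simp add: card_cartesian_product)
    moreover have BA: "B \<subseteq> A" using wA unfolding B_def by blast
    moreover have "finite B" unfolding B_def by simp
    ultimately obtain y where y: "y \<in> V" "act g y = y \<or> (\<exists>b\<in>B. \<exists>b'\<in>B. b \<noteq> b' \<and> act b y = act b' y)"
      using M[rule_format, OF x, of g B] C comm gh AG unfolding N_def by (metis order_refl subset_iff)
    then show ?thesis
    proof (elim disjE)
      assume "\<exists>b\<in>B. \<exists>b'\<in>B. b \<noteq> b' \<and> act b y = act b' y"
      then obtain b b' where b: "b \<in> A" "b' \<in> A" "b \<noteq> b'" "act b y = act b' y" using BA by blast
      moreover have "inv b \<otimes> b' \<in> A" using b A subgroup.m_inv_closed subgroup.m_closed by metis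
      ultimately show ?thesis using y(1) quot act_eq_imp AG by metis
    qed (use g1 gh in blast)
  next
    case False
    \<comment> \<open>\<open>g\<close> will move \<open>\<gamma> T\<close> by at most
      \<open>N g + 4 * \<delta>\<close>; passing to a translate of \<open>p\<close> near
      \<open>\<gamma> T\<close> costs \<open>2 * \<delta>\<close> at each end.\<close>
    define \<rho> where "\<rho> = N g + 8 * \<delta>"
    obtain M where M: "\<forall>p\<in>V. \<forall>g\<in>carrier G. \<forall>B\<subseteq>carrier G. finite B \<and> M \<le> card B \<and>
        (\<forall>b\<in>B. g \<otimes> b = b \<otimes> g \<and> d p (act b p) \<le> 4 * \<delta>) \<and> d p (act g p) \<le> \<rho> \<longrightarrow>
        (\<exists>y\<in>V. act g y = y \<or> (\<exists>b\<in>B. \<exists>b'\<in>B. b \<noteq> b' \<and> act b y = act b' y))"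
      using many_almost_fixed_imp_fixed[of "4 * \<delta>" \<rho>] by blast
    define c where "c = N g + N h"
    \<comment> \<open>There are \<open>n * n\<close> monomials with exponents below
      \<open>n\<close>, and they displace \<open>x\<close> by at most \<open>R = n * c\<close>. The
      indices up to \<open>2 * T\<close> number \<open>2 * n * c + 4 * \<delta> + 3\<close>. This
      \<open>n\<close> makes the first count exceed \<open>Suc M\<close> times the second.\<close>
    define n where "n = Suc M * (2 * c + 4 * \<delta> + 3) + 2"
    define R where "R = n * c"
    \<comment> \<open>The least depth at which \<open>quadrilateral\<close> applies; a length of
      more than \<open>2 * T\<close> gives the same depth from the other end.\<close>
    define T where "T = R + 2 * \<delta> + 1"
    obtain z where z: "z \<in> A" "2 * T < N z" using False by (meson not_le)
    obtain \<gamma> where \<gamma>: "geo \<gamma> (N z)" "\<gamma> 0 = x" "\<gamma> (N z) = act z x"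
      using geo_exists[OF x act_V[OF AG[OF z(1)] x]] unfolding N_def by metis
    have near: "\<exists>j\<le>N z. d (\<gamma> T) (act a (\<gamma> j)) \<le> 2 * \<delta>" if a: "a \<in> A" "N a \<le> R" for a
    proof (rule quadrilateral[OF \<gamma>(1) act_geo[OF \<gamma>(1) AG[OF a(1)]], of R])
      show "d (\<gamma> 0) (act a (\<gamma> 0)) \<le> R" using a(2) \<gamma>(2) unfolding N_def by simp
      have "act a (act z x) = act z (act a x)" using act_mult AG a(1) z(1) comm x by metis
      then show "d (\<gamma> (N z)) (act a (\<gamma> (N z))) \<le> R"
        using a \<gamma>(3) act_gdist AG z(1) x act_V unfolding N_def by simp
    qed (use z in \<open>auto simp: T_def\<close>)
    have shift: "j \<le> N a + T + 2 * \<delta>" "T \<le> N a + j + 2 * \<delta>"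
      if "a \<in> A" "j \<le> N z" "d (\<gamma> T) (act a (\<gamma> j)) \<le> 2 * \<delta>" for a j
    proof -
      have v: "act a x \<in> V" "\<gamma> T \<in> V" "act a (\<gamma> j) \<in> V"
        using act_V AG that x geo_V[OF \<gamma>(1)] z by auto
      have "d (act a x) (act a (\<gamma> j)) = j"
        using act_gdist AG that x geo_V[OF \<gamma>(1)] geo_d[OF \<gamma>(1), of 0 j] \<gamma>(2) by simp
      moreover have "d x (\<gamma> T) = T" using geo_d[OF \<gamma>(1), of 0 T] \<gamma>(2) z by simp
      moreover have "d (act a x) (act a (\<gamma> j)) \<le> d (act a x) x + d x (\<gamma> T) + d (\<gamma> T) (act a (\<gamma> j))"
        using gdist_triangle[of "act a x" x "\<gamma> T"] gdist_triangle[of "act a x" "\<gamma> T" "act a (\<gamma> j)"] v x by fastforce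
      moreover have "d x (\<gamma> T) \<le> d x (act a x) + d (act a x) (act a (\<gamma> j)) + d (act a (\<gamma> j)) (\<gamma> T)"
        using gdist_triangle[of x "act a x" "\<gamma> T"] gdist_triangle[of "act a x" "act a (\<gamma> j)" "\<gamma> T"] v x by fastforce
      moreover have "d (act a x) x = N a" "d (act a (\<gamma> j)) (\<gamma> T) = d (\<gamma> T) (act a (\<gamma> j))"
        using gdist_sym v x unfolding N_def by auto
      ultimately show "j \<le> N a + T + 2 * \<delta>" "T \<le> N a + j + 2 * \<delta>"
        using that unfolding N_def by linarith+
    qed
    define A0 where "A0 = ?w ` ({..<n} \<times> {..<n})"
    have A0: "finite A0" "A0 \<subseteq> A" "card A0 = n * n"
      using wA card_image[OF inj_on_subset[OF inj subset_UNIV], of "{..<n} \<times> {..<n}"]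
      unfolding A0_def by (auto simp: card_cartesian_product)
    have NA0: "N a \<le> R" if "a \<in> A0" for a
    proof -
      obtain i j where ij: "i < n" "j < n" "a = g [^] i \<otimes> h [^] j" using \<open>a \<in> A0\<close> unfolding A0_def by auto
      then have "N a \<le> i * N g + j * N h"
        unfolding ij(3)
        using Nmult[OF powA[OF gh(1), of i] powA[OF gh(2), of j]] Npow[OF gh(1), of i] Npow[OF gh(2), of j] by linarith
      also have "\<dots> \<le> n * N g + n * N h" using ij by (intro add_mono mult_right_mono) auto
      finally show ?thesis unfolding R_def c_def by (simp add: distrib_left)
    qed
    obtain s where s: "\<And>a. a \<in> A0 \<Longrightarrow> s a \<le> N z \<and> d (\<gamma> T) (act a (\<gamma> (s a))) \<le> 2 * \<delta>"
      using near NA0 A0(2) by (metis subsetD)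
    have "s ` A0 \<subseteq> {..2 * T}"
    proof
      fix j assume "j \<in> s ` A0"
      then obtain a where a: "a \<in> A0" "j = s a" by blast
      then have "j \<le> N a + T + 2 * \<delta>" using shift(1) s A0(2) by blast
      then show "j \<in> {..2 * T}" using NA0[OF a(1)] unfolding T_def by simp
    qed
    moreover have "Suc M * card {..2 * T} < card A0"
    proof -
      have "Suc M * card {..2 * T} = Suc M * (2 * n * c + (4 * \<delta> + 3))" by (simp add: T_def R_def algebra_simps)
      also have "\<dots> \<le> Suc M * (2 * n * c + n * (4 * \<delta> + 3))"
        by (intro mult_left_mono add_left_mono) (auto simp: n_def)
      also have "\<dots> = n * (Suc M * (2 * c + 4 * \<delta> + 3))" by (simp add: algebra_simps)
      also have "\<dots> < n * n" by (simp add: n_def)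
      finally show ?thesis using A0 by simp
    qed
    ultimately obtain j where j: "j \<in> {..2 * T}" "Suc M \<le> card {a\<in>A0. s a = j}"
      using many_in_fibre[OF A0(1), of "{..2 * T}" s "Suc M"] by auto
    let ?A = "{a\<in>A0. s a = j}"
    define p where "p = \<gamma> j"
    have p: "p \<in> V" using geo_V[OF \<gamma>(1)] j z unfolding p_def by simp
    have \<gamma>T: "\<gamma> T \<in> V" using geo_V[OF \<gamma>(1)] z by simp
    have dA: "d (\<gamma> T) (act a p) \<le> 2 * \<delta>" "a \<in> A" if "a \<in> ?A" for a
      using s that A0(2) unfolding p_def by auto
    show ?thesis
    proof -
      \<comment> \<open>The fibre was asked to have \<open>Suc M\<close> elements so that it is
        nonempty even for \<open>M = 0\<close>.\<close>
      obtain a0 where a0: "a0 \<in> ?A" using j(2) by (cases "?A = {}") auto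
      \<comment> \<open>All elements of the fibre move \<open>p\<close> to within
        \<open>2 * \<delta>\<close> of \<open>\<gamma> T\<close>, so their quotients move
        \<open>p\<close> by at most \<open>4 * \<delta>\<close>.\<close>
      define B where "B = (\<lambda>a. inv a0 \<otimes> a) ` ?A"
      have a0A: "a0 \<in> A" "a0 \<in> carrier G" using dA(2)[OF a0] AG by auto
      have "inv a0 \<otimes> a \<in> A" if "a \<in> ?A" for a
        using subgroup.m_closed[OF A subgroup.m_inv_closed[OF A a0A(1)] dA(2)[OF that]] .
      then have BA: "B \<subseteq> A" unfolding B_def by blast
      have "inj_on (\<lambda>a. inv a0 \<otimes> a) ?A"
        using dA(2) AG a0A by (intro inj_onI) simp
      then have cardB: "M \<le> card B" unfolding B_def using j(2) by (simp add: card_image)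
      have finB: "finite B" unfolding B_def using A0(1) by simp
      have dB: "d p (act b p) \<le> 4 * \<delta>" if b: "b \<in> B" for b
      proof -
        obtain a where a: "a \<in> ?A" "b = inv a0 \<otimes> a" using b unfolding B_def by blast
        have aG: "a \<in> carrier G" using dA(2) AG a by blast
        have "d p (act b p) = d (act a0 p) (act a0 (act b p))"
          using act_gdist a0A(2) p act_V AG BA b by (metis subsetD)
        also have "act a0 (act b p) = act a p"
          using a act_mult[of "inv a0" a p] act_inv2 aG a0A(2) p act_V by simp
        also have "d (act a0 p) (act a p) \<le> d (act a0 p) (\<gamma> T) + d (\<gamma> T) (act a p)"
          using gdist_triangle act_V a0A(2) aG p \<gamma>T by blast
        also have "d (act a0 p) (\<gamma> T) = d (\<gamma> T) (act a0 p)" using gdist_sym act_V a0A(2) p \<gamma>T by blast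
        finally show ?thesis using dA(1)[OF a0] dA(1)[OF a(1)] by linarith
      qed
      have dg: "d p (act g p) \<le> \<rho>"
      proof -
        have gG: "g \<in> carrier G" using gh AG by blast
        have "N g \<le> R"
        proof -
          have "N g * 1 \<le> c * n" unfolding c_def n_def by (intro mult_mono) auto
          then show ?thesis unfolding R_def by (simp add: mult.commute)
        qed
        then obtain i where i: "i \<le> N z" "d (\<gamma> T) (act g (\<gamma> i)) \<le> 2 * \<delta>" using near gh by blast
        have v: "\<gamma> i \<in> V" "act g (\<gamma> i) \<in> V" "act g (\<gamma> T) \<in> V" "act a0 p \<in> V" "act g (act a0 p) \<in> V" "act g p \<in> V"
          using geo_V[OF \<gamma>(1)] i act_V gG \<gamma>T a0A p by auto
        have "d (\<gamma> i) (\<gamma> T) \<le> N g + 2 * \<delta>"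
        proof (cases "i \<le> T")
          case True
          then show ?thesis using geo_d[OF \<gamma>(1) True] shift(2)[OF gh(1) i] z by simp
        next
          case False
          then show ?thesis
            using geo_d[OF \<gamma>(1), of T i] shift(1)[OF gh(1) i] i gdist_sym[OF v(1) \<gamma>T] by simp
        qed
        then have "d (act g (\<gamma> i)) (act g (\<gamma> T)) \<le> N g + 2 * \<delta>" using act_gdist gG v \<gamma>T by simp
        then have 1: "d (\<gamma> T) (act g (\<gamma> T)) \<le> N g + 4 * \<delta>"
          using gdist_triangle[OF \<gamma>T v(2,3)] i by linarith
        have "d (act g (\<gamma> T)) (act g (act a0 p)) \<le> 2 * \<delta>"
          using act_gdist gG \<gamma>T v dA(1)[OF a0] by simp
        then have "d (act a0 p) (act g (act a0 p)) \<le> \<rho>"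
          using 1 gdist_triangle[OF v(4) \<gamma>T v(5)] gdist_triangle[OF \<gamma>T v(3,5)] dA(1)[OF a0]
            gdist_sym[OF v(4) \<gamma>T] unfolding \<rho>_def by linarith
        moreover have "act g (act a0 p) = act a0 (act g p)"
          using act_mult[OF gG a0A(2) p] act_mult[OF a0A(2) gG p] comm[OF gh(1) a0A(1)] by simp
        ultimately show ?thesis using act_gdist[OF a0A(2) p v(6)] by simp
      qed
      have "g \<in> carrier G" "B \<subseteq> carrier G" using gh AG BA by auto
      then obtain y where y: "y \<in> V" "act g y = y \<or> (\<exists>b\<in>B. \<exists>b'\<in>B. b \<noteq> b' \<and> act b y = act b' y)"
        using M[rule_format, OF p, of g B] finB cardB dB dg comm[OF gh(1)] BA by blast
      then show ?thesis
      proof (elim disjE)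
        assume "\<exists>b\<in>B. \<exists>b'\<in>B. b \<noteq> b' \<and> act b y = act b' y"
        then obtain b b' where b: "b \<in> A" "b' \<in> A" "b \<noteq> b'" "act b y = act b' y" using BA by blast
        moreover have "inv b \<otimes> b' \<in> A" using b A subgroup.m_inv_closed subgroup.m_closed by metis
        ultimately show ?thesis using y(1) quot act_eq_imp AG by metis
      qed (use g1 gh in blast)
    qed
  qed
  then obtain y c where c: "y \<in> V" "c \<in> A" "c \<noteq> \<one>" "act c y = y" by blast
  \<comment> \<open>\<open>c\<close> has infinite order, hence a unique fixed vertex, which every
    element commuting with \<open>c\<close> must preserve.\<close>
  have "act a y = y" if a: "a \<in> A" for a
  proof (rule infinite_order_fixes_one[of c, symmetric])
    show "act c (act a y) = act a y"
      using act_mult[of c a y] act_mult[of a c y] comm[OF a c(2)] AG a c by simp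
  qed (use c AG a act_V tf in auto)
  then show ?thesis using c(1) by blast
qed

end

section \<open>The coned-off Cayley graph\<close>

lemma with_proj_sel:
  "verts (with_proj K) = pverts K" "arcs (with_proj K) = parcs K"
  "tail (with_proj K) = fst" "head (with_proj K) = snd"
  by (simp_all add: with_proj_def)

lemma awalk_of_fun:
  assumes "\<And>i. i < n \<Longrightarrow> (f i, f (Suc i)) \<in> parcs K" "f 0 \<in> pverts K"
  defines "p \<equiv> map (\<lambda>i. (f i, f (Suc i))) [0..<n]"
  shows "pre_digraph.awalk (with_proj K) (f 0) p (f n)"
    and "pre_digraph.awalk_verts (with_proj K) (f 0) p = map f [0..<Suc n]"
proof -
  have cas: "pre_digraph.cas (with_proj K) (f 0) (map (\<lambda>i. (f i, f (Suc i))) [0..<n]) (f n)" for f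
  proof (induction n arbitrary: f)
    case (Suc n)
    have "[0..<Suc n] = 0 # map Suc [0..<n]" by (simp add: map_Suc_upt upt_conv_Cons)
    then show ?case using Suc[of "\<lambda>i. f (Suc i)"]
      by (simp add: pre_digraph.cas.simps with_proj_sel o_def del: upt_Suc)
  qed (simp add: pre_digraph.cas.simps)
  show "pre_digraph.awalk (with_proj K) (f 0) p (f n)"
    unfolding pre_digraph.awalk_def p_def using cas[of f] assms(1,2) by (auto simp: with_proj_sel)
  have "pre_digraph.awalk_verts (with_proj K) (f 0) (map (\<lambda>i. (f i, f (Suc i))) [0..<n]) = map f [0..<Suc n]" for f
  proof (induction n arbitrary: f)
    case (Suc n)
    have "[0..<Suc m] = 0 # map Suc [0..<m]" for m by (simp add: map_Suc_upt upt_conv_Cons)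
    note upt = this
    show ?case using Suc[of "\<lambda>i. f (Suc i)"]
      unfolding upt[of n] upt[of "Suc n"]
      by (simp add: pre_digraph.awalk_verts.simps with_proj_sel o_def del: upt_Suc)
  qed (simp add: pre_digraph.awalk_verts.simps)
  then show "pre_digraph.awalk_verts (with_proj K) (f 0) p = map f [0..<Suc n]" unfolding p_def .
qed

lemma awalk_imp_relpow:
  assumes "pre_digraph.awalk (with_proj K) u p v"
  shows "(u, v) \<in> parcs K ^^ length p"
proof -
  have "set p \<subseteq> parcs K" "pre_digraph.cas (with_proj K) u p v"
    using assms by (auto simp: pre_digraph.awalk_def with_proj_sel)
  then show ?thesis
  proof (induction p arbitrary: u)
    case (Cons e p)
    then have "(u, snd e) \<in> parcs K" "(snd e, v) \<in> parcs K ^^ length p"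
      by (auto simp: pre_digraph.cas.simps with_proj_sel)
    then show ?case by (simp del: relpow.simps add: relpow_Suc_I2)
  qed (simp add: pre_digraph.cas.simps)
qed

lemma (in sym_conn) slim_of_delta_hyperbolic:
  assumes K: "pverts K = V" "parcs K = E" and hyp: "delta_hyperbolic \<delta> (with_proj K)"
    and \<alpha>: "geo \<alpha> l" and \<beta>: "geo \<beta> m" and \<kappa>: "geo \<kappa> n"
    and ends: "\<alpha> 0 = \<kappa> 0" "\<alpha> l = \<beta> 0" "\<beta> m = \<kappa> n" and i: "i \<le> l"
  shows "(\<exists>j\<le>m. d (\<alpha> i) (\<beta> j) \<le> \<delta>) \<or> (\<exists>j\<le>n. d (\<alpha> i) (\<kappa> j) \<le> \<delta>)"
proof -
  let ?p = "\<lambda>\<gamma> n. map (\<lambda>i. (\<gamma> i, \<gamma> (Suc i))) [0..<n]"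
  have edge: "(\<gamma> i, \<gamma> (Suc i)) \<in> E" if "geo \<gamma> n" "i < n" for \<gamma> n i
  proof -
    have "d (\<gamma> i) (\<gamma> (Suc i)) = 1" "\<gamma> i \<in> V" "\<gamma> (Suc i) \<in> V" using that unfolding geo_def by auto
    then show ?thesis using gdist_walk[of "\<gamma> i" "\<gamma> (Suc i)"] by simp
  qed
  have verts: "pre_digraph.awalk_verts (with_proj K) (\<gamma> 0) (?p \<gamma> n) = map \<gamma> [0..<Suc n]"
    if "geo \<gamma> n" for \<gamma> n
    using awalk_of_fun(2)[of n \<gamma> K] edge[OF that] that K unfolding geo_def by simp
  have geod: "geodesic (with_proj K) (\<gamma> 0) (?p \<gamma> n) (\<gamma> n)" if "geo \<gamma> n" for \<gamma> n
    unfolding geodesic_def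
  proof (intro conjI allI impI)
    show "pre_digraph.awalk (with_proj K) (\<gamma> 0) (?p \<gamma> n) (\<gamma> n)"
      using awalk_of_fun(1)[of n \<gamma> K] edge[OF that] that K unfolding geo_def by simp
    fix q assume "pre_digraph.awalk (with_proj K) (\<gamma> 0) q (\<gamma> n)"
    then have "d (\<gamma> 0) (\<gamma> n) \<le> length q" using awalk_imp_relpow K gdist_le by metis
    then show "length (?p \<gamma> n) \<le> length q" using that unfolding geo_def by simp
  qed
  have "\<alpha> i \<in> set (pre_digraph.awalk_verts (with_proj K) (\<alpha> 0) (?p \<alpha> l))"
    unfolding verts[OF \<alpha>] using i by (auto simp del: upt_Suc)
  moreover have "geodesic (with_proj K) (\<alpha> 0) (?p \<alpha> l) (\<beta> 0)"
    "geodesic (with_proj K) (\<beta> 0) (?p \<beta> m) (\<kappa> n)"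
    "geodesic (with_proj K) (\<alpha> 0) (?p \<kappa> n) (\<kappa> n)"
    using geod[OF \<alpha>] geod[OF \<beta>] geod[OF \<kappa>] ends by simp_all
  ultimately have "\<exists>y \<in> set (pre_digraph.awalk_verts (with_proj K) (\<beta> 0) (?p \<beta> m))
      \<union> set (pre_digraph.awalk_verts (with_proj K) (\<alpha> 0) (?p \<kappa> n)).
      \<exists>s. pre_digraph.awalk (with_proj K) (\<alpha> i) s y \<and> length s \<le> \<delta>"
    using hyp unfolding delta_hyperbolic_def by blast
  then obtain y s where y: "y \<in> set (pre_digraph.awalk_verts (with_proj K) (\<beta> 0) (?p \<beta> m))
      \<union> set (pre_digraph.awalk_verts (with_proj K) (\<kappa> 0) (?p \<kappa> n))"
    "pre_digraph.awalk (with_proj K) (\<alpha> i) s y" "length s \<le> \<delta>"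
    unfolding ends(1) by blast
  have "d (\<alpha> i) y \<le> \<delta>" using awalk_imp_relpow[OF y(2)] gdist_le[of "\<alpha> i" y "length s"] y(3) K by simp
  moreover have "y \<in> \<beta> ` {0..<Suc m} \<union> \<kappa> ` {0..<Suc n}"
    using y(1) unfolding verts[OF \<beta>] verts[OF \<kappa>] by (simp del: upt_Suc)
  ultimately show ?thesis by fastforce
qed

text \<open>A shortest path from \<open>u\<close> to \<open>v\<close> among those avoiding
  \<open>y\<close>, closed up through \<open>y\<close>, is a simple cycle of length at most
  \<open>L + 2\<close> through the edge from \<open>y\<close> to \<open>u\<close>. It determines
  \<open>v\<close> as the tail of its last edge.\<close>

lemma finite_angle_nbrs_of_fine:
  assumes K: "pair_wf_digraph K" and irr: "\<And>x. (x, x) \<notin> parcs K" and sy: "sym (parcs K)"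
    and fine: "fine_graph (with_proj K)" and yu: "(y, u) \<in> parcs K"
  shows "finite (angle_nbrs (parcs K) y u L)"
proof -
  interpret pair_wf_digraph K by fact
  let ?C = "\<lambda>k. {c. pre_digraph.cycle (with_proj K) c \<and> length c = k \<and> (y, u) \<in> set c}"
  have "angle_nbrs (parcs K) y u L \<subseteq> (\<Union>k\<le>L + 2. (\<lambda>c. fst (last c)) ` ?C k)"
  proof
    fix v assume v: "v \<in> angle_nbrs (parcs K) y u L"
    then have yv: "(y, v) \<in> parcs K" unfolding angle_nbrs_def by simp
    obtain k where k: "k \<le> L" "(u, v) \<in> off (parcs K) y ^^ k"
      using v unfolding angle_nbrs_def avoid_def by blast
    let ?O = "off (parcs K) y"
    define m where "m = gdist ?O u v"
    have m: "(u, v) \<in> ?O ^^ m" "m \<le> k" "\<And>l. (u, v) \<in> ?O ^^ l \<Longrightarrow> m \<le> l"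
      unfolding m_def gdist_def using k(2) by (auto intro: LeastI Least_le)
    obtain f where f: "f 0 = u" "f m = v" "\<And>i. i < m \<Longrightarrow> (f i, f (Suc i)) \<in> ?O"
      using m(1) by (auto simp: relpow_fun_conv)
    have walk: "(f i, f j) \<in> ?O ^^ (j - i)" if "i \<le> j" "j \<le> m" for i j
      using f(3) that by (auto simp: relpow_fun_conv intro!: exI[of _ "\<lambda>l. f (i + l)"])
    \<comment> \<open>A repeated vertex would allow a shortcut that still avoids \<open>y\<close>,
      against the minimality of \<open>m\<close>.\<close>
    have "f i \<noteq> f j" if ij: "i < j" "j \<le> m" for i j
    proof
      assume "f i = f j"
      then have "(u, f j) \<in> ?O ^^ i" using walk[of 0 i] ij f(1) by simp
      moreover have "(f j, v) \<in> ?O ^^ (m - j)" using walk[of j m] ij f(2) by simp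
      ultimately have "(u, v) \<in> ?O ^^ (i + (m - j))" by (auto simp: relpow_add)
      then show False using m(3)[of "i + (m - j)"] ij by simp
    qed
    then have inj: "inj_on f {0..<Suc m}"
      by (intro linorder_inj_onI) auto
    have fy: "f i \<noteq> y" if "i \<le> m" for i
    proof (cases i)
      case 0
      then show ?thesis using f(1) yu irr by auto
    next
      case (Suc l)
      then show ?thesis using f(3)[of l] that unfolding off_def by auto
    qed
    define p where "p = map (\<lambda>i. (f i, f (Suc i))) [0..<m]"
    have uV: "f 0 \<in> pverts K" using in_arcsD2[OF yu] f(1) by simp
    have aw: "awalk u p v" "awalk_verts u p = map f [0..<Suc m]"
      using awalk_of_fun[of m f K] f uV unfolding p_def off_def by auto
    have "f i \<noteq> y" if "i \<in> {0..<Suc m}" for i using fy that by simp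
    then have "y \<notin> f ` {0..<Suc m}" by blast
    then have pw: "distinct (awalk_verts u p)" "y \<notin> set (awalk_verts u p)" "length p \<le> L"
      unfolding aw(2) using inj m(2) k(1)
      by (auto simp: distinct_map p_def less_Suc_eq_le simp del: upt_Suc)
    define c where "c = (y, u) # p @ [(v, y)]"
    have "awalk y c y"
    proof -
      have "(v, y) \<in> parcs K" using yv sy by (simp add: symD)
      then have "awalk v [(v, y)] y" using arc_implies_awalk by fastforce
      then have "awalk u (p @ [(v, y)]) y" using awalk_appendI[OF aw(1)] by simp
      then show ?thesis using yu unfolding c_def by (auto simp: awalk_Cons_iff)
    qed
    moreover have "tl (awalk_verts y c) = awalk_verts u p @ [y]"
    proof -
      have "awalk_verts a (p @ [(b, y)]) = awalk_verts a p @ [y]" if "cas a p b" for a b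
        using that by (induction p arbitrary: a) auto
      then show ?thesis using aw(1) unfolding c_def awalk_def by simp
    qed
    ultimately have "cycle c" unfolding cycle_def using pw by (auto simp: c_def)
    moreover have "(y, u) \<in> set c" "length c \<le> L + 2" "fst (last c) = v" using pw unfolding c_def by auto
    ultimately show "v \<in> (\<Union>k\<le>L + 2. (\<lambda>c. fst (last c)) ` ?C k)" by blast
  qed
  moreover have "finite (?C k)" for k using fine yu unfolding fine_graph_def by simp
  ultimately show ?thesis by (meson finite_UN finite_atMost finite_imageI finite_subset)
qed


section \<open>A group acting on its coned-off Cayley graph\<close>

definition coned_act :: "('a, 'm) monoid_scheme \<Rightarrow> 'a \<Rightarrow> 'a + 'a set \<Rightarrow> 'a + 'a set" where
  "coned_act G a x = (case x of Inl g \<Rightarrow> Inl (a \<otimes>\<^bsub>G\<^esub> g) | Inr S \<Rightarrow> Inr (a <#\<^bsub>G\<^esub> S))"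

locale coned_off = group G for G :: "'a monoid" (structure) +
  fixes X :: "'a set" and \<H> :: "'a set set" and \<delta> :: nat
  assumes finX: "finite X" and XG: "X \<subseteq> carrier G" and genX: "generate G X = carrier G"
    and fin\<H>: "finite \<H>" and sub\<H>: "\<And>H. H \<in> \<H> \<Longrightarrow> subgroup H G"
    and hyp: "delta_hyperbolic \<delta> (with_proj (coned_off_cayley_graph G X \<H>))"
    and fine: "fine_graph (with_proj (coned_off_cayley_graph G X \<H>))"
begin

definition "K = coned_off_cayley_graph G X \<H>"

abbreviation "W \<equiv> pverts K"
abbreviation "E \<equiv> parcs K"

lemma W_cases:
  assumes "x \<in> W"
  obtains g where "g \<in> carrier G" "x = Inl g" | g H where "g \<in> carrier G" "H \<in> \<H>" "x = Inr (g <#\<^bsub>G\<^esub> H)"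
  using assms unfolding K_def coned_off_cayley_graph_def by auto

lemma Inl_W: "Inl g \<in> W \<longleftrightarrow> g \<in> carrier G"
  and Inr_W: "g \<in> carrier G \<Longrightarrow> H \<in> \<H> \<Longrightarrow> Inr (g <#\<^bsub>G\<^esub> H) \<in> W"
  unfolding K_def coned_off_cayley_graph_def by auto

lemma E_cases:
  assumes "(x, y) \<in> E"
  obtains g h where "x = Inl g" "y = Inl h" "g \<in> carrier G" "h \<in> carrier G" "g \<noteq> h"
      "\<exists>s\<in>X. h = g \<otimes> s \<or> g = h \<otimes> s"
  | k g H where "x = Inl k" "y = Inr (g <#\<^bsub>G\<^esub> H)" "g \<in> carrier G" "H \<in> \<H>" "k \<in> g <#\<^bsub>G\<^esub> H"
  | g H k where "x = Inr (g <#\<^bsub>G\<^esub> H)" "y = Inl k" "g \<in> carrier G" "H \<in> \<H>" "k \<in> g <#\<^bsub>G\<^esub> H"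
  using assms unfolding K_def coned_off_cayley_graph_def cayley_graph_def by auto

lemma E_Inl: "g \<in> carrier G \<Longrightarrow> h \<in> carrier G \<Longrightarrow> g \<noteq> h \<Longrightarrow> s \<in> X \<Longrightarrow> h = g \<otimes> s \<or> g = h \<otimes> s \<Longrightarrow> (Inl g, Inl h) \<in> E"
  and E_Inr: "g \<in> carrier G \<Longrightarrow> H \<in> \<H> \<Longrightarrow> k \<in> g <#\<^bsub>G\<^esub> H \<Longrightarrow> (Inl k, Inr (g <#\<^bsub>G\<^esub> H)) \<in> E"
  and E_Inr2: "g \<in> carrier G \<Longrightarrow> H \<in> \<H> \<Longrightarrow> k \<in> g <#\<^bsub>G\<^esub> H \<Longrightarrow> (Inr (g <#\<^bsub>G\<^esub> H), Inl k) \<in> E"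
  unfolding K_def coned_off_cayley_graph_def cayley_graph_def by auto

lemma coset_sub: "g \<in> carrier G \<Longrightarrow> H \<in> \<H> \<Longrightarrow> g <#\<^bsub>G\<^esub> H \<subseteq> carrier G"
  using sub\<H> subgroup.subset l_coset_subset_G by metis

lemma mem_l_coset: "k \<in> g <#\<^bsub>G\<^esub> H \<longleftrightarrow> (\<exists>h\<in>H. k = g \<otimes> h)"
  unfolding l_coset_def by auto

lemma act_simps [simp]:
  "coned_act G a (Inl g) = Inl (a \<otimes> g)" "coned_act G a (Inr S) = Inr (a <#\<^bsub>G\<^esub> S)"
  by (simp_all add: coned_act_def)

lemma coset_assoc: "a \<in> carrier G \<Longrightarrow> g \<in> carrier G \<Longrightarrow> H \<in> \<H> \<Longrightarrow> a <#\<^bsub>G\<^esub> (g <#\<^bsub>G\<^esub> H) = (a \<otimes> g) <#\<^bsub>G\<^esub> H"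
  using sub\<H> subgroup.subset lcos_m_assoc by metis

lemma mem_translate:
  assumes "a \<in> carrier G" "g \<in> carrier G" "H \<in> \<H>" "k \<in> g <#\<^bsub>G\<^esub> H"
  shows "a \<otimes> k \<in> (a \<otimes> g) <#\<^bsub>G\<^esub> H"
proof -
  obtain h where "h \<in> H" "k = g \<otimes> h" using assms(4) mem_l_coset by blast
  moreover have "h \<in> carrier G" using \<open>h \<in> H\<close> sub\<H> assms(3) subgroup.mem_carrier by metis
  ultimately have "a \<otimes> k = (a \<otimes> g) \<otimes> h" using assms m_assoc by simp
  then show ?thesis using \<open>h \<in> H\<close> mem_l_coset by blast
qed

lemma E_act: 
  assumes "a \<in> carrier G" "(x, y) \<in> E"
  shows "(coned_act G a x, coned_act G a y) \<in> E"
  using assms(2)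
proof (cases rule: E_cases)
  case (1 g h)
  then obtain s where s: "s \<in> X" "h = g \<otimes> s \<or> g = h \<otimes> s" by blast
  then have "s \<in> carrier G" using XG by blast
  then have "a \<otimes> h = a \<otimes> g \<otimes> s \<or> a \<otimes> g = a \<otimes> h \<otimes> s" using s(2) 1 assms(1) m_assoc by metis
  moreover have "a \<otimes> g \<noteq> a \<otimes> h" using 1 assms(1) by simp
  ultimately show ?thesis using 1 assms(1) E_Inl[of "a \<otimes> g" "a \<otimes> h" s] s(1) by simp
next
  case (2 k g H)
  then show ?thesis using E_Inr[of "a \<otimes> g" H "a \<otimes> k"] mem_translate[of a g H k] assms(1)
    by (simp add: coset_assoc)
next
  case (3 g H k)
  then show ?thesis using E_Inr2[of "a \<otimes> g" H "a \<otimes> k"] mem_translate[of a g H k] assms(1)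
    by (simp add: coset_assoc)
qed

lemma E_sub: "E \<subseteq> W \<times> W"
proof
  fix e assume "e \<in> E"
  then obtain x y where e: "e = (x, y)" "(x, y) \<in> E" by (cases e) auto
  from e(2) show "e \<in> W \<times> W" unfolding e(1)
    by (cases rule: E_cases) (use coset_sub in \<open>auto simp: Inl_W Inr_W\<close>)
qed

lemma E_sym: "sym E"
proof (rule symI)
  fix x y assume "(x, y) \<in> E"
  then show "(y, x) \<in> E"
    by (cases rule: E_cases) (auto intro: E_Inl E_Inr E_Inr2)
qed

lemma E_irrefl: "(x, x) \<notin> E"
proof
  assume "(x, x) \<in> E"
  then show False by (cases rule: E_cases) auto
qed

lemma E_conn:
  assumes "x \<in> W" "y \<in> W"
  shows "\<exists>k. (x, y) \<in> E ^^ k"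
proof -
  have step: "(Inl a, Inl (a \<otimes> s)) \<in> E\<^sup>*" "(Inl a, Inl (a \<otimes> inv s)) \<in> E\<^sup>*"
    if "a \<in> carrier G" "s \<in> X" for a s
  proof -
    have s: "s \<in> carrier G" using that XG by blast
    show "(Inl a, Inl (a \<otimes> s)) \<in> E\<^sup>*"
      using E_Inl[of a "a \<otimes> s" s] that s by (cases "a = a \<otimes> s") auto
    show "(Inl a, Inl (a \<otimes> inv s)) \<in> E\<^sup>*"
      using E_Inl[of a "a \<otimes> inv s" s] that s by (cases "a = a \<otimes> inv s") (auto simp: m_assoc)
  qed
  have gen: "g \<in> carrier G \<and> (\<forall>a\<in>carrier G. (Inl a, Inl (a \<otimes> g)) \<in> E\<^sup>*)" if "g \<in> generate G X" for g
    using that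
  proof (induction rule: generate.induct)
    case (eng g h)
    then show ?case using m_assoc by (metis m_closed rtrancl_trans)
  qed (use step XG in auto)
  have base: "\<exists>g\<in>carrier G. (x, Inl g) \<in> E\<^sup>* \<and> (Inl g, x) \<in> E\<^sup>*" if "x \<in> W" for x
    using that
  proof (cases rule: W_cases)
    case (2 g H)
    have "g \<in> g <#\<^bsub>G\<^esub> H" using 2 sub\<H> subgroup.one_closed mem_l_coset r_one by metis
    then show ?thesis using 2 E_Inr E_Inr2 by blast
  qed auto
  obtain a b where ab: "a \<in> carrier G" "b \<in> carrier G" "(x, Inl a) \<in> E\<^sup>*" "(Inl b, y) \<in> E\<^sup>*"
    using base assms by metis
  have "(Inl a, Inl (a \<otimes> (inv a \<otimes> b))) \<in> E\<^sup>*" using gen[of "inv a \<otimes> b"] ab genX by simp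
  then have "(Inl a, Inl b) \<in> E\<^sup>*" using ab by (simp add: m_assoc[symmetric])
  then have "(x, y) \<in> E\<^sup>*" using ab by (meson rtrancl_trans)
  then show ?thesis using rtrancl_imp_relpow by blast
qed

lemma finite_angle_nbrs: "(y, u) \<in> E \<Longrightarrow> finite (angle_nbrs E y u L)"
proof (rule finite_angle_nbrs_of_fine)
  show "pair_wf_digraph K" using E_sub by unfold_locales auto
qed (use E_irrefl E_sym fine in \<open>auto simp: K_def\<close>)

text \<open>Finitely many pairs whose translates include all edges. If
  \<open>\<one> \<in> X\<close>, a pair of equal vertices occurs, which is not an edge; this is
  harmless, as \<open>E0\<close> only serves as the index set of a finite sum.\<close>

definition "E0 = (\<lambda>s. (Inl \<one>, Inl s)) ` (X \<union> m_inv G ` X)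
  \<union> (\<lambda>H. (Inl \<one>, Inr H)) ` \<H> \<union> (\<lambda>H. (Inr H, Inl \<one>)) ` \<H>"

lemma edge_representative:
  assumes "(x, y) \<in> E"
  obtains a x0 y0 where "a \<in> carrier G" "(x0, y0) \<in> E0" "x = coned_act G a x0" "y = coned_act G a y0"
  using assms
proof (cases rule: E_cases)
  case (1 g h)
  then obtain s where s: "s \<in> X" "h = g \<otimes> s \<or> g = h \<otimes> s" by blast
  then have sG: "s \<in> carrier G" using XG by blast
  then have "h = g \<otimes> s \<or> h = g \<otimes> inv s" using s 1 by (metis inv_solve_right)
  then obtain t where "t \<in> X \<union> m_inv G ` X" "h = g \<otimes> t" using s by blast
  then show ?thesis using that[of g "Inl \<one>" "Inl t"] 1 by (simp add: E0_def)
next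
  case (2 k g H)
  then have k: "k \<in> carrier G" using coset_sub by blast
  have "k <#\<^bsub>G\<^esub> H = g <#\<^bsub>G\<^esub> H"
    using 2 sub\<H> l_repr_independence by metis
  then show ?thesis using that[of k "Inl \<one>" "Inr H"] 2 k by (simp add: E0_def)
next
  case (3 g H k)
  then have k: "k \<in> carrier G" using coset_sub by blast
  have "k <#\<^bsub>G\<^esub> H = g <#\<^bsub>G\<^esub> H"
    using 3 sub\<H> l_repr_independence by metis
  then show ?thesis using that[of k "Inr H" "Inl \<one>"] 3 k by (simp add: E0_def)
qed

end

sublocale coned_off \<subseteq> sym_conn W E
  using E_sub E_sym E_conn by unfold_locales

context coned_off begin

lemma act_W: "a \<in> carrier G \<Longrightarrow> x \<in> W \<Longrightarrow> coned_act G a x \<in> W"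
  by (erule W_cases) (auto simp: Inl_W Inr_W coset_assoc)

lemma act_mult_W:
  "a \<in> carrier G \<Longrightarrow> b \<in> carrier G \<Longrightarrow> x \<in> W \<Longrightarrow> coned_act G (a \<otimes> b) x = coned_act G a (coned_act G b x)"
  by (erule W_cases) (auto simp: coset_assoc m_assoc)

lemma act_one_W: "x \<in> W \<Longrightarrow> coned_act G \<one> x = x"
  by (erule W_cases) (auto simp: coset_assoc)

lemma angle_nbrs_act:
  assumes a: "a \<in> carrier G" and y: "y \<in> W"
  shows "coned_act G a ` angle_nbrs E y u L \<subseteq> angle_nbrs E (coned_act G a y) (coned_act G a u) L"
proof -
  have inj: "v = y" if "v \<in> W" "coned_act G a v = coned_act G a y" for v
    using that y a act_mult_W[of "inv a" a] act_one_W by (metis inv_closed l_inv)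
  have "(coned_act G a u, coned_act G a v) \<in> off E (coned_act G a y) ^^ k" if "(u, v) \<in> off E y ^^ k" for v k
    using that
  proof (induction k arbitrary: v)
    case (Suc k)
    then obtain w where w: "(u, w) \<in> off E y ^^ k" "(w, v) \<in> off E y" by auto
    then have "(coned_act G a w, coned_act G a v) \<in> off E (coned_act G a y)"
      unfolding off_def using E_act[OF a] inj E_sub by auto
    then show ?case using Suc.IH[OF w(1)] by auto
  qed auto
  then show ?thesis unfolding angle_nbrs_def avoid_def using E_act[OF a] by blast
qed

text \<open>Left translation preserves angles, and every edge is a translate of a pair in the finite
  set \<open>E0\<close>, so the sum over \<open>E0\<close> bounds all angle balls at once.\<close>

lemma uniformly_fine_K:
  "\<exists>F. \<forall>L y u. (y, u) \<in> E \<longrightarrow> finite (angle_nbrs E y u L) \<and> card (angle_nbrs E y u L) \<le> F L"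
proof (intro exI allI impI conjI)
  fix L y u assume yu: "(y, u) \<in> E"
  show "finite (angle_nbrs E y u L)" using finite_angle_nbrs yu .
  obtain a y0 u0 where a: "a \<in> carrier G" "(y0, u0) \<in> E0" "y = coned_act G a y0" "u = coned_act G a u0"
    using edge_representative[OF yu] .
  have fE0: "finite E0" unfolding E0_def using finX fin\<H> by simp
  have yW: "y \<in> W" "u \<in> W" using yu E_sub by auto
  have H1: "\<one> <#\<^bsub>G\<^esub> H = H" if "H \<in> \<H>" for H using sub\<H> that subgroup.subset lcos_mult_one by metis
  have W0: "y0 \<in> W" "u0 \<in> W" using a(2) XG Inl_W Inr_W[of \<one>] H1 unfolding E0_def by auto
  have bk: "coned_act G (inv a) (coned_act G a v) = v" "coned_act G a (coned_act G (inv a) v) = v" if "v \<in> W" for v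
    using act_mult_W[of "inv a" a v] act_mult_W[of a "inv a" v] act_one_W a(1) that by auto
  have "card (angle_nbrs E y u L) \<le> card (coned_act G (inv a) ` angle_nbrs E y u L)"
  proof -
    have "inj_on (coned_act G (inv a)) (angle_nbrs E y u L)"
      using bk(2) E_sub unfolding angle_nbrs_def by (intro inj_onI) (metis (no_types, lifting) mem_Collect_eq mem_Sigma_iff subsetD)
    then show ?thesis by (simp add: card_image)
  qed
  also have "\<dots> \<le> card (angle_nbrs E y0 u0 L)"
  proof (rule card_mono)
    have "(y0, u0) \<in> E" using E_act[OF inv_closed[OF a(1)] yu] bk W0 unfolding a(3,4) by simp
    then show "finite (angle_nbrs E y0 u0 L)" using finite_angle_nbrs by blast
    show "coned_act G (inv a) ` angle_nbrs E y u L \<subseteq> angle_nbrs E y0 u0 L"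
      using angle_nbrs_act[OF inv_closed[OF a(1)] yW(1), of u L] bk W0 unfolding a(3,4) by simp
  qed
  also have "\<dots> \<le> (\<Sum>(y0, u0)\<in>E0. card (angle_nbrs E y0 u0 L))"
    using member_le_sum[of "(y0, u0)" E0 "\<lambda>(y0, u0). card (angle_nbrs E y0 u0 L)"] a(2) fE0 by auto
  finally show "card (angle_nbrs E y u L) \<le> (\<Sum>(y0, u0)\<in>E0. card (angle_nbrs E y0 u0 L))" .
qed

end

sublocale coned_off \<subseteq> hyperbolic_action W E G "coned_act G" "range Inl" \<delta>
proof unfold_locales
  fix x y assume "(x, y) \<in> E"
  then show "x \<in> range Inl \<or> y \<in> range Inl" by (cases rule: E_cases) auto
next
  fix a x assume "a \<in> carrier G" "x \<in> range Inl" "x \<in> W" "coned_act G a x = x"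
  then show "a = \<one>" using Inl_W by (auto simp: r_cancel_one)
qed (use act_W act_one_W act_mult_W E_act uniformly_fine_K slim_of_delta_hyperbolic[of K, OF HOL.refl HOL.refl] hyp in
      \<open>auto simp: K_def\<close>)

context coned_off begin

text \<open>\<open>P\<close> is the stabilizer of a vertex \<open>y\<close> fixed by
  \<open>A\<close>. If \<open>c\<close> and its conjugate by \<open>t\<close> both fix
  \<open>y\<close>, then \<open>c\<close> fixes \<open>y\<close> and the image of \<open>y\<close>
  under the inverse of \<open>t\<close>; these coincide, as an element of infinite order fixes at
  most one vertex.\<close>

lemma peripheral_exists:
  assumes proper: "\<And>H. H \<in> \<H> \<Longrightarrow> H \<noteq> carrier G"
    and A: "subgroup A G" and comm: "\<And>a b. a \<in> A \<Longrightarrow> b \<in> A \<Longrightarrow> a \<otimes> b = b \<otimes> a"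
    and tf: "\<And>a n. a \<in> A \<Longrightarrow> a \<noteq> \<one> \<Longrightarrow> a [^] (n :: nat) = \<one> \<Longrightarrow> n = 0"
    and gh: "g \<in> A" "h \<in> A" and inj: "inj (\<lambda>(i :: nat, j :: nat). g [^] i \<otimes> h [^] j)"
  shows "\<exists>P. subgroup P G \<and> P \<noteq> carrier G \<and> A \<subseteq> P \<and>
    (\<forall>c\<in>P. \<forall>t\<in>carrier G. (\<forall>n :: nat. c [^] n = \<one> \<longrightarrow> n = 0) \<and> t \<otimes> c \<otimes> inv t \<in> P \<longrightarrow> t \<in> P)"
proof -
  let ?act = "coned_act G"
  obtain y where y: "y \<in> W" "\<And>a. a \<in> A \<Longrightarrow> ?act a y = y"
  proof -
    have "\<exists>y\<in>W. \<forall>a\<in>A. ?act a y = y"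
      by (rule abelian_rank_two_fixes[of A g h "Inl \<one>"])
        (fact A, fact comm, fact tf, fact gh(1), fact gh(2), fact inj, simp add: Inl_W)
    then show thesis using that by blast
  qed
  define P where "P = {a \<in> carrier G. ?act a y = y}"
  have AG: "A \<subseteq> carrier G" using A subgroup.subset by blast
  have "subgroup P G"
    using act_one[OF y(1)] act_inv_fix[OF _ y(1)] act_mult[OF _ _ y(1)]
    by unfold_locales (auto simp: P_def)
  moreover have "A \<subseteq> P" using y(2) AG unfolding P_def by blast
  moreover have "P \<noteq> carrier G"
  proof
    assume P: "P = carrier G"
    show False using y(1)
    proof (cases rule: W_cases)
      \<comment> \<open>A group element has trivial stabilizer, so \<open>g\<close> would be
        trivial, against injectivity.\<close>
      case (1 k)
      have "g = \<one>" using y(2)[OF gh(1)] 1 AG gh(1) by auto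
      then have "(0 :: nat, 0 :: nat) = (1, 0)" by (intro injD[OF inj]) simp
      then show False by simp
    next
      case (2 k H)
      \<comment> \<open>If the whole group fixes the coset of \<open>H\<close> by \<open>k\<close>,
        then so does the conjugate of any \<open>a\<close> by \<open>k\<close>, which says that
        \<open>a\<close> lies in \<open>H\<close>.\<close>
      have "carrier G \<subseteq> H"
      proof
        fix a assume a: "a \<in> carrier G"
        have "k \<otimes> a \<otimes> inv k \<in> P" using P a 2 by simp
        then have "(k \<otimes> a \<otimes> inv k) <#\<^bsub>G\<^esub> (k <#\<^bsub>G\<^esub> H) = k <#\<^bsub>G\<^esub> H" unfolding P_def 2 by simp
        then have eq: "(k \<otimes> a) <#\<^bsub>G\<^esub> H = k <#\<^bsub>G\<^esub> H"
          using 2 a coset_assoc by (simp add: m_assoc)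
        have "k \<otimes> a \<in> (k \<otimes> a) <#\<^bsub>G\<^esub> H" using 2 a sub\<H> subgroup.one_closed mem_l_coset r_one m_closed by metis
        then obtain h where "h \<in> H" "k \<otimes> a = k \<otimes> h" using eq mem_l_coset by auto
        then show "a \<in> H" using 2 a sub\<H> subgroup.mem_carrier Units_l_cancel Units_eq by metis
      qed
      then show False using proper sub\<H> 2 subgroup.subset by blast
    qed
  qed
  moreover have "t \<in> P"
    if c: "c \<in> P" "\<And>n :: nat. c [^] n = \<one> \<Longrightarrow> n = 0" and t: "t \<in> carrier G" "t \<otimes> c \<otimes> inv t \<in> P" for c t
  proof -
    have cG: "c \<in> carrier G" "?act c y = y" using c(1) unfolding P_def by auto
    have ty: "?act (inv t) y \<in> W" using act_V t y(1) by simp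
    have "?act (inv t) y = ?act (inv t) (?act (t \<otimes> c \<otimes> inv t) y)" using t unfolding P_def by simp
    also have "\<dots> = ?act (inv t \<otimes> (t \<otimes> c \<otimes> inv t)) y" using act_mult t cG y(1) by simp
    also have "inv t \<otimes> (t \<otimes> c \<otimes> inv t) = c \<otimes> inv t" using t cG by (simp add: m_assoc[symmetric])
    also have "?act (c \<otimes> inv t) y = ?act c (?act (inv t) y)" using act_mult t cG y(1) by simp
    finally have "y = ?act (inv t) y"
      using infinite_order_fixes_one[OF cG(1) c(2) y(1) cG(2) ty] by simp
    then have "?act (inv (inv t)) y = y" using act_inv_fix[of "inv t" y] t y(1) by simp
    then show ?thesis using t unfolding P_def by simp
  qed
  ultimately show ?thesis by blast
qed

end

text \<open>The study of the automorphism group uses relative hyperbolicity only in this graph-free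
  form. The pair \<open>g\<close>, \<open>h\<close> witnesses rank at least two, and injectivity on
  natural exponents is what the count of monomials consumes.\<close>

theorem relatively_hyperbolic_peripheral:
  fixes G :: "'a monoid" (structure)
  assumes "group G" "relatively_hyperbolic G"
    and "subgroup A G" and "\<And>a b. a \<in> A \<Longrightarrow> b \<in> A \<Longrightarrow> a \<otimes> b = b \<otimes> a"
    and "\<And>a n. a \<in> A \<Longrightarrow> a \<noteq> \<one> \<Longrightarrow> a [^] (n :: nat) = \<one> \<Longrightarrow> n = 0"
    and "g \<in> A" "h \<in> A" and "inj (\<lambda>(i :: nat, j :: nat). g [^] i \<otimes> h [^] j)"
  shows "\<exists>P. subgroup P G \<and> P \<noteq> carrier G \<and> A \<subseteq> P \<and>
    (\<forall>c\<in>P. \<forall>t\<in>carrier G. (\<forall>n :: nat. c [^] n = \<one> \<longrightarrow> n = 0) \<and> t \<otimes> c \<otimes> inv t \<in> P \<longrightarrow> t \<in> P)"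
proof -
  obtain \<H> where H: "finite \<H>" "\<forall>H\<in>\<H>. fin_gen_subgroup G H \<and> H \<noteq> carrier G" "relatively_hyperbolic_wrt G \<H>"
    using assms(2) unfolding relatively_hyperbolic_def by blast
  then obtain X \<delta> where X: "finite X" "X \<subseteq> carrier G" "generate G X = carrier G"
    "delta_hyperbolic \<delta> (with_proj (coned_off_cayley_graph G X \<H>))"
    "fine_graph (with_proj (coned_off_cayley_graph G X \<H>))"
    unfolding relatively_hyperbolic_wrt_def by blast
  interpret group G by fact
  have "subgroup H G" if "H \<in> \<H>" for H using H(2) that unfolding fin_gen_subgroup_def by blast
  then interpret coned_off G X \<H> \<delta>
    using X H(1) by (intro coned_off.intro coned_off_axioms.intro assms(1))
  have "H \<noteq> carrier G" if "H \<in> \<H>" for H using H(2) that by blast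
  note nH = this
  show ?thesis
    by (rule peripheral_exists[of A g h])
      (fact nH, fact assms(3), fact assms(4), fact assms(5), fact assms(6), fact assms(7), fact assms(8))
qed

section \<open>Automorphisms of right-angled Artin groups\<close>

fun wprod :: "('a, 'm) monoid_scheme \<Rightarrow> ('x \<Rightarrow> 'a) \<Rightarrow> 'x word \<Rightarrow> 'a" where
  "wprod H f [] = \<one>\<^bsub>H\<^esub>"
| "wprod H f ((x, b) # w) = (if b then f x else inv\<^bsub>H\<^esub> f x) \<otimes>\<^bsub>H\<^esub> wprod H f w"

context group begin

lemma int_pow_commute:
  assumes c: "x \<in> carrier G" "y \<in> carrier G" "x \<otimes> y = y \<otimes> x"
  shows "x [^] (i :: int) \<otimes> y = y \<otimes> x [^] i"
proof (cases i rule: int_cases)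
  case (nonneg n)
  then show ?thesis using group_commutes_pow c by (simp add: int_pow_int)
next
  case (neg n)
  let ?z = "x [^] Suc n"
  have "?z \<otimes> y = y \<otimes> ?z" using group_commutes_pow c by blast
  moreover have "?z \<in> carrier G" using c by blast
  ultimately have "inv ?z \<otimes> y = y \<otimes> inv ?z"
    using c by (metis inv_closed inv_solve_left inv_solve_right m_assoc m_closed)
  then show ?thesis unfolding neg using c by (simp add: int_pow_neg_int del: of_nat_Suc nat_pow_Suc)
qed

lemma int_pow_commute2:
  assumes c: "x \<in> carrier G" "y \<in> carrier G" "x \<otimes> y = y \<otimes> x"
  shows "x [^] (i :: int) \<otimes> y [^] (j :: int) = y [^] j \<otimes> x [^] i"
  using int_pow_commute[of y "x [^] i" j] int_pow_commute[OF c, of i] c by simp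

lemma wprod_closed: "f \<in> X \<rightarrow> carrier G \<Longrightarrow> w \<in> words X \<Longrightarrow> wprod G f w \<in> carrier G"
proof (induction w)
  case (Cons l w)
  obtain x b where l: "l = (x, b)" by (cases l)
  then have "f x \<in> carrier G" using Cons.prems by auto
  then show ?case using Cons l by auto
qed simp

lemma wprod_append:
  "f \<in> X \<rightarrow> carrier G \<Longrightarrow> u \<in> words X \<Longrightarrow> w \<in> words X \<Longrightarrow>
    wprod G f (u @ w) = wprod G f u \<otimes> wprod G f w"
proof (induction u)
  case (Cons l u)
  obtain x b where l: "l = (x, b)" by (cases l)
  have "f x \<in> carrier G" using Cons.prems l by auto
  then show ?case
    using Cons wprod_closed[of f X u] wprod_closed[of f X w] l by (simp add: m_assoc)
qed (simp add: wprod_closed)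

lemma wprod_pres_rel:
  assumes f: "f \<in> X \<rightarrow> carrier G" and R: "\<And>r. r \<in> R \<Longrightarrow> r \<in> words X \<Longrightarrow> wprod G f r = \<one>"
  shows "(u, w) \<in> pres_rel X R \<Longrightarrow> wprod G f u = wprod G f w"
proof (induction rule: pres_rel.induct)
  case (cancel u w x b)
  have "f x \<in> carrier G" using f cancel by auto
  then have "wprod G f [(x, b), (x, \<not> b)] = \<one>" by simp
  then show ?case
    using cancel f wprod_append[OF f, of u "[(x, b), (x, \<not> b)] @ w"]
      wprod_append[OF f, of "[(x, b), (x, \<not> b)]" w] wprod_append[OF f, of u w] wprod_closed[OF f]
    by (simp del: wprod.simps)
next
  case (relator u w r)
  then show ?case
    using R f wprod_append[OF f, of u "r @ w"] wprod_append[OF f, of r w]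
      wprod_append[OF f, of u w] wprod_closed[OF f] by simp
qed auto

end

lemma presented_carrier: "A \<in> carrier (presented_group X R) \<longleftrightarrow> (\<exists>w\<in>words X. A = pres_rel X R `` {w})"
  by (auto simp: presented_group_def quotient_def)

text \<open>Evaluation of words sends relators to the unit and is therefore constant on each class,
  so the representative chosen in \<open>\<phi>\<close> does not matter.\<close>

theorem presented_group_hom:
  assumes H: "group H" and f: "f \<in> X \<rightarrow> carrier H"
    and R: "\<And>r. r \<in> R \<Longrightarrow> r \<in> words X \<Longrightarrow> wprod H f r = \<one>\<^bsub>H\<^esub>"
  shows "\<exists>\<phi>\<in>hom (presented_group X R) H. \<forall>x\<in>X. \<phi> (pres_rel X R `` {[(x, True)]}) = f x"
proof -
  interpret H: group H by fact
  define \<phi> where "\<phi> A = wprod H f (SOME w. w \<in> A)" for A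
  have \<phi>: "\<phi> (pres_rel X R `` {w}) = wprod H f w" if "w \<in> words X" for w
  proof -
    have "w \<in> pres_rel X R `` {w}" using that by (simp add: pres_rel.refl)
    then have "(SOME u. u \<in> pres_rel X R `` {w}) \<in> pres_rel X R `` {w}" by (rule someI)
    then show ?thesis unfolding \<phi>_def using H.wprod_pres_rel[OF f R] by (metis Image_singleton_iff)
  qed
  have "\<phi> \<in> hom (presented_group X R) H"
  proof (rule homI)
    fix A assume "A \<in> carrier (presented_group X R)"
    then show "\<phi> A \<in> carrier H" using \<phi> H.wprod_closed[OF f] by (auto simp: presented_carrier)
  next
    fix A B assume "A \<in> carrier (presented_group X R)" "B \<in> carrier (presented_group X R)"
    then obtain a b where "a \<in> words X" "b \<in> words X" "A = pres_rel X R `` {a}" "B = pres_rel X R `` {b}"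
      unfolding presented_carrier by blast
    then show "\<phi> (A \<otimes>\<^bsub>presented_group X R\<^esub> B) = \<phi> A \<otimes>\<^bsub>H\<^esub> \<phi> B"
      using \<phi> H.wprod_append[OF f] by (simp add: presented_group_mult)
  qed
  moreover have "\<phi> (pres_rel X R `` {[(x, True)]}) = f x" if "x \<in> X" for x
  proof -
    have "f x \<in> carrier H" using that f by auto
    then show ?thesis using \<phi>[of "[(x, True)]"] that by simp
  qed
  ultimately show ?thesis by blast
qed

lemma presented_group_induct [consumes 1, case_names one gen inv]:
  fixes X :: "'x set" and R :: "'x word set"
  defines "G \<equiv> presented_group X R" and "g \<equiv> \<lambda>x. pres_rel X R `` {[(x, True)]}"
  assumes A: "A \<in> carrier G" and one: "P \<one>\<^bsub>G\<^esub>"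
    and gen: "\<And>x B. x \<in> X \<Longrightarrow> B \<in> carrier G \<Longrightarrow> P B \<Longrightarrow> P (g x \<otimes>\<^bsub>G\<^esub> B)"
    and inv: "\<And>x B. x \<in> X \<Longrightarrow> B \<in> carrier G \<Longrightarrow> P B \<Longrightarrow> P (inv\<^bsub>G\<^esub> g x \<otimes>\<^bsub>G\<^esub> B)"
  shows "P A"
proof -
  interpret group G unfolding G_def by (rule group_presented_group)
  have car: "B \<in> carrier G \<longleftrightarrow> (\<exists>w\<in>words X. B = pres_rel X R `` {w})" for B
    unfolding G_def by (rule presented_carrier)
  have gcar: "g x \<in> carrier G" if "x \<in> X" for x
    unfolding car g_def using that by (intro bexI[of _ "[(x, True)]"]) auto
  have "P (pres_rel X R `` {w})" if "w \<in> words X" for w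
    using that
  proof (induction w)
    case Nil
    then show ?case using one by (simp add: G_def presented_group_def)
  next
    case (Cons l w)
    obtain x b where l: "l = (x, b)" by (cases l)
    have x: "x \<in> X" "w \<in> words X" using Cons l by auto
    have w: "pres_rel X R `` {w} \<in> carrier G" unfolding car using x by blast
    have split: "pres_rel X R `` {l # w} = pres_rel X R `` {[(x, b)]} \<otimes>\<^bsub>G\<^esub> pres_rel X R `` {w}"
      unfolding G_def l using presented_group_mult[of "[(x, b)]" X w R] x by simp
    show ?case
    proof (cases b)
      case True
      then show ?thesis using gen[OF x(1) w] Cons.IH[OF x(2)] split unfolding g_def by simp
    next
      case False
      have "pres_rel X R `` {[(x, False)]} \<otimes>\<^bsub>G\<^esub> g x = pres_rel X R `` {[(x, False), (x, True)]}"
        unfolding G_def g_def using presented_group_mult[of "[(x, False)]" X "[(x, True)]" R] x by simp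
      also have "\<dots> = pres_rel X R `` {[]}"
        using pres_rel.cancel[of "[]" X "[]" x False R] x by (intro equiv_class_eq[OF equiv_pres_rel]) simp
      also have "\<dots> = \<one>\<^bsub>G\<^esub>" by (simp add: G_def presented_group_def)
      finally have "pres_rel X R `` {[(x, False)]} = inv\<^bsub>G\<^esub> g x"
        using inv_equality[of _ "g x"] gcar[OF x(1)] car[of "pres_rel X R `` {[(x, False)]}"] x(1) by auto
      then show ?thesis using inv[OF x(1) w] Cons.IH[OF x(2)] split False by simp
    qed
  qed
  then show ?thesis using A unfolding car by blast
qed

section \<open>The Artin group and its automorphism group\<close>

locale raag_graph = pair_graph \<Gamma> for \<Gamma> :: "'v pair_pre_digraph"
begin

abbreviation "V \<equiv> pverts \<Gamma>"
abbreviation "A \<equiv> raag \<Gamma>"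
abbreviation "gen \<equiv> raag_gen \<Gamma>"
abbreviation "Aut \<equiv> AutoGroup A"

abbreviation mult_A (infixl "\<cdot>" 70) where "x \<cdot> y \<equiv> x \<otimes>\<^bsub>A\<^esub> y"
abbreviation pow_A (infixr "\<up>" 75) where "x \<up> i \<equiv> x [^]\<^bsub>A\<^esub> (i :: int)"
abbreviation mult_Aut (infixl "\<odot>" 70) where "s \<odot> t \<equiv> s \<otimes>\<^bsub>Aut\<^esub> t"

sublocale A: group A
  unfolding raag_def by (rule group_presented_group)

sublocale Aut: group Aut
  by (rule A.AutoGroup)

lemma edge_sym: "(u, v) \<in> parcs \<Gamma> \<Longrightarrow> (v, u) \<in> parcs \<Gamma>"
  using arcs_symmetric by blast

lemma edge_V: "(u, v) \<in> parcs \<Gamma> \<Longrightarrow> u \<in> V \<and> v \<in> V"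
  using in_arcsD1 in_arcsD2 by blast

lemma edge_irrefl: "(u, u) \<notin> parcs \<Gamma>"
  using no_loops by fastforce

lemma gen_closed [simp, intro]: "v \<in> V \<Longrightarrow> gen v \<in> carrier A"
  unfolding raag_def raag_gen_def presented_carrier by (intro bexI[of _ "[(v, True)]"]) auto

lemma raag_hom:
  assumes H: "group H" and f: "\<And>v. v \<in> V \<Longrightarrow> f v \<in> carrier H"
    and comm: "\<And>u v. (u, v) \<in> parcs \<Gamma> \<Longrightarrow> f u \<otimes>\<^bsub>H\<^esub> f v = f v \<otimes>\<^bsub>H\<^esub> f u"
  obtains \<phi> where "\<phi> \<in> hom A H" "\<And>v. v \<in> V \<Longrightarrow> \<phi> (gen v) = f v"
proof -
  interpret H: group H by fact
  have "wprod H f r = \<one>\<^bsub>H\<^esub>" if r: "r \<in> raag_relators \<Gamma>" for r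
  proof -
    obtain u v where uv: "(u, v) \<in> parcs \<Gamma>" "r = [(u, True), (v, True), (u, False), (v, False)]"
      using r unfolding raag_relators_def by blast
    have c: "f u \<in> carrier H" "f v \<in> carrier H" using f edge_V uv by auto
    have "f u \<otimes>\<^bsub>H\<^esub> (f v \<otimes>\<^bsub>H\<^esub> (inv\<^bsub>H\<^esub> f u \<otimes>\<^bsub>H\<^esub> inv\<^bsub>H\<^esub> f v)) = (f u \<otimes>\<^bsub>H\<^esub> f v) \<otimes>\<^bsub>H\<^esub> inv\<^bsub>H\<^esub> (f v \<otimes>\<^bsub>H\<^esub> f u)"
      using c by (simp add: H.m_assoc H.inv_mult_group)
    also have "\<dots> = \<one>\<^bsub>H\<^esub>" using c comm[OF uv(1)] by simp
    finally show ?thesis using c uv by simp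
  qed
  then show thesis
    using presented_group_hom[OF H, of f V "raag_relators \<Gamma>"] f that unfolding raag_def raag_gen_def by blast
qed

lemma raag_induct [consumes 1, case_names one gen inv]:
  assumes "x \<in> carrier A" "P \<one>\<^bsub>A\<^esub>"
    "\<And>v y. v \<in> V \<Longrightarrow> y \<in> carrier A \<Longrightarrow> P y \<Longrightarrow> P (gen v \<cdot> y)"
    "\<And>v y. v \<in> V \<Longrightarrow> y \<in> carrier A \<Longrightarrow> P y \<Longrightarrow> P (inv\<^bsub>A\<^esub> gen v \<cdot> y)"
  shows "P x"
  using presented_group_induct[of x V "raag_relators \<Gamma>" P] assms unfolding raag_def raag_gen_def by blast

lemma gen_commute:
  assumes "(u, v) \<in> parcs \<Gamma>"
  shows "gen u \<cdot> gen v = gen v \<cdot> gen u"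
proof -
  let ?c = "\<lambda>w. pres_rel V (raag_relators \<Gamma>) `` {w}"
  let ?r = "[(u, True), (v, True), (u, False), (v, False)]"
  have uv: "u \<in> V" "v \<in> V" using edge_V assms by auto
  have mult: "?c a \<cdot> ?c b = ?c (a @ b)" if "a \<in> words V" "b \<in> words V" for a b
    unfolding raag_def using presented_group_mult that by blast
  have eq: "?c a = ?c b" if "(a, b) \<in> pres_rel V (raag_relators \<Gamma>)" for a b
    using equiv_class_eq[OF equiv_pres_rel that] .
  have "?r \<in> raag_relators \<Gamma>" using assms unfolding raag_relators_def by blast
  \<comment> \<open>The relator followed by the word v u equals v u when the relator is deleted, and
    u v when inverse letters are cancelled instead.\<close>
  then have "?c (?r @ [(v, True), (u, True)]) = ?c [(v, True), (u, True)]"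
    using pres_rel.relator[of "[]" V "[(v, True), (u, True)]" ?r "raag_relators \<Gamma>"] uv by (intro eq) simp
  moreover have "?c ([(u, True), (v, True), (u, False)] @ [(v, False), (v, \<not> False)] @ [(u, True)])
      = ?c ([(u, True), (v, True), (u, False)] @ [(u, True)])"
    using uv by (intro eq pres_rel.cancel) auto
  moreover have "?c ([(u, True), (v, True)] @ [(u, False), (u, \<not> False)] @ []) = ?c ([(u, True), (v, True)] @ [])"
    using uv by (intro eq pres_rel.cancel) auto
  ultimately have "?c [(u, True), (v, True)] = ?c [(v, True), (u, True)]" by simp
  then show ?thesis unfolding raag_gen_def using mult[of "[(u, True)]" "[(v, True)]"] mult[of "[(v, True)]" "[(u, True)]"] uv by simp
qed

lemma group_homI: "group H \<Longrightarrow> \<phi> \<in> hom A H \<Longrightarrow> group_hom A H \<phi>"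
  using A.group_axioms by (simp add: group_hom_def group_hom_axioms_def)

lemma hom_eqI:
  assumes H: "group H" and h: "\<phi> \<in> hom A H" "\<psi> \<in> hom A H"
    and eq: "\<And>v. v \<in> V \<Longrightarrow> \<phi> (gen v) = \<psi> (gen v)" and x: "x \<in> carrier A"
  shows "\<phi> x = \<psi> x"
proof -
  interpret H: group H by fact
  interpret \<phi>: group_hom A H \<phi> using h by unfold_locales auto
  interpret \<psi>: group_hom A H \<psi> using h by unfold_locales auto
  show ?thesis using x by (induction rule: raag_induct) (auto simp: eq)
qed

lemma Aut_carrier: "s \<in> carrier Aut \<longleftrightarrow> s \<in> hom A A \<and> s \<in> extensional (carrier A) \<and> bij_betw s (carrier A) (carrier A)"
  by (auto simp: AutoGroup_def auto_def Bij_def)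

lemma Aut_hom: "s \<in> carrier Aut \<Longrightarrow> group_hom A A s"
  using A.group_axioms by (auto simp: Aut_carrier group_hom_def group_hom_axioms_def)

lemma Aut_apply_closed: "s \<in> carrier Aut \<Longrightarrow> x \<in> carrier A \<Longrightarrow> s x \<in> carrier A"
  using Aut_hom group_hom.hom_closed by metis

lemma Aut_mult: "s \<in> carrier Aut \<Longrightarrow> t \<in> carrier Aut \<Longrightarrow> x \<in> carrier A \<Longrightarrow> (s \<odot> t) x = s (t x)"
  by (simp add: AutoGroup_def auto_def BijGroup_def compose_def)

lemma Aut_one: "x \<in> carrier A \<Longrightarrow> \<one>\<^bsub>Aut\<^esub> x = x"
  by (simp add: AutoGroup_def BijGroup_def)

lemma Aut_eqI:
  assumes "s \<in> carrier Aut" "t \<in> carrier Aut" "\<And>v. v \<in> V \<Longrightarrow> s (gen v) = t (gen v)"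
  shows "s = t"
proof (rule extensionalityI[of s "carrier A"])
  fix x assume "x \<in> carrier A"
  then show "s x = t x"
    using hom_eqI[OF A.group_axioms, of s t] assms Aut_carrier by blast
qed (use assms Aut_carrier in auto)

lemma Aut_inv_apply:
  assumes "s \<in> carrier Aut" "x \<in> carrier A"
  shows "(inv\<^bsub>Aut\<^esub> s) (s x) = x" "s ((inv\<^bsub>Aut\<^esub> s) x) = x"
  using Aut_mult[of "inv\<^bsub>Aut\<^esub> s" s x] Aut_mult[of s "inv\<^bsub>Aut\<^esub> s" x] Aut_one assms by auto

text \<open>Elements of \<open>AutoGroup\<close> are extensional functions, so a homomorphism has to
  be restricted to the carrier.\<close>

lemma Aut_restrictI:
  assumes "\<phi> \<in> hom A A" "\<psi> \<in> hom A A"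
    and "\<And>x. x \<in> carrier A \<Longrightarrow> \<phi> (\<psi> x) = x" "\<And>x. x \<in> carrier A \<Longrightarrow> \<psi> (\<phi> x) = x"
  shows "restrict \<phi> (carrier A) \<in> carrier Aut"
proof -
  have c: "\<phi> x \<in> carrier A" "\<psi> x \<in> carrier A" if "x \<in> carrier A" for x
    using assms(1,2) that by (auto simp: hom_def)
  have "bij_betw \<phi> (carrier A) (carrier A)"
    by (rule bij_betw_byWitness[of _ \<psi>]) (use assms c in auto)
  then have "bij_betw (restrict \<phi> (carrier A)) (carrier A) (carrier A)"
    by (simp cong: bij_betw_cong)
  moreover have "restrict \<phi> (carrier A) \<in> hom A A"
    using assms(1) by (auto simp: hom_def)
  ultimately show ?thesis unfolding Aut_carrier by simp
qed

text \<open>Integer exponents put powers, inverses and products of automorphisms with the same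
  \<open>w\<close> into one family. A right transvection has \<open>p = 0\<close> and the indicator
  of a vertex as \<open>q\<close>, a left one the reverse; for a partial conjugation
  \<open>p\<close> is the indicator of a component and \<open>q\<close> its negative.\<close>

definition twist :: "'v \<Rightarrow> ('v \<Rightarrow> int) \<Rightarrow> ('v \<Rightarrow> int) \<Rightarrow> 'v \<Rightarrow> 'v word set" where
  "twist w p q u = gen w \<up> p u \<cdot> gen u \<cdot> gen w \<up> q u"

lemma twist_closed [simp, intro]: "w \<in> V \<Longrightarrow> u \<in> V \<Longrightarrow> twist w p q u \<in> carrier A"
  unfolding twist_def by simp

text \<open>Both transvections and partial conjugations have this form; \<open>w\<close> is the acting letter.\<close>

definition acts :: "('v word set \<Rightarrow> 'v word set) \<Rightarrow> 'v \<Rightarrow> ('v \<Rightarrow> int) \<Rightarrow> ('v \<Rightarrow> int) \<Rightarrow> bool" where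
  "acts s w p q \<longleftrightarrow> s \<in> carrier Aut \<and> w \<in> V \<and> p w = 0 \<and> q w = 0 \<and> (\<forall>u\<in>V. s (gen u) = twist w p q u)"

lemma hom_twist:
  assumes s: "group_hom A H s" and "w \<in> V" "u \<in> V"
  shows "s (twist w p q u) = s (gen w) [^]\<^bsub>H\<^esub> p u \<otimes>\<^bsub>H\<^esub> s (gen u) \<otimes>\<^bsub>H\<^esub> s (gen w) [^]\<^bsub>H\<^esub> q u"
proof -
  interpret group_hom A H s by fact
  show ?thesis using assms unfolding twist_def by (simp add: hom_int_pow)
qed

text \<open>Both automorphisms fix \<open>gen w\<close>, so each wraps another pair of powers of
  \<open>gen w\<close> around \<open>gen u\<close>, and the exponents add.\<close>

lemma acts_mult:
  assumes s: "acts s w p q" and t: "acts t w p' q'"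
  shows "acts (s \<odot> t) w (\<lambda>u. p u + p' u) (\<lambda>u. q u + q' u)"
  unfolding acts_def
proof (intro conjI ballI)
  have c: "s \<in> carrier Aut" "t \<in> carrier Aut" "w \<in> V" using s t unfolding acts_def by auto
  show "s \<odot> t \<in> carrier Aut" using c by simp
  fix u assume u: "u \<in> V"
  have "s (gen w) = gen w" using s c unfolding acts_def twist_def by simp
  then have "(s \<odot> t) (gen u) = gen w \<up> p' u \<cdot> twist w p q u \<cdot> gen w \<up> q' u"
    using Aut_mult c u s t hom_twist[OF Aut_hom[OF c(1)]] unfolding acts_def by simp
  also have "\<dots> = gen w \<up> p' u \<cdot> gen w \<up> p u \<cdot> gen u \<cdot> (gen w \<up> q u \<cdot> gen w \<up> q' u)"
    using c u unfolding twist_def by (simp add: A.m_assoc)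
  also have "\<dots> = twist w (\<lambda>u. p u + p' u) (\<lambda>u. q u + q' u) u"
    using c u unfolding twist_def by (simp add: A.int_pow_mult add.commute[of "p u"])
  finally show "(s \<odot> t) (gen u) = twist w (\<lambda>u. p u + p' u) (\<lambda>u. q u + q' u) u" .
qed (use s t in \<open>auto simp: acts_def\<close>)

lemma acts_one: "w \<in> V \<Longrightarrow> acts \<one>\<^bsub>Aut\<^esub> w (\<lambda>_. 0) (\<lambda>_. 0)"
  unfolding acts_def twist_def using Aut_one by simp

lemma acts_inv:
  assumes s: "acts s w p q"
  shows "acts (inv\<^bsub>Aut\<^esub> s) w (\<lambda>u. - p u) (\<lambda>u. - q u)"
  unfolding acts_def
proof (intro conjI ballI)
  have c: "s \<in> carrier Aut" "w \<in> V" using s unfolding acts_def by auto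
  show "inv\<^bsub>Aut\<^esub> s \<in> carrier Aut" using c by simp
  fix u assume u: "u \<in> V"
  have "s (gen w) = gen w" using s c unfolding acts_def twist_def by simp
  then have "s (twist w (\<lambda>u. - p u) (\<lambda>u. - q u) u)
      = gen w \<up> (- p u) \<cdot> twist w p q u \<cdot> gen w \<up> (- q u)"
    using c u s hom_twist[OF Aut_hom[OF c(1)]] unfolding acts_def by simp
  also have "\<dots> = gen w \<up> (- p u) \<cdot> gen w \<up> p u \<cdot> gen u \<cdot> (gen w \<up> q u \<cdot> gen w \<up> (- q u))"
    using c u unfolding twist_def by (simp add: A.m_assoc)
  also have "\<dots> = gen u" using c u by (simp add: A.int_pow_mult[symmetric])
  finally show "(inv\<^bsub>Aut\<^esub> s) (gen u) = twist w (\<lambda>u. - p u) (\<lambda>u. - q u) u"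
    using Aut_inv_apply(1)[OF c(1), of "twist w (\<lambda>u. - p u) (\<lambda>u. - q u) u"] c u by simp
qed (use s in \<open>auto simp: acts_def\<close>)

lemma acts_nat_pow:
  assumes "acts s w p q"
  shows "acts (s [^]\<^bsub>Aut\<^esub> (n :: nat)) w (\<lambda>u. int n * p u) (\<lambda>u. int n * q u)"
proof (induction n)
  case 0
  then show ?case using acts_one[of w] assms unfolding acts_def[of s] by simp
next
  case (Suc n)
  from acts_mult[OF Suc assms] show ?case by (simp add: algebra_simps)
qed

lemma acts_int_pow:
  assumes "acts s w p q"
  shows "acts (s [^]\<^bsub>Aut\<^esub> (n :: int)) w (\<lambda>u. n * p u) (\<lambda>u. n * q u)"
proof (cases n rule: int_cases)
  case (nonneg m)
  then show ?thesis using acts_nat_pow[OF assms, of m] by (simp add: int_pow_int)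
next
  case (neg m)
  have "s \<in> carrier Aut" using assms unfolding acts_def by blast
  then have "s [^]\<^bsub>Aut\<^esub> n = inv\<^bsub>Aut\<^esub> (s [^]\<^bsub>Aut\<^esub> Suc m)"
    unfolding neg by (rule Aut.int_pow_neg_int)
  then show ?thesis using acts_inv[OF acts_nat_pow[OF assms, of "Suc m"]] unfolding neg by (simp del: of_nat_Suc nat_pow_Suc)
qed

lemma acts_fix: "acts s w p q \<Longrightarrow> x \<in> V \<Longrightarrow> p x = 0 \<Longrightarrow> q x = 0 \<Longrightarrow> s (gen x) = gen x"
  unfolding acts_def twist_def by simp

text \<open>Each automorphism fixes the acting letter of the other, so both products place the same
  powers of \<open>gen w\<close> and \<open>gen x\<close> on the two sides of \<open>gen u\<close>.
  Only their order can differ, and it is immaterial if the letters commute or if on each side one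
  exponent is 0.\<close>

lemma acts_commute:
  assumes s: "acts s w p q" and t: "acts t x p' q'"
    and fx: "p x = 0" "q x = 0" "p' w = 0" "q' w = 0"
    and c: "gen w \<cdot> gen x = gen x \<cdot> gen w \<or>
      (\<forall>u\<in>V. (p u = 0 \<or> p' u = 0) \<and> (q u = 0 \<or> q' u = 0))"
  shows "s \<odot> t = t \<odot> s"
proof (rule Aut_eqI)
  have cs: "s \<in> carrier Aut" "t \<in> carrier Aut" "w \<in> V" "x \<in> V" using s t unfolding acts_def by auto
  show "s \<odot> t \<in> carrier Aut" "t \<odot> s \<in> carrier Aut" using cs by auto
  fix u assume u: "u \<in> V"
  let ?w = "\<lambda>i :: int. gen w \<up> i" and ?x = "\<lambda>i :: int. gen x \<up> i"
  have fixed: "s (gen x) = gen x" "t (gen w) = gen w" using acts_fix s t fx cs by auto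
  have val: "s (gen u) = twist w p q u" "t (gen u) = twist x p' q' u" using s t u unfolding acts_def by auto
  have 1: "(s \<odot> t) (gen u) = ?x (p' u) \<cdot> twist w p q u \<cdot> ?x (q' u)"
    using Aut_mult[OF cs(1,2) gen_closed[OF u]] hom_twist[OF Aut_hom[OF cs(1)] cs(4) u, of p' q'] val fixed by simp
  have 2: "(t \<odot> s) (gen u) = ?w (p u) \<cdot> twist x p' q' u \<cdot> ?w (q u)"
    using Aut_mult[OF cs(2,1) gen_closed[OF u]] hom_twist[OF Aut_hom[OF cs(2)] cs(3) u, of p q] val fixed by simp
  have pq: "?x (p' u) \<cdot> ?w (p u) = ?w (p u) \<cdot> ?x (p' u)" "?w (q u) \<cdot> ?x (q' u) = ?x (q' u) \<cdot> ?w (q u)"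
    using c A.int_pow_commute2[of "gen w" "gen x"] cs u by auto
  have "(s \<odot> t) (gen u) = (?x (p' u) \<cdot> ?w (p u)) \<cdot> gen u \<cdot> (?w (q u) \<cdot> ?x (q' u))"
    unfolding 1 twist_def using cs u by (simp add: A.m_assoc)
  also have "\<dots> = (t \<odot> s) (gen u)"
    unfolding pq 2 twist_def using cs u by (simp add: A.m_assoc)
  finally show "(s \<odot> t) (gen u) = (t \<odot> s) (gen u)" .
qed

text \<open>A sufficient condition for the images of adjacent generators to commute: both are
  conjugated by the same power of \<open>gen w\<close>, or one of them is fixed and commutes with
  \<open>gen w\<close>.\<close>

definition respects_edges :: "'v \<Rightarrow> ('v \<Rightarrow> int) \<Rightarrow> ('v \<Rightarrow> int) \<Rightarrow> bool" where
  "respects_edges w p q \<longleftrightarrow> w \<in> V \<and> p w = 0 \<and> q w = 0 \<and> (\<forall>u v. (u, v) \<in> parcs \<Gamma> \<longrightarrow>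
     p u = p v \<and> p u + q u = 0 \<and> p v + q v = 0 \<or>
     p u = 0 \<and> q u = 0 \<and> u \<in> st \<Gamma> w \<or> p v = 0 \<and> q v = 0 \<and> v \<in> st \<Gamma> w)"

lemma st_commute: "u \<in> st \<Gamma> w \<Longrightarrow> gen w \<cdot> gen u = gen u \<cdot> gen w"
  unfolding st_def lk_def using gen_commute by auto

lemma respects_edges_commute:
  assumes g: "respects_edges w p q" and uv: "(u, v) \<in> parcs \<Gamma>"
  shows "twist w p q u \<cdot> twist w p q v = twist w p q v \<cdot> twist w p q u"
proof -
  have c: "w \<in> V" "u \<in> V" "v \<in> V" using g uv edge_V unfolding respects_edges_def by auto
  let ?w = "\<lambda>i :: int. gen w \<up> i"
  have fixed: "twist w p q a \<cdot> twist w p q b = twist w p q b \<cdot> twist w p q a"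
    if "(a, b) \<in> parcs \<Gamma>" "p a = 0" "q a = 0" "a \<in> st \<Gamma> w" for a b
  proof -
    have ab: "a \<in> V" "b \<in> V" using edge_V that by auto
    have aw: "gen a \<cdot> ?w i = ?w i \<cdot> gen a" for i
      using A.int_pow_commute[OF _ _ st_commute[OF that(4)]] c ab by simp
    have "gen a \<cdot> (?w (p b) \<cdot> gen b \<cdot> ?w (q b)) = (gen a \<cdot> ?w (p b)) \<cdot> gen b \<cdot> ?w (q b)"
      using ab c by (simp add: A.m_assoc)
    also have "\<dots> = ?w (p b) \<cdot> (gen a \<cdot> gen b) \<cdot> ?w (q b)"
      unfolding aw using ab c by (simp add: A.m_assoc)
    also have "\<dots> = ?w (p b) \<cdot> gen b \<cdot> (gen a \<cdot> ?w (q b))"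
      unfolding gen_commute[OF that(1)] using ab c by (simp add: A.m_assoc)
    also have "\<dots> = ?w (p b) \<cdot> gen b \<cdot> ?w (q b) \<cdot> gen a"
      unfolding aw using ab c by (simp add: A.m_assoc)
    finally show ?thesis using that ab c unfolding twist_def by simp
  qed
  have conj: "?w i \<cdot> gen a \<cdot> ?w (- i) \<cdot> (?w i \<cdot> gen b \<cdot> ?w (- i)) = ?w i \<cdot> (gen a \<cdot> gen b) \<cdot> ?w (- i)"
    if "a \<in> V" "b \<in> V" for a b i
  proof -
    have "?w i \<cdot> gen a \<cdot> ?w (- i) \<cdot> (?w i \<cdot> gen b \<cdot> ?w (- i))
        = ?w i \<cdot> gen a \<cdot> (?w (- i) \<cdot> ?w i) \<cdot> gen b \<cdot> ?w (- i)"
      using that c by (simp add: A.m_assoc del: A.int_pow_mult)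
    also have "?w (- i) \<cdot> ?w i = \<one>\<^bsub>A\<^esub>" using c by (simp add: A.int_pow_mult[symmetric])
    finally show ?thesis using that c by (simp add: A.m_assoc)
  qed
  consider "p u = p v" "p u + q u = 0" "p v + q v = 0" | "p u = 0" "q u = 0" "u \<in> st \<Gamma> w" | "p v = 0" "q v = 0" "v \<in> st \<Gamma> w"
    using g uv unfolding respects_edges_def by blast
  then show ?thesis
  proof cases
    case 1
    then have q: "p u = p v" "q u = - p v" "q v = - p v" by auto
    show ?thesis unfolding twist_def q using conj[of u v] conj[of v u] c gen_commute[OF uv] by simp
  next
    case 2
    then show ?thesis using fixed uv by blast
  next
    case 3
    then show ?thesis using fixed[OF edge_sym[OF uv]] by simp
  qed
qed

lemma respects_edges_uminus: "respects_edges w p q \<Longrightarrow> respects_edges w (\<lambda>u. - p u) (\<lambda>u. - q u)"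
  unfolding respects_edges_def by (smt (verit))

text \<open>The homomorphism with negated exponents is an inverse, because both homomorphisms fix
  \<open>gen w\<close>.\<close>

lemma acts_exists:
  assumes g: "respects_edges w p q"
  obtains s where "acts s w p q"
proof -
  have w: "w \<in> V" "p w = 0" "q w = 0" using g unfolding respects_edges_def by auto
  obtain \<phi> where \<phi>: "\<phi> \<in> hom A A" "\<And>v. v \<in> V \<Longrightarrow> \<phi> (gen v) = twist w p q v"
    using raag_hom[OF A.group_axioms, of "twist w p q"] respects_edges_commute[OF g] w by auto
  obtain \<psi> where \<psi>: "\<psi> \<in> hom A A" "\<And>v. v \<in> V \<Longrightarrow> \<psi> (gen v) = twist w (\<lambda>u. - p u) (\<lambda>u. - q u) v"
    using raag_hom[OF A.group_axioms, of "twist w (\<lambda>u. - p u) (\<lambda>u. - q u)"]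
      respects_edges_commute[OF respects_edges_uminus[OF g]] w by auto
  have undo: "\<alpha> (\<beta> x) = x"
    if \<alpha>: "\<alpha> \<in> hom A A" "\<And>v. v \<in> V \<Longrightarrow> \<alpha> (gen v) = twist w a b v"
      and \<beta>: "\<beta> \<in> hom A A" "\<And>v. v \<in> V \<Longrightarrow> \<beta> (gen v) = twist w (\<lambda>u. - a u) (\<lambda>u. - b u) v"
      and ab: "a w = 0" "b w = 0" and x: "x \<in> carrier A" for \<alpha> \<beta> a b x
  proof -
    interpret \<alpha>: group_hom A A \<alpha> using \<alpha> by unfold_locales auto
    have "(\<alpha> \<circ> \<beta>) x = id x"
    proof (rule hom_eqI[OF A.group_axioms _ _ _ x])
      show "\<alpha> \<circ> \<beta> \<in> hom A A" using Group.hom_compose[OF \<beta>(1) \<alpha>(1)] .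
      show "id \<in> hom A A" by (simp add: hom_def)
      fix u assume u: "u \<in> V"
      have "\<alpha> (gen w) = gen w" using \<alpha>(2)[OF w(1)] ab w unfolding twist_def by simp
      then have "\<alpha> (\<beta> (gen u)) = gen w \<up> (- a u) \<cdot> twist w a b u \<cdot> gen w \<up> (- b u)"
        using hom_twist[OF \<alpha>.group_hom_axioms w(1) u] \<alpha>(2)[OF u] \<beta>(2)[OF u] by simp
      also have "\<dots> = gen w \<up> (- a u) \<cdot> gen w \<up> a u \<cdot> gen u \<cdot> (gen w \<up> b u \<cdot> gen w \<up> (- b u))"
        using w u unfolding twist_def by (simp add: A.m_assoc)
      also have "\<dots> = gen u" using w u by (simp add: A.int_pow_mult[symmetric])
      finally show "(\<alpha> \<circ> \<beta>) (gen u) = id (gen u)" by simp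
    qed
    then show ?thesis by simp
  qed
  have "restrict \<phi> (carrier A) \<in> carrier Aut"
  proof (rule Aut_restrictI[OF \<phi>(1) \<psi>(1)])
    show "\<phi> (\<psi> x) = x" if "x \<in> carrier A" for x
      using undo[OF \<phi> \<psi>] w that by simp
    show "\<psi> (\<phi> x) = x" if "x \<in> carrier A" for x
      using undo[OF \<psi>, of \<phi>] \<phi> w that by simp
  qed
  then have "acts (restrict \<phi> (carrier A)) w p q" using \<phi>(2) w unfolding acts_def by auto
  then show thesis using that by blast
qed

section \<open>Exponent sums and dihedral quotients as detectors of nontrivial twists\<close>

lemma exponent_hom:
  obtains \<epsilon> where "\<epsilon> \<in> hom A integer_group" "\<And>v. v \<in> V \<Longrightarrow> \<epsilon> (gen v) = (if v = w then 1 else 0)"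
  using raag_hom[OF group_integer_group, of "\<lambda>v. if v = w then 1 else 0"] by (auto simp: add.commute)

lemma exponent_twist:
  assumes w: "w \<in> V" "u \<in> V" "u \<noteq> w"
    and eq: "twist w p q u = gen u"
  shows "p u + q u = 0"
proof -
  obtain \<epsilon> where \<epsilon>: "\<epsilon> \<in> hom A integer_group" "\<And>v. v \<in> V \<Longrightarrow> \<epsilon> (gen v) = (if v = w then 1 else 0)"
    using exponent_hom[of w] by blast
  interpret \<epsilon>: group_hom A integer_group \<epsilon> using \<epsilon>(1) by (intro group_homI) auto
  have "\<epsilon> (twist w p q u) = p u + q u" using hom_twist[OF \<epsilon>.group_hom_axioms w(1,2)] \<epsilon>(2) w by simp
  then show ?thesis using eq \<epsilon>(2) w by simp
qed

text \<open>Nonadjacent generators map to the translation and the reflection generating the infinite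
  dihedral group acting on \<open>\<int>\<close>.\<close>

lemma dihedral_hom:
  assumes w: "w \<in> V" "u \<in> V" "u \<notin> st \<Gamma> w"
  obtains \<phi> where "\<phi> \<in> hom A (BijGroup (UNIV :: int set))" "\<And>v. v \<in> V \<Longrightarrow> v \<noteq> w \<Longrightarrow> v \<noteq> u \<Longrightarrow> \<phi> (gen v) = \<one>\<^bsub>BijGroup UNIV\<^esub>"
    "\<And>i :: int. \<phi> (gen w \<up> i) = (\<lambda>n. n + i)" "\<phi> (gen u) = uminus"
proof -
  let ?B = "BijGroup (UNIV :: int set)"
  interpret B: group ?B by (rule group_BijGroup)
  have car: "f \<in> carrier ?B \<longleftrightarrow> bij f" for f by (simp add: BijGroup_def Bij_def)
  have mul: "f \<otimes>\<^bsub>?B\<^esub> g = f \<circ> g" if "bij f" "bij g" for f g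
    using that by (auto simp: BijGroup_def Bij_def compose_def)
  have one: "\<one>\<^bsub>?B\<^esub> = id" by (auto simp: BijGroup_def)
  have trans: "bij (\<lambda>n :: int. n + i)" for i
    by (rule bij_betw_byWitness[of _ "\<lambda>n. n - i"]) auto
  have refl: "bij (uminus :: int \<Rightarrow> int)"
    by (rule bij_betw_byWitness[of _ uminus]) auto
  define f where "f v = (if v = w then (\<lambda>n :: int. n + 1) else if v = u then uminus else id)" for v
  have fB: "f v \<in> carrier ?B" for v unfolding f_def using trans[of 1] refl by (simp add: car)
  have "f a \<otimes>\<^bsub>?B\<^esub> f b = f b \<otimes>\<^bsub>?B\<^esub> f a" if "(a, b) \<in> parcs \<Gamma>" for a b
  proof -
    have "\<not> (a = w \<and> b = u)" "\<not> (a = u \<and> b = w)"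
      using that w edge_sym unfolding st_def lk_def by auto
    then show ?thesis using fB unfolding car by (auto simp: mul f_def)
  qed
  then obtain \<phi> where \<phi>: "\<phi> \<in> hom A ?B" "\<And>v. v \<in> V \<Longrightarrow> \<phi> (gen v) = f v"
    using raag_hom[OF B.group_axioms, of f] fB by blast
  interpret \<phi>: group_hom A ?B \<phi> using \<phi>(1) by unfold_locales auto
  have "u \<noteq> w" using w unfolding st_def by auto
  interpret T: group_hom integer_group ?B "\<lambda>i n. n + i"
  proof (intro group_hom.intro group_hom_axioms.intro group_integer_group B.group_axioms)
    show "(\<lambda>i n. n + i) \<in> hom integer_group ?B"
      using trans by (auto simp: hom_def car mul fun_eq_iff)
  qed
  have "\<phi> (gen w \<up> i) = (\<lambda>n. n + i)" for i :: int
    using T.hom_int_pow[of 1 i] \<phi>.hom_int_pow[of "gen w" i] \<phi>(2)[OF w(1)] w(1) by (simp add: f_def)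
  then show thesis using that[OF \<phi>(1)] \<phi>(2) one w \<open>u \<noteq> w\<close> by (auto simp: f_def)
qed

text \<open>Conjugating the reflection by the translation by \<open>i\<close> sends \<open>n\<close>
  to \<open>2 * i - n\<close>. Evaluation at 0 tells this apart from negation unless
  \<open>i = 0\<close>.\<close>

lemma dihedral_detects:
  assumes w: "w \<in> V" "u \<in> V" "u \<notin> st \<Gamma> w"
  obtains \<phi> where "\<phi> \<in> hom A (BijGroup (UNIV :: int set))"
    "\<And>v. v \<in> V \<Longrightarrow> v \<noteq> w \<Longrightarrow> v \<noteq> u \<Longrightarrow> \<phi> (gen v) = \<one>\<^bsub>BijGroup UNIV\<^esub>"
    "\<And>i :: int. \<phi> (gen w \<up> i \<cdot> gen u \<cdot> gen w \<up> (- i)) = \<phi> (gen u) \<Longrightarrow> i = 0"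
proof -
  let ?B = "BijGroup (UNIV :: int set)"
  obtain \<phi> where \<phi>: "\<phi> \<in> hom A ?B" "\<And>v. v \<in> V \<Longrightarrow> v \<noteq> w \<Longrightarrow> v \<noteq> u \<Longrightarrow> \<phi> (gen v) = \<one>\<^bsub>?B\<^esub>"
    "\<And>i :: int. \<phi> (gen w \<up> i) = (\<lambda>n. n + i)" "\<phi> (gen u) = uminus"
    using dihedral_hom[OF w] by blast
  interpret \<phi>: group_hom A ?B \<phi> using \<phi>(1) group_BijGroup by (intro group_homI)
  have mul: "f \<otimes>\<^bsub>?B\<^esub> g = f \<circ> g" if "f \<in> carrier ?B" "g \<in> carrier ?B" for f g
    using that by (auto simp: BijGroup_def compose_def)
  have "i = 0" if eq: "\<phi> (gen w \<up> i \<cdot> gen u \<cdot> gen w \<up> (- i)) = \<phi> (gen u)" for i :: int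
  proof -
    have c: "\<phi> (gen w \<up> k) \<in> carrier ?B" "\<phi> (gen u) \<in> carrier ?B" for k :: int
      using w by simp_all
    have "\<phi> (gen w \<up> i \<cdot> gen u \<cdot> gen w \<up> (- i))
        = \<phi> (gen w \<up> i) \<otimes>\<^bsub>?B\<^esub> \<phi> (gen u) \<otimes>\<^bsub>?B\<^esub> \<phi> (gen w \<up> (- i))"
      using w by (simp add: \<phi>.hom_mult)
    also have "\<dots> = (\<phi> (gen w \<up> i) \<circ> \<phi> (gen u)) \<circ> \<phi> (gen w \<up> (- i))"
      using mul c \<phi>.H.m_closed by metis
    finally have "(\<phi> (gen w \<up> i) \<circ> \<phi> (gen u) \<circ> \<phi> (gen w \<up> (- i))) 0 = \<phi> (gen u) 0"
      using eq by simp
    then show ?thesis unfolding \<phi>(3,4) by simp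
  qed
  then show thesis using that[OF \<phi>(1,2)] by blast
qed

lemma conj_power_nontrivial:
  assumes w: "w \<in> V" "u \<in> V" "u \<notin> st \<Gamma> w"
    and eq: "gen w \<up> (i :: int) \<cdot> gen u \<cdot> gen w \<up> (- i) = gen u"
  shows "i = 0"
  using dihedral_detects[OF w] eq by metis

end

section \<open>Commuting transvections and partial conjugations\<close>

definition ind :: "'v set \<Rightarrow> 'v \<Rightarrow> int" where
  "ind C u = (if u \<in> C then 1 else 0)"

context raag_graph begin

abbreviation "S \<equiv> transvections_and_partial_conjugations \<Gamma>"

text \<open>Reachability by paths that stay outside the star of \<open>w\<close>, in the form that
  unfolding the strongly connected components produces.\<close>

definition reach_off :: "'v \<Rightarrow> 'v rel" where
  "reach_off w = rtrancl_on (V - st \<Gamma> w) {(a, b) \<in> parcs \<Gamma>. a \<in> V - st \<Gamma> w \<and> b \<in> V - st \<Gamma> w}"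

lemma components_conv:
  "components_minus_star \<Gamma> w = {C. C \<noteq> {} \<and> (\<forall>u\<in>C. \<forall>v\<in>C. (u, v) \<in> reach_off w) \<and>
    (\<forall>u\<in>C. \<forall>v. v \<notin> C \<longrightarrow> (u, v) \<notin> reach_off w \<or> (v, u) \<notin> reach_off w)}"
proof -
  have "arcs_ends (with_proj \<Gamma> \<restriction> (V - st \<Gamma> w)) = {(a, b) \<in> parcs \<Gamma>. a \<in> V - st \<Gamma> w \<and> b \<in> V - st \<Gamma> w}"
    by (auto simp: arcs_ends_def arc_to_ends_def induce_subgraph_def with_proj_def image_iff)
  then show ?thesis
    unfolding components_minus_star_def pre_digraph.sccs_verts_def reachable_def reach_off_def by simp
qed

lemma reach_off_sym: "(u, v) \<in> reach_off w \<Longrightarrow> (v, u) \<in> reach_off w"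
proof -
  have "sym {(a, b) \<in> parcs \<Gamma>. a \<in> V - st \<Gamma> w \<and> b \<in> V - st \<Gamma> w}"
    unfolding sym_def using edge_sym by blast
  from rtrancl_on_sym[OF this] show "(u, v) \<in> reach_off w \<Longrightarrow> (v, u) \<in> reach_off w"
    unfolding reach_off_def by (rule symD)
qed

lemma reach_off_in:
  assumes "(u, v) \<in> reach_off w"
  shows "u \<in> V - st \<Gamma> w \<and> v \<in> V - st \<Gamma> w"
  using in_rtrancl_on_in_F[OF assms[unfolded reach_off_def]] by blast

lemma reach_off_edge:
  assumes "(u, v) \<in> parcs \<Gamma>" "u \<in> V - st \<Gamma> w" "v \<in> V - st \<Gamma> w"
  shows "(u, v) \<in> reach_off w"
proof -
  have "(u, u) \<in> reach_off w"
    unfolding reach_off_def using assms(2) by (rule rtrancl_on.rtrancl_on_refl)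
  then show ?thesis
    unfolding reach_off_def using assms by (elim rtrancl_on.rtrancl_on_into_rtrancl_on) auto
qed

lemma reach_off_rtrancl:
  assumes "(u, v) \<in> reach_off w"
  shows "(u, v) \<in> (parcs \<Gamma>)\<^sup>*"
proof -
  have "{(a, b) \<in> parcs \<Gamma>. a \<in> V - st \<Gamma> w \<and> b \<in> V - st \<Gamma> w} \<subseteq> parcs \<Gamma>" by auto
  from rtrancl_mono[OF this] show ?thesis
    using rtrancl_on_rtranclI[OF assms[unfolded reach_off_def]] by (rule subsetD)
qed

lemma component_nonempty: "C \<in> components_minus_star \<Gamma> w \<Longrightarrow> C \<noteq> {}"
  unfolding components_conv by blast

lemma component_subset: "C \<in> components_minus_star \<Gamma> w \<Longrightarrow> C \<subseteq> V - st \<Gamma> w"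
  unfolding components_conv using reach_off_in by blast

lemma component_closed:
  assumes "C \<in> components_minus_star \<Gamma> w" "u \<in> C" "(u, v) \<in> parcs \<Gamma>" "v \<notin> st \<Gamma> w"
  shows "v \<in> C"
proof -
  have "(u, v) \<in> reach_off w"
    using reach_off_edge assms component_subset edge_V by blast
  then show ?thesis using reach_off_sym assms(1,2) unfolding components_conv by blast
qed

lemma component_exists:
  assumes u: "u \<in> V - st \<Gamma> w"
  obtains C where "C \<in> components_minus_star \<Gamma> w" "u \<in> C" "\<And>v. v \<in> C \<Longrightarrow> (u, v) \<in> (parcs \<Gamma>)\<^sup>*"
proof -
  define C where "C = {v. (u, v) \<in> reach_off w}"
  have "u \<in> C" unfolding C_def reach_off_def using u by (auto intro: rtrancl_on.rtrancl_on_refl)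
  moreover have trans: "(a, c) \<in> reach_off w" if "(a, b) \<in> reach_off w" "(b, c) \<in> reach_off w" for a b c
    using rtrancl_on_trans[OF that[unfolded reach_off_def]] unfolding reach_off_def .
  have "C \<in> components_minus_star \<Gamma> w"
    unfolding components_conv using \<open>u \<in> C\<close> reach_off_sym trans unfolding C_def by blast
  ultimately show thesis using that reach_off_rtrancl unfolding C_def by blast
qed

lemma rtrancl_edge_sym: "(u, v) \<in> (parcs \<Gamma>)\<^sup>* \<Longrightarrow> (v, u) \<in> (parcs \<Gamma>)\<^sup>*"
  using sym_rtrancl edge_sym by (metis symD symI)

lemma rtrancl_edge_V:
  assumes "(u, v) \<in> (parcs \<Gamma>)\<^sup>*" "u \<in> V"
  shows "v \<in> V"
  using assms by (induction rule: rtrancl_induct) (auto dest: edge_V)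

lemma lk_st: "w \<in> V \<Longrightarrow> u \<in> st \<Gamma> w \<Longrightarrow> u = w \<or> (w, u) \<in> parcs \<Gamma>"
  unfolding st_def lk_def by auto

lemma lkI: "(v, u) \<in> parcs \<Gamma> \<Longrightarrow> u \<in> lk \<Gamma> v"
  unfolding lk_def using edge_V by auto

lemma S_carrier: "s \<in> S \<Longrightarrow> s \<in> carrier Aut"
  unfolding transvections_and_partial_conjugations_def right_transvections_def
    left_transvections_def partial_conjugations_def by blast

lemma twist_values:
  assumes "w \<in> V" "u \<in> V"
  shows "p u = 0 \<Longrightarrow> q u = 0 \<Longrightarrow> twist w p q u = gen u"
    "p u = 0 \<Longrightarrow> q u = 1 \<Longrightarrow> twist w p q u = gen u \<cdot> gen w"
    "p u = 1 \<Longrightarrow> q u = 0 \<Longrightarrow> twist w p q u = gen w \<cdot> gen u"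
    "p u = 1 \<Longrightarrow> q u = -1 \<Longrightarrow> twist w p q u = gen w \<cdot> gen u \<cdot> inv\<^bsub>A\<^esub> gen w"
  using assms unfolding twist_def by (auto simp: A.int_pow_neg A.int_pow_1)

section \<open>Existence and normal form of the generators\<close>

lemma right_transvection:
  assumes v: "v \<in> V" "w \<in> V" "v \<noteq> w" "lk \<Gamma> v \<subseteq> st \<Gamma> w"
  obtains s where "s \<in> S" "acts s w (\<lambda>_. 0) (ind {v})"
proof -
  have "u \<in> st \<Gamma> w" if "(v, u) \<in> parcs \<Gamma> \<or> (u, v) \<in> parcs \<Gamma>" for u
    using that v(4) lkI edge_sym by blast
  then have "respects_edges w (\<lambda>_. 0) (ind {v})"
    unfolding respects_edges_def ind_def using v(2,3) edge_irrefl[of v] by auto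
  then obtain s where s: "acts s w (\<lambda>_. 0) (ind {v})" using acts_exists by blast
  then have val: "s \<in> carrier Aut" "\<And>u. u \<in> V \<Longrightarrow> s (gen u) = twist w (\<lambda>_. 0) (ind {v}) u" unfolding acts_def by auto
  have "s (gen v) = gen v \<cdot> gen w"
    using val(2)[OF v(1)] twist_values(2)[OF v(2,1), of "\<lambda>_. 0" "ind {v}"] by (simp add: ind_def)
  moreover have "\<forall>u\<in>V - {v}. s (gen u) = gen u"
    using val(2) twist_values(1)[OF v(2), of _ "\<lambda>_. 0" "ind {v}"] by (simp add: ind_def)
  ultimately have "s \<in> right_transvections \<Gamma>"
    unfolding right_transvections_def using v val(1) by blast
  then show thesis using that s unfolding transvections_and_partial_conjugations_def by blast
qed

lemma left_transvection:
  assumes v: "v \<in> V" "w \<in> V" "v \<noteq> w" "lk \<Gamma> v \<subseteq> st \<Gamma> w"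
  obtains s where "s \<in> S" "acts s w (ind {v}) (\<lambda>_. 0)"
proof -
  have "u \<in> st \<Gamma> w" if "(v, u) \<in> parcs \<Gamma> \<or> (u, v) \<in> parcs \<Gamma>" for u
    using that v(4) lkI edge_sym by blast
  then have "respects_edges w (ind {v}) (\<lambda>_. 0)"
    unfolding respects_edges_def ind_def using v(2,3) edge_irrefl[of v] by auto
  then obtain s where s: "acts s w (ind {v}) (\<lambda>_. 0)" using acts_exists by blast
  then have val: "s \<in> carrier Aut" "\<And>u. u \<in> V \<Longrightarrow> s (gen u) = twist w (ind {v}) (\<lambda>_. 0) u" unfolding acts_def by auto
  have "s (gen v) = gen w \<cdot> gen v"
    using val(2)[OF v(1)] twist_values(3)[OF v(2,1), of "ind {v}" "\<lambda>_. 0"] by (simp add: ind_def)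
  moreover have "\<forall>u\<in>V - {v}. s (gen u) = gen u"
    using val(2) twist_values(1)[OF v(2), of _ "ind {v}" "\<lambda>_. 0"] by (simp add: ind_def)
  ultimately have "s \<in> left_transvections \<Gamma>"
    unfolding left_transvections_def using v val(1) by blast
  then show thesis using that s unfolding transvections_and_partial_conjugations_def by blast
qed

lemma partial_conjugation:
  assumes w: "w \<in> V" and C: "C \<in> components_minus_star \<Gamma> w"
  obtains s where "s \<in> S" "acts s w (ind C) (\<lambda>u. - ind C u)"
proof -
  have wC: "w \<notin> C" using component_subset[OF C] unfolding st_def by auto
  have "respects_edges w (ind C) (\<lambda>u. - ind C u)"
    unfolding respects_edges_def
  proof (intro conjI allI impI)
    fix u v assume uv: "(u, v) \<in> parcs \<Gamma>"
    have "u \<in> C \<longleftrightarrow> v \<in> C" if "u \<notin> st \<Gamma> w" "v \<notin> st \<Gamma> w"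
      using component_closed[OF C] uv edge_sym that by blast
    then show "ind C u = ind C v \<and> ind C u + - ind C u = 0 \<and> ind C v + - ind C v = 0 \<or>
      ind C u = 0 \<and> - ind C u = 0 \<and> u \<in> st \<Gamma> w \<or> ind C v = 0 \<and> - ind C v = 0 \<and> v \<in> st \<Gamma> w"
      using component_subset[OF C] unfolding ind_def by auto
  qed (use w wC in \<open>auto simp: ind_def\<close>)
  then obtain s where s: "acts s w (ind C) (\<lambda>u. - ind C u)" using acts_exists by blast
  have CV: "C \<subseteq> V" using component_subset[OF C] by blast
  have "s \<in> partial_conjugations \<Gamma>"
    unfolding partial_conjugations_def
  proof (intro CollectI conjI bexI[OF _ w] bexI[OF _ C] ballI)
    show "s \<in> carrier Aut" using s unfolding acts_def by blast
    fix u assume "u \<in> C"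
    then show "s (gen u) = gen w \<cdot> gen u \<cdot> inv\<^bsub>A\<^esub> gen w"
      using s CV twist_values(4)[OF w, of u "ind C"] unfolding acts_def by (auto simp: ind_def)
  next
    fix u assume "u \<in> V - C"
    then show "s (gen u) = gen u"
      using s twist_values(1)[OF w, of u "ind C"] unfolding acts_def by (auto simp: ind_def)
  qed
  then show thesis using that s unfolding transvections_and_partial_conjugations_def by blast
qed

lemma S_cases:
  assumes "s \<in> S"
  obtains v w where "v \<in> V" "w \<in> V" "v \<noteq> w" "lk \<Gamma> v \<subseteq> st \<Gamma> w" "acts s w (\<lambda>_. 0) (ind {v})"
  | v w where "v \<in> V" "w \<in> V" "v \<noteq> w" "lk \<Gamma> v \<subseteq> st \<Gamma> w" "acts s w (ind {v}) (\<lambda>_. 0)"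
  | w C where "w \<in> V" "C \<in> components_minus_star \<Gamma> w" "acts s w (ind C) (\<lambda>u. - ind C u)"
proof -
  consider "s \<in> right_transvections \<Gamma>" | "s \<in> left_transvections \<Gamma>" | "s \<in> partial_conjugations \<Gamma>"
    using assms unfolding transvections_and_partial_conjugations_def by blast
  then show thesis
  proof cases
    case 1
    then obtain v w where vw: "s \<in> carrier Aut" "v \<in> V" "w \<in> V" "v \<noteq> w" "lk \<Gamma> v \<subseteq> st \<Gamma> w"
      "s (gen v) = gen v \<cdot> gen w" "\<forall>u\<in>V - {v}. s (gen u) = gen u"
      unfolding right_transvections_def by blast
    have "s (gen u) = twist w (\<lambda>_. 0) (ind {v}) u" if "u \<in> V" for u
      using vw that twist_values(1,2)[OF vw(3) that, of "\<lambda>_. 0" "ind {v}"] by (cases "u = v") (auto simp: ind_def)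
    then have "acts s w (\<lambda>_. 0) (ind {v})" using vw unfolding acts_def by (simp add: ind_def)
    then show ?thesis using that(1) vw by blast
  next
    case 2
    then obtain v w where vw: "s \<in> carrier Aut" "v \<in> V" "w \<in> V" "v \<noteq> w" "lk \<Gamma> v \<subseteq> st \<Gamma> w"
      "s (gen v) = gen w \<cdot> gen v" "\<forall>u\<in>V - {v}. s (gen u) = gen u"
      unfolding left_transvections_def by blast
    have "s (gen u) = twist w (ind {v}) (\<lambda>_. 0) u" if "u \<in> V" for u
      using vw that twist_values(1,3)[OF vw(3) that, of "ind {v}" "\<lambda>_. 0"] by (cases "u = v") (auto simp: ind_def)
    then have "acts s w (ind {v}) (\<lambda>_. 0)" using vw unfolding acts_def by (simp add: ind_def)
    then show ?thesis using that(2) vw by blast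
  next
    case 3
    then obtain w C where w: "s \<in> carrier Aut" "w \<in> V" "C \<in> components_minus_star \<Gamma> w"
      "\<forall>u\<in>C. s (gen u) = gen w \<cdot> gen u \<cdot> inv\<^bsub>A\<^esub> gen w" "\<forall>u\<in>V - C. s (gen u) = gen u"
      unfolding partial_conjugations_def by blast
    have wC: "w \<notin> C" using component_subset[OF w(3)] unfolding st_def by auto
    have "s (gen u) = twist w (ind C) (\<lambda>u. - ind C u) u" if "u \<in> V" for u
      using w that twist_values(1,4)[OF w(2) that, of "ind C" "\<lambda>u. - ind C u"] by (cases "u \<in> C") (auto simp: ind_def)
    then have "acts s w (ind C) (\<lambda>u. - ind C u)" using w wC unfolding acts_def by (simp add: ind_def)
    then show ?thesis using that(3) w by blast
  qed
qed

section \<open>Connecting the acting letters by commuting generators\<close>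

lemma S_acts: "s \<in> S \<Longrightarrow> \<exists>w p q. acts s w p q"
  by (erule S_cases) blast+

text \<open>Commutation of the elements themselves, which is stronger than that of powers in the
  commutativity graph. Pairs of equal elements are included.\<close>

definition commuting :: "('v word set \<Rightarrow> 'v word set) rel" where
  "commuting = {(s, t). s \<in> S \<and> t \<in> S \<and> s \<odot> t = t \<odot> s}"

lemma commuting_sym: "(s, t) \<in> commuting\<^sup>* \<Longrightarrow> (t, s) \<in> commuting\<^sup>*"
proof -
  have "sym commuting" unfolding commuting_def sym_def by auto
  then show "(s, t) \<in> commuting\<^sup>* \<Longrightarrow> (t, s) \<in> commuting\<^sup>*" using sym_rtrancl symD by metis
qed

lemma same_letter:
  assumes "s \<in> S" "t \<in> S" "acts s w p q" "acts t w p' q'"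
  shows "(s, t) \<in> commuting"
  using acts_commute[OF assms(3,4)] assms unfolding commuting_def acts_def by auto

text \<open>One pair of generators represents all, since elements of \<open>S\<close> with the same
  acting letter commute. This moves connectedness from generators to vertices.\<close>

definition linked :: "'v \<Rightarrow> 'v \<Rightarrow> bool" where
  "linked w x \<longleftrightarrow> (\<exists>s p q t p' q'. s \<in> S \<and> acts s w p q \<and> t \<in> S \<and> acts t x p' q' \<and> (s, t) \<in> commuting\<^sup>*)"

lemma linkedD:
  assumes "linked w x" "s \<in> S" "acts s w p q" "t \<in> S" "acts t x p' q'"
  shows "(s, t) \<in> commuting\<^sup>*"
proof -
  obtain s0 p0 q0 t0 p1 q1 where 0: "s0 \<in> S" "acts s0 w p0 q0" "t0 \<in> S" "acts t0 x p1 q1" "(s0, t0) \<in> commuting\<^sup>*"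
    using assms(1) unfolding linked_def by blast
  have "(s, s0) \<in> commuting" "(t0, t) \<in> commuting" using same_letter 0 assms by blast+
  then show ?thesis using 0(5) by (meson converse_rtrancl_into_rtrancl rtrancl.rtrancl_into_rtrancl)
qed

lemma linked_sym: "linked w x \<Longrightarrow> linked x w"
  unfolding linked_def using commuting_sym by blast

lemma linked_trans:
  assumes "linked w x" "linked x y"
  shows "linked w y"
proof -
  obtain s p q t p' q' where s: "s \<in> S" "acts s w p q" "t \<in> S" "acts t x p' q'" "(s, t) \<in> commuting\<^sup>*"
    using assms(1) unfolding linked_def by blast
  obtain r p1 q1 where r: "r \<in> S" "acts r y p1 q1"
    using assms(2) unfolding linked_def by blast
  have "(t, r) \<in> commuting\<^sup>*" using linkedD[OF assms(2) s(3,4) r] .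
  then show ?thesis using s r unfolding linked_def by (meson rtrancl_trans)
qed

lemma linkedI: "s \<in> S \<Longrightarrow> acts s w p q \<Longrightarrow> t \<in> S \<Longrightarrow> acts t x p' q' \<Longrightarrow> s \<odot> t = t \<odot> s \<Longrightarrow> linked w x"
  unfolding linked_def commuting_def by blast

lemma another_vertex:
  assumes "card V \<ge> 3"
  obtains v where "v \<in> V" "v \<noteq> a" "v \<noteq> b"
proof -
  have "\<not> V \<subseteq> {a, b}"
  proof
    assume "V \<subseteq> {a, b}"
    then have "card V \<le> card {a, b}" by (intro card_mono) auto
    also have "\<dots> \<le> 2" by (simp add: card_insert_if)
    finally show False using assms by simp
  qed
  then show thesis using that by blast
qed

text \<open>If the star of \<open>w\<close> contains every vertex, any other vertex can be
  multiplied by \<open>w\<close>, and a third vertex \<open>v\<close> leaves \<open>x\<close> fixed.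
  Otherwise a partial conjugation by \<open>w\<close> moves only vertices outside the star, hence
  not \<open>x\<close>.\<close>

lemma pick:
  assumes n: "card V \<ge> 3" and w: "w \<in> V" and x: "x \<in> st \<Gamma> w"
  obtains s p q where "s \<in> S" "acts s w p q" "p x = 0" "q x = 0"
proof (cases "V \<subseteq> st \<Gamma> w")
  case True
  obtain v where v: "v \<in> V" "v \<noteq> w" "v \<noteq> x" using another_vertex[OF n] by metis
  have "lk \<Gamma> v \<subseteq> st \<Gamma> w" using True unfolding lk_def by blast
  then obtain s where "s \<in> S" "acts s w (\<lambda>_. 0) (ind {v})" using right_transvection v w by metis
  then show thesis using that[of s "\<lambda>_. 0" "ind {v}"] v by (simp add: ind_def)
next
  case False
  then obtain u where "u \<in> V - st \<Gamma> w" by blast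
  then obtain C where C: "C \<in> components_minus_star \<Gamma> w" using component_exists by metis
  then have "x \<notin> C" using component_subset x by blast
  moreover obtain s where "s \<in> S" "acts s w (ind C) (\<lambda>u. - ind C u)" using partial_conjugation[OF w C] .
  ultimately show thesis using that[of s "ind C" "\<lambda>u. - ind C u"] by (simp add: ind_def)
qed

lemma linked_refl: "card V \<ge> 3 \<Longrightarrow> w \<in> V \<Longrightarrow> linked w w"
  unfolding linked_def using pick[of w w] by (metis rtrancl.rtrancl_refl insertI1 st_def)

lemma linked_edge:
  assumes n: "card V \<ge> 3" and wx: "(w, x) \<in> parcs \<Gamma>"
  shows "linked w x"
proof -
  have V: "w \<in> V" "x \<in> V" "x \<in> st \<Gamma> w" "w \<in> st \<Gamma> x"
    using edge_V[OF wx] lkI[OF wx] lkI[OF edge_sym[OF wx]] unfolding st_def by auto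
  obtain s p q where s: "s \<in> S" "acts s w p q" "p x = 0" "q x = 0" using pick[OF n V(1,3)] .
  obtain t p' q' where t: "t \<in> S" "acts t x p' q'" "p' w = 0" "q' w = 0" using pick[OF n V(2,4)] .
  show ?thesis
    using linkedI[OF s(1,2) t(1,2)] acts_commute[OF s(2) t(2) s(3,4) t(3,4)] gen_commute[OF wx] by blast
qed

lemma linked_class:
  assumes n: "card V \<ge> 3" and "(w, x) \<in> (parcs \<Gamma>)\<^sup>*" "w \<in> V"
  shows "linked w x"
  using assms(2)
proof (induction rule: rtrancl_induct)
  case base
  then show ?case using linked_refl n assms(3) by blast
next
  case (step y z)
  then show ?case using linked_trans linked_edge[OF n] by blast
qed

text \<open>Meant for making generators in different components of \<open>\<Gamma>\<close> commute:
  the acting letter and the moved vertices stay in the component of \<open>v\<close>. A component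
  that is not complete admits a partial conjugation; in a complete one \<open>v\<close> can be
  multiplied by \<open>v'\<close>.\<close>

lemma local_generator:
  assumes vv: "(v, v') \<in> parcs \<Gamma>"
  obtains w s p q where "(v, w) \<in> (parcs \<Gamma>)\<^sup>*" "s \<in> S" "acts s w p q"
    "\<And>u. p u \<noteq> 0 \<or> q u \<noteq> 0 \<Longrightarrow> (v, u) \<in> (parcs \<Gamma>)\<^sup>*"
proof (cases "\<exists>w u. (v, w) \<in> (parcs \<Gamma>)\<^sup>* \<and> (v, u) \<in> (parcs \<Gamma>)\<^sup>* \<and> u \<notin> st \<Gamma> w")
  case True
  then obtain w u where w: "(v, w) \<in> (parcs \<Gamma>)\<^sup>*" "(v, u) \<in> (parcs \<Gamma>)\<^sup>*" "u \<notin> st \<Gamma> w" by blast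
  have V: "v \<in> V" "w \<in> V" "u \<in> V" using edge_V[OF vv] rtrancl_edge_V w by auto
  obtain C where C: "C \<in> components_minus_star \<Gamma> w" "\<And>x. x \<in> C \<Longrightarrow> (u, x) \<in> (parcs \<Gamma>)\<^sup>*"
    using component_exists[of u w] w V by blast
  obtain s where s: "s \<in> S" "acts s w (ind C) (\<lambda>u. - ind C u)" using partial_conjugation[OF V(2) C(1)] .
  show thesis
  proof (rule that[OF w(1) s])
    fix x assume "ind C x \<noteq> 0 \<or> - ind C x \<noteq> 0"
    then have "x \<in> C" by (auto simp: ind_def split: if_splits)
    then show "(v, x) \<in> (parcs \<Gamma>)\<^sup>*" using C(2) w(2) by (meson rtrancl_trans)
  qed
next
  case False
  have V: "v \<in> V" "v' \<in> V" "v \<noteq> v'" using edge_V[OF vv] vv edge_irrefl by auto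
  have "lk \<Gamma> v \<subseteq> st \<Gamma> v'"
    using False vv unfolding lk_def by (auto dest: r_into_rtrancl)
  then obtain s where s: "s \<in> S" "acts s v' (\<lambda>_. 0) (ind {v})" using right_transvection[OF V] by blast
  show thesis
    by (rule that[OF r_into_rtrancl[OF vv] s]) (auto simp: ind_def split: if_splits)
qed

definition conj :: "'v word set \<Rightarrow> 'v word set \<Rightarrow> 'v word set" where
  "conj a = (\<lambda>x\<in>carrier A. a \<cdot> x \<cdot> inv\<^bsub>A\<^esub> a)"

lemma conj_hom:
  assumes a: "a \<in> carrier A"
  shows "conj a \<in> hom A A"
proof (rule homI)
  fix x y assume xy: "x \<in> carrier A" "y \<in> carrier A"
  have "inv\<^bsub>A\<^esub> a \<cdot> (a \<cdot> z) = z" if "z \<in> carrier A" for z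
    using a that by (simp add: A.m_assoc[symmetric])
  then show "conj a (x \<cdot> y) = conj a x \<cdot> conj a y"
    using a xy by (simp add: conj_def A.m_assoc)
qed (use a in \<open>simp add: conj_def\<close>)

text \<open>On the generators in \<open>B\<close>, \<open>t\<close> is conjugation by
  \<open>gen z\<close>. As \<open>s\<close> fixes \<open>gen z\<close> and moves generators in
  \<open>B\<close> only, by a letter of \<open>B\<close>, it commutes with this conjugation there;
  outside \<open>B\<close> both are trivial.\<close>

lemma conj_of_isolated_commute:
  assumes s: "acts s w p q" and t: "acts t z (ind B) (\<lambda>u. - ind B u)"
    and supp: "\<And>u. p u \<noteq> 0 \<or> q u \<noteq> 0 \<Longrightarrow> u \<in> B" and wB: "w \<in> B" and zB: "z \<notin> B"
  shows "s \<odot> t = t \<odot> s"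
proof (rule Aut_eqI)
  have cs: "s \<in> carrier Aut" "t \<in> carrier Aut" "w \<in> V" "z \<in> V" using s t unfolding acts_def by auto
  show "s \<odot> t \<in> carrier Aut" "t \<odot> s \<in> carrier Aut" using cs by auto
  fix u assume u: "u \<in> V"
  have val: "s (gen v) = twist w p q v" "t (gen v) = twist z (ind B) (\<lambda>u. - ind B u) v" if "v \<in> V" for v
    using s t that unfolding acts_def by auto
  have "s (gen z) = gen z" using acts_fix[OF s cs(4)] supp zB by blast
  interpret s: group_hom A A s using Aut_hom[OF cs(1)] .
  have k: "group_hom A A (conj (gen z))" using group_homI[OF A.group_axioms conj_hom] cs by simp
  show "(s \<odot> t) (gen u) = (t \<odot> s) (gen u)"
  proof (cases "u \<in> B")
    case True
    have tB: "t (gen v) = conj (gen z) (gen v)" if "v \<in> V" "v \<in> B" for v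
      using val(2)[OF that(1)] twist_values(4)[OF cs(4) that(1), of "ind B"] that cs by (simp add: ind_def conj_def)
    have "(s \<odot> t) (gen u) = conj (gen z) (twist w p q u)"
      using Aut_mult cs u tB[OF u True] val(1)[OF u] \<open>s (gen z) = gen z\<close> by (simp add: conj_def)
    also have "\<dots> = (t \<odot> s) (gen u)"
      using Aut_mult[OF cs(2,1)] cs u val(1)[OF u] hom_twist[OF k cs(3) u] hom_twist[OF Aut_hom[OF cs(2)] cs(3) u]
        tB[OF u True] tB[OF cs(3) wB] by simp
    finally show ?thesis .
  next
    case False
    then have "s (gen u) = gen u" "t (gen u) = gen u"
      using acts_fix[OF s u] acts_fix[OF t u] supp by (auto simp: ind_def)
    then show ?thesis using Aut_mult cs u by simp
  qed
qed

text \<open>The star of \<open>z\<close> is \<open>z\<close> alone, so a partial conjugation by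
  \<open>z\<close> conjugates the whole component of \<open>v\<close> and commutes with a generator
  living in it. If \<open>v\<close> is isolated as well, multiplying it on the right by
  \<open>z\<close> commutes with multiplying it on the left by a third vertex.\<close>

lemma isolated_linked:
  assumes n: "card V \<ge> 3" and z: "z \<in> V" "\<And>y. (z, y) \<notin> parcs \<Gamma>" and v: "v \<in> V" "v \<noteq> z"
  shows "\<exists>y\<in>V - {z}. linked z y"
proof (cases "\<exists>v'. (v, v') \<in> parcs \<Gamma>")
  case True
  then obtain v' where vv: "(v, v') \<in> parcs \<Gamma>" by blast
  obtain w s p q where w: "(v, w) \<in> (parcs \<Gamma>)\<^sup>*" "s \<in> S" "acts s w p q"
    "\<And>u. p u \<noteq> 0 \<or> q u \<noteq> 0 \<Longrightarrow> (v, u) \<in> (parcs \<Gamma>)\<^sup>*"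
    using local_generator[OF vv] by blast
  have zv: "(v, z) \<notin> (parcs \<Gamma>)\<^sup>*"
    using z(2) v(2) by (metis converse_rtranclE rtrancl_edge_sym)
  have st: "st \<Gamma> z = {z}" using z unfolding st_def lk_def by auto
  obtain B where B: "B \<in> components_minus_star \<Gamma> z" "v \<in> B" "\<And>u. u \<in> B \<Longrightarrow> (v, u) \<in> (parcs \<Gamma>)\<^sup>*"
    using component_exists[of v z] v st by auto
  have Bv: "u \<in> B" if "(v, u) \<in> (parcs \<Gamma>)\<^sup>*" for u
    using that
  proof (induction rule: rtrancl_induct)
    case (step a b)
    then have "b \<noteq> z" using zv by (meson rtrancl.rtrancl_into_rtrancl)
    then show ?case using component_closed[OF B(1)] step st by auto
  qed (rule B(2))
  obtain t where t: "t \<in> S" "acts t z (ind B) (\<lambda>u. - ind B u)" using partial_conjugation[OF z(1) B(1)] .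
  have "s \<odot> t = t \<odot> s"
    using conj_of_isolated_commute[OF w(3) t(2)] w(1,4) Bv B(3) zv by blast
  then have "linked w z" using linkedI w t by blast
  moreover have "w \<in> V - {z}" using rtrancl_edge_V w(1) v zv by auto
  ultimately show ?thesis using linked_sym by blast
next
  case False
  then have lkv: "lk \<Gamma> v = {}" unfolding lk_def by auto
  obtain y where y: "y \<in> V" "y \<noteq> z" "y \<noteq> v" using another_vertex[OF n] by metis
  obtain s where s: "s \<in> S" "acts s z (\<lambda>_. 0) (ind {v})" using right_transvection[of v z] v z lkv by blast
  obtain t where t: "t \<in> S" "acts t y (ind {v}) (\<lambda>_. 0)" using left_transvection[of v y] v y lkv by blast
  have "s \<odot> t = t \<odot> s"
    by (rule acts_commute[OF s(2) t(2)]) (use v y in \<open>auto simp: ind_def\<close>)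
  then show ?thesis using linkedI s t y by blast
qed

text \<open>An isolated \<open>z\<close> can be multiplied on the right by \<open>a\<close> and on
  the left by \<open>b\<close>, which links all letters other than \<open>z\<close>;
  \<open>isolated_linked\<close> attaches \<open>z\<close>. Without isolated vertices, generators
  local to different components commute, and edges link the letters within a component.\<close>

lemma all_linked:
  assumes n: "card V \<ge> 3" and wx: "w \<in> V" "x \<in> V"
  shows "linked w x"
proof (cases "\<exists>z\<in>V. \<forall>y. (z, y) \<notin> parcs \<Gamma>")
  case True
  then obtain z where z: "z \<in> V" "\<And>y. (z, y) \<notin> parcs \<Gamma>" by blast
  then have lkz: "lk \<Gamma> z = {}" unfolding lk_def by auto
  have others: "linked a b" if ab: "a \<in> V - {z}" "b \<in> V - {z}" for a b
  proof -
    obtain s where s: "s \<in> S" "acts s a (\<lambda>_. 0) (ind {z})" using right_transvection[of z a] ab z(1) lkz by blast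
    obtain t where t: "t \<in> S" "acts t b (ind {z}) (\<lambda>_. 0)" using left_transvection[of z b] ab z(1) lkz by blast
    have "s \<odot> t = t \<odot> s"
      by (rule acts_commute[OF s(2) t(2)]) (use ab in \<open>auto simp: ind_def\<close>)
    then show ?thesis using linkedI s t by blast
  qed
  obtain v where "v \<in> V" "v \<noteq> z" using another_vertex[OF n] by metis
  then obtain y where y: "y \<in> V - {z}" "linked z y" using isolated_linked[OF n z] by blast
  have "linked z a" if "a \<in> V" for a
    using that linked_refl[OF n z(1)] linked_trans[OF y(2) others[OF y(1), of a]] by (cases "a = z") simp_all
  then show ?thesis using linked_trans[OF linked_sym] wx by blast
next
  case False
  then obtain w' x' where e: "(w, w') \<in> parcs \<Gamma>" "(x, x') \<in> parcs \<Gamma>" using wx by blast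
  show ?thesis
  proof (cases "(w, x) \<in> (parcs \<Gamma>)\<^sup>*")
    case True
    then show ?thesis using linked_class[OF n] wx by blast
  next
    case False
    obtain a s p q where a: "(w, a) \<in> (parcs \<Gamma>)\<^sup>*" "s \<in> S" "acts s a p q"
      "\<And>u. p u \<noteq> 0 \<or> q u \<noteq> 0 \<Longrightarrow> (w, u) \<in> (parcs \<Gamma>)\<^sup>*"
      using local_generator[OF e(1)] by blast
    obtain b t p' q' where b: "(x, b) \<in> (parcs \<Gamma>)\<^sup>*" "t \<in> S" "acts t b p' q'"
      "\<And>u. p' u \<noteq> 0 \<or> q' u \<noteq> 0 \<Longrightarrow> (x, u) \<in> (parcs \<Gamma>)\<^sup>*"
      using local_generator[OF e(2)] by blast
    have disj: "\<not> ((w, u) \<in> (parcs \<Gamma>)\<^sup>* \<and> (x, u) \<in> (parcs \<Gamma>)\<^sup>*)" for u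
      using False rtrancl_edge_sym by (meson rtrancl_trans)
    have "s \<odot> t = t \<odot> s"
      by (rule acts_commute[OF a(3) b(3)]) (use a(1,4) b(1,4) disj in blast)+
    then have "linked a b" using linkedI a b by blast
    then show ?thesis
      using linked_class[OF n a(1) wx(1)] linked_class[OF n b(1) wx(2)] linked_trans linked_sym by blast
  qed
qed

theorem S_connected:
  assumes "card V \<ge> 3" "s \<in> S" "t \<in> S"
  shows "(s, t) \<in> commuting\<^sup>*"
proof -
  obtain w p q x p' q' where "acts s w p q" "acts t x p' q'" using S_acts assms(2,3) by metis
  moreover have "linked w x" using all_linked[OF assms(1)] calculation unfolding acts_def by blast
  ultimately show ?thesis using linkedD assms(2,3) by blast
qed

text \<open>Connectedness of a digraph includes that it has a vertex.\<close>

lemma S_nonempty: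
  assumes "card V \<ge> 3"
  shows "S \<noteq> {}"
proof -
  obtain v where "v \<in> V" using another_vertex[OF assms] by metis
  then have "linked v v" using linked_refl assms by blast
  then show ?thesis unfolding linked_def by blast
qed

lemma comm_group_of_commuting:
  assumes G: "group G" and st: "s \<in> carrier G" "t \<in> carrier G" "s \<otimes>\<^bsub>G\<^esub> t = t \<otimes>\<^bsub>G\<^esub> s"
  shows "comm_group (subgroup_generated G {s, t})"
proof -
  interpret G: group G by fact
  have c1: "a \<otimes>\<^bsub>G\<^esub> g = g \<otimes>\<^bsub>G\<^esub> a"
    if "g \<in> generate G {s, t}" "a \<in> carrier G" "a \<otimes>\<^bsub>G\<^esub> s = s \<otimes>\<^bsub>G\<^esub> a" "a \<otimes>\<^bsub>G\<^esub> t = t \<otimes>\<^bsub>G\<^esub> a" for g a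
  proof -
    have inv: "a \<otimes>\<^bsub>G\<^esub> inv\<^bsub>G\<^esub> h = inv\<^bsub>G\<^esub> h \<otimes>\<^bsub>G\<^esub> a" if "h \<in> carrier G" "a \<otimes>\<^bsub>G\<^esub> h = h \<otimes>\<^bsub>G\<^esub> a" for h
      using that \<open>a \<in> carrier G\<close> by (metis G.inv_closed G.inv_solve_left G.inv_solve_right G.m_assoc G.m_closed)
    have "g \<in> carrier G \<and> a \<otimes>\<^bsub>G\<^esub> g = g \<otimes>\<^bsub>G\<^esub> a"
      using that(1)
    proof (induction rule: generate.induct)
      case (eng g h)
      then show ?case using that(2) by (metis G.m_assoc G.m_closed)
    qed (use that st inv in auto)
    then show ?thesis by blast
  qed
  have sub: "generate G {s, t} \<subseteq> carrier G" using G.generate_incl[of "{s, t}"] st by auto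
  have "a \<otimes>\<^bsub>G\<^esub> b = b \<otimes>\<^bsub>G\<^esub> a" if "a \<in> generate G {s, t}" "b \<in> generate G {s, t}" for a b
  proof (rule c1[OF that(2)])
    show "a \<in> carrier G" using that sub by blast
    show "a \<otimes>\<^bsub>G\<^esub> s = s \<otimes>\<^bsub>G\<^esub> a" "a \<otimes>\<^bsub>G\<^esub> t = t \<otimes>\<^bsub>G\<^esub> a" using c1[OF that(1)] st by metis+
  qed
  moreover have "carrier G \<inter> {s, t} = {s, t}" using st by blast
  ultimately show ?thesis
    by (intro group.group_comm_groupI G.group_subgroup_generated)
      (simp add: carrier_subgroup_generated)
qed

text \<open>The exponents 1 witness the edges. Commuting pairs of equal elements are skipped in a
  chain, as the graph has no loops.\<close>

theorem commutativity_graph_connected: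
  assumes n: "card V \<ge> 3"
  shows "Digraph_Component.connected (with_proj (commutativity_graph (Aut_star \<Gamma>) S))"
proof -
  define K where "K = commutativity_graph (Aut_star \<Gamma>) S"
  have grp: "group (Aut_star \<Gamma>)" unfolding Aut_star_def by (rule Aut.group_subgroup_generated)
  have car: "S \<subseteq> carrier (Aut_star \<Gamma>)"
    unfolding Aut_star_def carrier_subgroup_generated using S_carrier by (auto intro: generate.incl)
  interpret G: group "Aut_star \<Gamma>" by (rule grp)
  have edge: "(s, t) \<in> parcs K" if "(s, t) \<in> commuting" "s \<noteq> t" for s t
  proof -
    have st: "s \<in> S" "t \<in> S" "s \<otimes>\<^bsub>Aut_star \<Gamma>\<^esub> t = t \<otimes>\<^bsub>Aut_star \<Gamma>\<^esub> s"
      using that unfolding commuting_def Aut_star_def by auto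
    then have "comm_group (subgroup_generated (Aut_star \<Gamma>) {s [^]\<^bsub>Aut_star \<Gamma>\<^esub> (1 :: int), t [^]\<^bsub>Aut_star \<Gamma>\<^esub> (1 :: int)})"
      using comm_group_of_commuting[OF grp _ _ st(3)] car st(1,2) by (simp add: subset_iff)
    then show ?thesis using st that(2) unfolding K_def commutativity_graph_def
      by (auto intro!: exI[of _ "1 :: int"])
  qed
  have KV: "pverts K = S" unfolding K_def commutativity_graph_def by simp
  have "(s, t) \<in> rtrancl_on S (parcs (mk_symmetric (with_proj K)))" if "s \<in> S" "(s, t) \<in> commuting\<^sup>*" for s t
    using that(2)
  proof (induction rule: rtrancl_induct)
    case (step t r)
    then have "r \<in> S" unfolding commuting_def by blast
    then show ?case
      using step edge[of t r] by (cases "t = r")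
        (auto simp: parcs_mk_symmetric intro!: rtrancl_on.rtrancl_on_into_rtrancl_on[of s t])
  qed (use that(1) in \<open>auto intro: rtrancl_on.rtrancl_on_refl\<close>)
  then have "s \<rightarrow>\<^sup>*\<^bsub>with_proj (mk_symmetric (with_proj K))\<^esub> t" if "s \<in> S" "t \<in> S" for s t
    using S_connected[OF n] that KV by (auto simp: reachable_def)
  then show ?thesis
    using S_nonempty[OF n] KV unfolding K_def[symmetric] Digraph_Component.connected_def
    by (intro strongly_connectedI) auto
qed

end

section \<open>Peripheral subgroups of the automorphism group\<close>

text \<open>Monomials multiply by adding exponents, so independence of \<open>s\<close> and
  \<open>t\<close> makes \<open>B\<close> free abelian of rank two. The conclusions are the
  hypotheses of \<open>relatively_hyperbolic_peripheral\<close>.\<close>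

lemma (in group) rank_two_subgroup:
  assumes st: "s \<in> carrier G" "t \<in> carrier G" "s \<otimes> t = t \<otimes> s"
    and ind: "\<forall>(i :: int) (j :: int). s [^] i \<otimes> t [^] j = \<one> \<longrightarrow> i = 0 \<and> j = 0"
  defines "B \<equiv> range (\<lambda>(i :: int, j :: int). s [^] i \<otimes> t [^] j)"
  shows "subgroup B G" "\<And>a b. a \<in> B \<Longrightarrow> b \<in> B \<Longrightarrow> a \<otimes> b = b \<otimes> a"
    "\<And>a n. a \<in> B \<Longrightarrow> a \<noteq> \<one> \<Longrightarrow> a [^] (n :: nat) = \<one> \<Longrightarrow> n = 0"
    "s \<in> B" "t \<in> B" "inj (\<lambda>(i :: nat, j :: nat). s [^] i \<otimes> t [^] j)"
proof -
  let ?w = "\<lambda>(i :: int) (j :: int). s [^] i \<otimes> t [^] j"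
  have B: "a \<in> B \<longleftrightarrow> (\<exists>i j. a = ?w i j)" for a
    unfolding B_def by (simp add: image_iff split_paired_Ex)
  have mult: "?w i j \<otimes> ?w k l = ?w (i + k) (j + l)" for i j k l
  proof -
    have "?w i j \<otimes> ?w k l = s [^] i \<otimes> (t [^] j \<otimes> s [^] k) \<otimes> t [^] l" using st by (simp add: m_assoc)
    also have "t [^] j \<otimes> s [^] k = s [^] k \<otimes> t [^] j" using int_pow_commute2[OF st] by simp
    also have "s [^] i \<otimes> (s [^] k \<otimes> t [^] j) \<otimes> t [^] l = (s [^] i \<otimes> s [^] k) \<otimes> (t [^] j \<otimes> t [^] l)"
      using st by (simp add: m_assoc)
    finally show ?thesis using st by (simp add: int_pow_mult)
  qed
  have wc: "?w i j \<in> carrier G" for i j using st by simp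
  have w0: "?w 0 0 = \<one>" by simp
  have winv: "inv (?w i j) = ?w (- i) (- j)" for i j
    using mult[of "- i" "- j" i j] wc w0 by (intro inv_equality) auto
  show sub: "subgroup B G"
  proof (unfold_locales)
    show "B \<subseteq> carrier G" using wc unfolding B_def by auto
    show "\<one> \<in> B" using w0 B by metis
    show "x \<otimes> y \<in> B" if "x \<in> B" "y \<in> B" for x y using that mult unfolding B by metis
    show "inv x \<in> B" if "x \<in> B" for x using that winv unfolding B by metis
  qed
  show "a \<otimes> b = b \<otimes> a" if ab: "a \<in> B" "b \<in> B" for a b
  proof -
    obtain i j k l where "a = ?w i j" "b = ?w k l" using ab unfolding B by blast
    then show ?thesis using mult[of i j k l] mult[of k l i j] by (simp add: add.commute)
  qed
  have pow: "?w i j [^] n = ?w (int n * i) (int n * j)" for i j and n :: nat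
  proof (induction n)
    case (Suc n)
    have "?w i j [^] Suc n = ?w (int n * i) (int n * j) \<otimes> ?w i j" using Suc by simp
    also have "\<dots> = ?w (int n * i + i) (int n * j + j)" by (rule mult)
    finally show ?case by (simp add: algebra_simps)
  qed simp
  show "n = 0" if a: "a \<in> B" "a \<noteq> \<one>" "a [^] n = \<one>" for a and n :: nat
  proof -
    obtain i j where ij: "a = ?w i j" using a(1) unfolding B by blast
    then have "?w (int n * i) (int n * j) = \<one>" using pow a(3) by simp
    then have "int n * i = 0 \<and> int n * j = 0" using ind by blast
    then show ?thesis using ij a(2) by auto
  qed
  show "s \<in> B" "t \<in> B"
    using B[of s] B[of t] st
    by (metis int_pow_0 int_pow_1 r_one, metis int_pow_0 int_pow_1 l_one)
  show "inj (\<lambda>(i :: nat, j :: nat). s [^] i \<otimes> t [^] j)"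
  proof (rule injI, clarify)
    fix i j k l :: nat
    assume "s [^] i \<otimes> t [^] j = s [^] k \<otimes> t [^] l"
    then have "?w (int i) (int j) = ?w (int k) (int l)" by (simp add: int_pow_int)
    then have "?w (int i) (int j) \<otimes> ?w (- int k) (- int l) = \<one>"
      using winv[of "int k" "int l"] wc by (metis r_inv)
    then have "?w (int i - int k) (int j - int l) = \<one>" unfolding mult by simp
    then show "i = k \<and> j = l" using ind by fastforce
  qed
qed

context raag_graph begin

section \<open>Infinite order and independent commuting generators\<close>

definition torsion_free :: "('v word set \<Rightarrow> 'v word set) \<Rightarrow> bool" where
  "torsion_free s \<longleftrightarrow> (\<forall>n :: nat. s [^]\<^bsub>Aut\<^esub> n = \<one>\<^bsub>Aut\<^esub> \<longrightarrow> n = 0)"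

lemma torsion_freeD_int:
  assumes "torsion_free s" "s \<in> carrier Aut" "s [^]\<^bsub>Aut\<^esub> (i :: int) = \<one>\<^bsub>Aut\<^esub>"
  shows "i = 0"
proof (cases i rule: int_cases)
  case (nonneg n)
  then show ?thesis using assms unfolding torsion_free_def by (simp add: int_pow_int)
next
  case (neg n)
  have "inv\<^bsub>Aut\<^esub> (s [^]\<^bsub>Aut\<^esub> Suc n) = \<one>\<^bsub>Aut\<^esub>"
    using Aut.int_pow_neg_int[OF assms(2), of "Suc n"] assms(3) neg by simp
  then have "s [^]\<^bsub>Aut\<^esub> Suc n = \<one>\<^bsub>Aut\<^esub>"
    using Aut.inv_eq_1_iff[of "s [^]\<^bsub>Aut\<^esub> Suc n"] assms(2) by (metis Aut.nat_pow_closed)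
  then show ?thesis using assms(1) unfolding torsion_free_def by blast
qed

text \<open>The exponent sum of the acting letter detects the powers of a transvection. A partial
  conjugation preserves exponent sums, so its powers are detected in the infinite dihedral quotient
  instead.\<close>

lemma S_torsion_free:
  assumes "s \<in> S"
  shows "torsion_free s"
  unfolding torsion_free_def
proof (intro allI impI)
  fix n :: nat assume one: "s [^]\<^bsub>Aut\<^esub> n = \<one>\<^bsub>Aut\<^esub>"
  have fixed: "twist w (\<lambda>u. int n * p u) (\<lambda>u. int n * q u) u = gen u" if "acts s w p q" "u \<in> V" for w p q u
    using acts_nat_pow[OF that(1), of n] that(2) one Aut_one unfolding acts_def by simp
  from assms show "n = 0"
  proof (cases rule: S_cases)
    case (1 v w)
    then show ?thesis using exponent_twist[OF _ _ _ fixed[OF 1(5)], of v] by (simp add: ind_def)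
  next
    case (2 v w)
    then show ?thesis using exponent_twist[OF _ _ _ fixed[OF 2(5)], of v] by (simp add: ind_def)
  next
    case (3 w C)
    obtain u where u: "u \<in> C" using component_nonempty[OF 3(2)] by blast
    then have "u \<in> V" "u \<notin> st \<Gamma> w" using component_subset[OF 3(2)] by auto
    then show ?thesis
      using conj_power_nontrivial[OF 3(1), of u "int n"] fixed[OF 3(3), of u] u by (simp add: twist_def ind_def)
  qed
qed

text \<open>If \<open>w\<close> is adjacent to \<open>x\<close> but not to some \<open>u\<close>, a
  partial conjugation by \<open>w\<close> is paired with a generator acting by \<open>x\<close>; the
  dihedral quotient for \<open>w\<close> and \<open>u\<close> kills \<open>x\<close> and sees only
  the power of \<open>w\<close>. Otherwise \<open>\<Gamma>\<close> is complete or edgeless, and a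
  vertex is multiplied on the right and on the left by two others, told apart by an exponent
  sum.\<close>

lemma independent_pair:
  assumes n: "card V \<ge> 3"
  obtains s t where "s \<in> S" "t \<in> S" "s \<odot> t = t \<odot> s"
    "\<forall>(i :: int) (j :: int). s [^]\<^bsub>Aut\<^esub> i \<odot> t [^]\<^bsub>Aut\<^esub> j = \<one>\<^bsub>Aut\<^esub> \<longrightarrow> i = 0 \<and> j = 0"
proof -
  note found = that
  \<comment> \<open>Once \<open>i = 0\<close>, a power of \<open>t\<close> is trivial, and
    \<open>t\<close> has infinite order.\<close>
  have suffices: thesis
    if st: "s \<in> S" "t \<in> S" "s \<odot> t = t \<odot> s"
      and i: "\<And>(i :: int) (j :: int). s [^]\<^bsub>Aut\<^esub> i \<odot> t [^]\<^bsub>Aut\<^esub> j = \<one>\<^bsub>Aut\<^esub> \<Longrightarrow> i = 0" for s t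
  proof (rule found[OF st], intro allI impI)
    fix i j :: int assume e: "s [^]\<^bsub>Aut\<^esub> i \<odot> t [^]\<^bsub>Aut\<^esub> j = \<one>\<^bsub>Aut\<^esub>"
    then have "i = 0" by (rule i)
    moreover have "t [^]\<^bsub>Aut\<^esub> j = \<one>\<^bsub>Aut\<^esub>" using e \<open>i = 0\<close> S_carrier[OF st(2)] by simp
    ultimately show "i = 0 \<and> j = 0" using torsion_freeD_int S_torsion_free S_carrier st(2) by blast
  qed
  have composite: "gen x \<up> (j * p' u) \<cdot> twist w (\<lambda>u. i * p u) (\<lambda>u. i * q u) u \<cdot> gen x \<up> (j * q' u) = gen u"
    if s: "acts s w p q" and t: "acts t x p' q'" and x: "p x = 0" "q x = 0" and u: "u \<in> V"
      and e: "s [^]\<^bsub>Aut\<^esub> i \<odot> t [^]\<^bsub>Aut\<^esub> j = \<one>\<^bsub>Aut\<^esub>" for s t w x p q p' q' u and i j :: int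
  proof -
    let ?s = "s [^]\<^bsub>Aut\<^esub> i" and ?t = "t [^]\<^bsub>Aut\<^esub> j"
    have a: "acts ?s w (\<lambda>u. i * p u) (\<lambda>u. i * q u)" "acts ?t x (\<lambda>u. j * p' u) (\<lambda>u. j * q' u)"
      using acts_int_pow s t by blast+
    then have c: "?s \<in> carrier Aut" "?t \<in> carrier Aut" "x \<in> V" unfolding acts_def by auto
    have "?s (gen x) = gen x" using acts_fix[OF a(1) c(3)] x by simp
    then have "?s (?t (gen u)) = gen x \<up> (j * p' u) \<cdot> twist w (\<lambda>u. i * p u) (\<lambda>u. i * q u) u \<cdot> gen x \<up> (j * q' u)"
      using a u hom_twist[OF Aut_hom[OF c(1)] c(3) u] unfolding acts_def by simp
    moreover have "?s (?t (gen u)) = gen u"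
      using e Aut_mult[OF c(1,2), of "gen u"] Aut_one u by simp
    ultimately show ?thesis by simp
  qed
  show thesis
  proof (cases "\<exists>w x u. (w, x) \<in> parcs \<Gamma> \<and> u \<in> V - st \<Gamma> w")
    case True
    then obtain w x u where w: "(w, x) \<in> parcs \<Gamma>" "u \<in> V - st \<Gamma> w" by blast
    have V: "w \<in> V" "x \<in> V" "x \<in> st \<Gamma> w" "w \<in> st \<Gamma> x" "x \<noteq> w" "u \<in> V" "u \<notin> st \<Gamma> w"
      using edge_V[OF w(1)] lkI[OF w(1)] lkI[OF edge_sym[OF w(1)]] w edge_irrefl unfolding st_def by auto
    obtain C where C: "C \<in> components_minus_star \<Gamma> w" "u \<in> C" using component_exists[OF w(2)] by blast
    then have xC: "x \<notin> C" using component_subset V by blast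
    obtain s where s: "s \<in> S" "acts s w (ind C) (\<lambda>u. - ind C u)" using partial_conjugation[OF V(1) C(1)] .
    obtain t p' q' where t: "t \<in> S" "acts t x p' q'" "p' w = 0" "q' w = 0" using pick[OF n V(2,4)] .
    show thesis
    proof (rule suffices[OF s(1) t(1)])
      show "s \<odot> t = t \<odot> s"
        by (rule acts_commute[OF s(2) t(2) _ _ t(3,4)]) (use xC gen_commute[OF w(1)] in \<open>auto simp: ind_def\<close>)
      fix i j :: int assume e: "s [^]\<^bsub>Aut\<^esub> i \<odot> t [^]\<^bsub>Aut\<^esub> j = \<one>\<^bsub>Aut\<^esub>"
      have eq: "gen x \<up> (j * p' u) \<cdot> (gen w \<up> i \<cdot> gen u \<cdot> gen w \<up> (- i)) \<cdot> gen x \<up> (j * q' u) = gen u"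
        using composite[OF s(2) t(2) _ _ V(6) e] xC C(2) by (simp add: ind_def twist_def)
      obtain \<phi> where \<phi>: "\<phi> \<in> hom A (BijGroup (UNIV :: int set))"
        "\<And>v. v \<in> V \<Longrightarrow> v \<noteq> w \<Longrightarrow> v \<noteq> u \<Longrightarrow> \<phi> (gen v) = \<one>\<^bsub>BijGroup UNIV\<^esub>"
        "\<And>i :: int. \<phi> (gen w \<up> i \<cdot> gen u \<cdot> gen w \<up> (- i)) = \<phi> (gen u) \<Longrightarrow> i = 0"
        using dihedral_detects[OF V(1,6,7)] by blast
      let ?B = "BijGroup (UNIV :: int set)"
      interpret \<phi>: group_hom A ?B \<phi> using \<phi>(1) group_BijGroup by (intro group_homI)
      have "\<phi> (gen x) = \<one>\<^bsub>?B\<^esub>" using \<phi>(2) V by blast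
      then have "\<phi> (gen x \<up> k) = \<one>\<^bsub>?B\<^esub>" for k :: int using \<phi>.hom_int_pow[of "gen x" k] V by simp
      note \<phi>x = this
      define m where "m = gen w \<up> i \<cdot> gen u \<cdot> gen w \<up> (- i)"
      have m: "m \<in> carrier A" unfolding m_def using V by simp
      have "\<phi> (gen x \<up> (j * p' u) \<cdot> m \<cdot> gen x \<up> (j * q' u)) = \<phi> m"
        using m V \<phi>x by simp
      then have "\<phi> m = \<phi> (gen u)" using eq unfolding m_def by simp
      then have "\<phi> (gen w \<up> i \<cdot> gen u \<cdot> gen w \<up> (- i)) = \<phi> (gen u)" unfolding m_def .
      then show "i = 0" by (rule \<phi>(3))
    qed
  next
    case False
    obtain z where z: "z \<in> V" using another_vertex[OF n] by metis
    obtain w where w: "w \<in> V" "w \<noteq> z" using another_vertex[OF n, of z z] by metis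
    obtain y where y: "y \<in> V" "y \<noteq> z" "y \<noteq> w" using another_vertex[OF n] by metis
    \<comment> \<open>In this case a vertex with a neighbour is adjacent to all others, so a single
      edge makes the graph complete.\<close>
    have lk: "lk \<Gamma> z \<subseteq> st \<Gamma> x" if x: "x \<in> V" "x \<noteq> z" for x
    proof (cases "lk \<Gamma> z = {}")
      case False': False
      then have "V \<subseteq> st \<Gamma> z" using False unfolding lk_def by blast
      then have "(z, x) \<in> parcs \<Gamma>" using x lk_st z by blast
      then have "V \<subseteq> st \<Gamma> x" using False edge_sym by blast
      then show ?thesis unfolding lk_def by blast
    qed simp
    obtain s where s: "s \<in> S" "acts s w (\<lambda>_. 0) (ind {z})" using right_transvection[of z w] z w lk by metis
    obtain t where t: "t \<in> S" "acts t y (ind {z}) (\<lambda>_. 0)" using left_transvection[of z y] z y lk by metis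
    show thesis
    proof (rule suffices[OF s(1) t(1)])
      show "s \<odot> t = t \<odot> s"
        by (rule acts_commute[OF s(2) t(2)]) (use w y in \<open>auto simp: ind_def\<close>)
      fix i j :: int assume e: "s [^]\<^bsub>Aut\<^esub> i \<odot> t [^]\<^bsub>Aut\<^esub> j = \<one>\<^bsub>Aut\<^esub>"
      have eq: "gen y \<up> j \<cdot> (gen z \<cdot> gen w \<up> i) = gen z"
        using composite[OF s(2) t(2) _ _ z e] y z w by (simp add: ind_def twist_def)
      obtain \<epsilon> where \<epsilon>: "\<epsilon> \<in> hom A integer_group" "\<And>v. v \<in> V \<Longrightarrow> \<epsilon> (gen v) = (if v = w then 1 else 0)"
        using exponent_hom[of w] by blast
      interpret \<epsilon>: group_hom A integer_group \<epsilon> using \<epsilon>(1) by (intro group_homI) auto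
      show "i = 0"
        using arg_cong[OF eq, of \<epsilon>] \<epsilon>(2) y z w \<epsilon>.hom_int_pow by simp
    qed
  qed
qed

section \<open>Inner automorphisms\<close>

lemma conj_mult:
  assumes "a \<in> carrier A" "b \<in> carrier A" "x \<in> carrier A"
  shows "conj (a \<cdot> b) x = conj a (conj b x)"
  using assms by (simp add: conj_def A.m_assoc A.inv_mult_group)

lemma conj_Aut:
  assumes a: "a \<in> carrier A"
  shows "conj a \<in> carrier Aut"
proof -
  have one: "conj \<one>\<^bsub>A\<^esub> x = x" if "x \<in> carrier A" for x using that by (simp add: conj_def)
  have "restrict (conj a) (carrier A) \<in> carrier Aut"
  proof (rule Aut_restrictI[OF conj_hom[OF a] conj_hom[of "inv\<^bsub>A\<^esub> a"]])
    show "conj a (conj (inv\<^bsub>A\<^esub> a) x) = x" "conj (inv\<^bsub>A\<^esub> a) (conj a x) = x" if "x \<in> carrier A" for x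
      using conj_mult[of a "inv\<^bsub>A\<^esub> a" x] conj_mult[of "inv\<^bsub>A\<^esub> a" a x] one that a by auto
  qed (use a in simp)
  then show ?thesis by (simp add: conj_def restrict_def cong: if_cong)
qed

lemma conj_hom_Aut:
  assumes "a \<in> carrier A" "b \<in> carrier A"
  shows "conj (a \<cdot> b) = conj a \<odot> conj b"
  using assms conj_mult Aut_mult conj_Aut by (intro Aut_eqI) auto

lemma conj_equivariant:
  assumes "g \<in> carrier Aut" "a \<in> carrier A"
  shows "g \<odot> conj a = conj (g a) \<odot> g"
proof (rule Aut_eqI)
  interpret g: group_hom A A g using Aut_hom[OF assms(1)] .
  have c: "conj a \<in> carrier Aut" "conj (g a) \<in> carrier Aut" using conj_Aut assms(2) by auto
  then show "g \<odot> conj a \<in> carrier Aut" "conj (g a) \<odot> g \<in> carrier Aut" using assms(1) by auto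
  show "(g \<odot> conj a) (gen v) = (conj (g a) \<odot> g) (gen v)" if "v \<in> V" for v
    using that Aut_mult[OF assms(1) c(1)] Aut_mult[OF c(2) assms(1)] assms(2) by (simp add: conj_def)
qed

lemma conj_group_hom: "group_hom A Aut conj"
  using conj_Aut conj_hom_Aut by (intro group_homI Aut.group_axioms homI)

lemma conj_in_subgroup:
  assumes P: "subgroup P Aut" and gens: "\<And>v. v \<in> V \<Longrightarrow> conj (gen v) \<in> P" and a: "a \<in> carrier A"
  shows "conj a \<in> P"
proof -
  interpret c: group_hom A Aut conj by (rule conj_group_hom)
  show ?thesis using a
  proof (induction rule: raag_induct)
    case one
    then show ?case using P subgroup.one_closed by fastforce
  next
    case (gen v y)
    then show ?case using P gens subgroup.m_closed by fastforce
  next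
    case (inv v y)
    then show ?case using P gens subgroup.m_closed subgroup.m_inv_closed c.hom_inv
      by (metis A.inv_closed c.hom_mult gen_closed)
  qed
qed

lemma conj_gen_central:
  assumes "v \<in> V" "V \<subseteq> st \<Gamma> v"
  shows "conj (gen v) = \<one>\<^bsub>Aut\<^esub>"
proof (rule Aut_eqI)
  show "conj (gen v) \<in> carrier Aut" using conj_Aut assms(1) by simp
  fix u assume u: "u \<in> V"
  then have "gen v \<cdot> gen u = gen u \<cdot> gen v" using st_commute assms by blast
  then show "conj (gen v) (gen u) = \<one>\<^bsub>Aut\<^esub> (gen u)"
    using u assms(1) Aut_one by (simp add: conj_def A.m_assoc)
qed simp

text \<open>In the abelian case, \<open>x \<mapsto> x a\<^sup>f\<^sup>(\<^sup>x\<^sup>)\<close> is an automorphism if \<open>f a = 0\<close>; conjugation permutes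
  these generalized transvections.\<close>

definition transv :: "'v word set \<Rightarrow> ('v word set \<Rightarrow> int) \<Rightarrow> 'v word set \<Rightarrow> 'v word set" where
  "transv a f = (\<lambda>x\<in>carrier A. x \<cdot> a \<up> f x)"

lemma hom_int_mult: "f \<in> hom A integer_group \<Longrightarrow> x \<in> carrier A \<Longrightarrow> y \<in> carrier A \<Longrightarrow> f (x \<cdot> y) = f x + f y"
  unfolding hom_def by simp

lemma hom_int_power: "f \<in> hom A integer_group \<Longrightarrow> x \<in> carrier A \<Longrightarrow> f (x \<up> (n :: int)) = n * f x"
  using group_hom.hom_int_pow[OF group_homI, of integer_group f x n] by simp

lemma transv_apply: "x \<in> carrier A \<Longrightarrow> transv a f x = x \<cdot> a \<up> f x"
  unfolding transv_def by simp

text \<open>Since \<open>f a = 0\<close>, multiplying by powers of \<open>a\<close> does not change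
  \<open>f\<close>, so the map with the opposite exponent is an inverse.\<close>

lemma transv_Aut:
  assumes comm: "\<forall>x\<in>carrier A. \<forall>y\<in>carrier A. x \<cdot> y = y \<cdot> x"
    and f: "f \<in> hom A integer_group" "a \<in> carrier A" "f a = 0"
  shows "transv a f \<in> carrier Aut"
  unfolding transv_def
proof (rule Aut_restrictI[where \<psi> = "\<lambda>x. x \<cdot> a \<up> (- f x)"])
  have h: "(\<lambda>x. x \<cdot> a \<up> (k * f x)) \<in> hom A A" for k :: int
  proof (rule homI)
    fix x y assume xy: "x \<in> carrier A" "y \<in> carrier A"
    have "x \<cdot> y \<cdot> a \<up> (k * f (x \<cdot> y)) = x \<cdot> (y \<cdot> a \<up> (k * f x)) \<cdot> a \<up> (k * f y)"
      using xy f by (simp add: hom_int_mult distrib_left A.int_pow_mult A.m_assoc)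
    also have "y \<cdot> a \<up> (k * f x) = a \<up> (k * f x) \<cdot> y" using comm xy f by simp
    finally show "x \<cdot> y \<cdot> a \<up> (k * f (x \<cdot> y)) = x \<cdot> a \<up> (k * f x) \<cdot> (y \<cdot> a \<up> (k * f y))"
      using xy f by (simp add: A.m_assoc)
  qed (use f in simp)
  show "(\<lambda>x. x \<cdot> a \<up> f x) \<in> hom A A" "(\<lambda>x. x \<cdot> a \<up> (- f x)) \<in> hom A A"
    using h[of 1] h[of "- 1"] by simp_all
  fix x assume x: "x \<in> carrier A"
  have inv: "a \<up> (- k) \<cdot> a \<up> k = \<one>\<^bsub>A\<^esub>" "a \<up> k \<cdot> a \<up> (- k) = \<one>\<^bsub>A\<^esub>" for k :: int
    using f(2) by (simp_all add: A.int_pow_mult[symmetric])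
  have fx: "f (x \<cdot> a \<up> k) = f x" for k :: int using x f by (simp add: hom_int_mult hom_int_power)
  show "x \<cdot> a \<up> (- f x) \<cdot> a \<up> f (x \<cdot> a \<up> (- f x)) = x"
    "x \<cdot> a \<up> f x \<cdot> a \<up> (- f (x \<cdot> a \<up> f x)) = x"
    unfolding fx using x f(2) inv by (simp_all add: A.m_assoc)
qed

text \<open>Neither map changes the exponent used by the other. The conditions hold whenever the two
  share the vector (\<open>a = b\<close>) or the functional (\<open>f = g\<close>), and this is how
  they are met later.\<close>

lemma transv_commute:
  assumes comm: "\<forall>x\<in>carrier A. \<forall>y\<in>carrier A. x \<cdot> y = y \<cdot> x"
    and f: "f \<in> hom A integer_group" "a \<in> carrier A" "f a = 0"
    and g: "g \<in> hom A integer_group" "b \<in> carrier A" "g b = 0"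
    and fg: "f b = 0" "g a = 0"
  shows "transv a f \<odot> transv b g = transv b g \<odot> transv a f"
proof (rule Aut_eqI)
  have c: "transv a f \<in> carrier Aut" "transv b g \<in> carrier Aut" using transv_Aut comm f g by auto
  then show "transv a f \<odot> transv b g \<in> carrier Aut" "transv b g \<odot> transv a f \<in> carrier Aut" by auto
  fix v assume "v \<in> V"
  then have v: "gen v \<in> carrier A" by simp
  have e: "f (gen v \<cdot> b \<up> k) = f (gen v)" "g (gen v \<cdot> a \<up> k) = g (gen v)" for k :: int
    using v f g fg by (simp_all add: hom_int_mult hom_int_power)
  have "b \<up> g (gen v) \<cdot> a \<up> f (gen v) = a \<up> f (gen v) \<cdot> b \<up> g (gen v)"
    using comm f(2) g(2) by simp
  then show "(transv a f \<odot> transv b g) (gen v) = (transv b g \<odot> transv a f) (gen v)"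
    using Aut_mult[OF c] Aut_mult[OF c(2,1)] v f(2) g(2) by (simp add: transv_apply e A.m_assoc)
qed

lemma transv_torsion_free:
  assumes comm: "\<forall>x\<in>carrier A. \<forall>y\<in>carrier A. x \<cdot> y = y \<cdot> x"
    and f: "f \<in> hom A integer_group" "a \<in> carrier A" "f a = 0"
    and a: "\<forall>n :: int. a \<up> n = \<one>\<^bsub>A\<^esub> \<longrightarrow> n = 0" and y: "y \<in> carrier A" "f y \<noteq> 0"
  shows "torsion_free (transv a f)"
  unfolding torsion_free_def
proof (intro allI impI)
  fix n :: nat assume n: "transv a f [^]\<^bsub>Aut\<^esub> n = \<one>\<^bsub>Aut\<^esub>"
  have c: "transv a f \<in> carrier Aut" using transv_Aut comm f by blast
  have fx: "f (x \<cdot> a \<up> k) = f x" if "x \<in> carrier A" for k :: int and x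
    using that f by (simp add: hom_int_mult hom_int_power)
  have "(transv a f [^]\<^bsub>Aut\<^esub> m) x = x \<cdot> a \<up> (int m * f x)" if "x \<in> carrier A" for m :: nat and x
    using that
  proof (induction m arbitrary: x)
    case 0
    then show ?case using Aut_one by simp
  next
    case (Suc m)
    have "(transv a f [^]\<^bsub>Aut\<^esub> Suc m) x = (transv a f [^]\<^bsub>Aut\<^esub> m) (x \<cdot> a \<up> f x)"
      using Aut_mult[of "transv a f [^]\<^bsub>Aut\<^esub> m" "transv a f" x] c Suc.prems by (simp add: transv_apply)
    also have "\<dots> = x \<cdot> (a \<up> f x \<cdot> a \<up> (int m * f x))"
      using Suc.IH[of "x \<cdot> a \<up> f x"] Suc.prems f(2) fx by (simp add: A.m_assoc)
    also have "a \<up> f x \<cdot> a \<up> (int m * f x) = a \<up> (int (Suc m) * f x)"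
      using f(2) A.int_pow_mult[of a "f x" "int m * f x"] by (simp add: algebra_simps)
    finally show ?case .
  qed
  then have "y \<cdot> a \<up> (int n * f y) = y" using n Aut_one y(1) by metis
  then have "a \<up> (int n * f y) = \<one>\<^bsub>A\<^esub>" using y(1) f(2) by simp
  then have "int n * f y = 0" using a by blast
  then show "n = 0" using y(2) by simp
qed

lemma gen_torsion_free:
  assumes "w \<in> V" "gen w \<up> (n :: int) = \<one>\<^bsub>A\<^esub>"
  shows "n = 0"
proof -
  obtain \<epsilon> where \<epsilon>: "\<epsilon> \<in> hom A integer_group" "\<And>v. v \<in> V \<Longrightarrow> \<epsilon> (gen v) = (if v = w then 1 else 0)"
    using exponent_hom[of w] by blast
  interpret \<epsilon>: group_hom A integer_group \<epsilon> using \<epsilon>(1) by (intro group_homI) auto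
  show ?thesis using hom_int_power[OF \<epsilon>(1), of "gen w" n] assms \<epsilon>(2) \<epsilon>.hom_one by simp
qed

text \<open>Malnormality up to torsion: \<open>P\<close> meets its conjugate by an element outside
  \<open>P\<close> in no element of infinite order.\<close>

definition malnormal_subgroup :: "('v word set \<Rightarrow> 'v word set) set \<Rightarrow> bool" where
  "malnormal_subgroup P \<longleftrightarrow> subgroup P Aut \<and>
    (\<forall>c\<in>P. \<forall>t\<in>carrier Aut. torsion_free c \<and> t \<odot> c \<odot> inv\<^bsub>Aut\<^esub> t \<in> P \<longrightarrow> t \<in> P)"

lemma commuting_in_malnormal:
  assumes P: "malnormal_subgroup P" and c: "c \<in> P" "torsion_free c"
    and t: "t \<in> carrier Aut" "c \<odot> t = t \<odot> c"
  shows "t \<in> P"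
proof -
  have "c \<in> carrier Aut" using P c(1) subgroup.subset unfolding malnormal_subgroup_def by blast
  then have "t \<odot> c \<odot> inv\<^bsub>Aut\<^esub> t = c"
    unfolding t(2)[symmetric] using t(1) by (simp add: Aut.m_assoc)
  then show ?thesis using P c t(1) unfolding malnormal_subgroup_def by simp
qed

text \<open>A partial conjugation by \<open>v\<close> fixes \<open>gen v\<close> and so commutes
  with conjugation by it, while a central generator acts trivially; this puts all inner
  automorphisms into \<open>P\<close>. Conjugation by \<open>gen w\<close> has infinite order, and
  its conjugate by \<open>g\<close> is again inner.\<close>

lemma malnormal_noncomplete:
  assumes mal: "malnormal_subgroup P" and SP: "S \<subseteq> P"
    and w: "w \<in> V" "u \<in> V - st \<Gamma> w" and g: "g \<in> carrier Aut"
  shows "g \<in> P"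
proof -
  have P: "subgroup P Aut" using mal unfolding malnormal_subgroup_def by blast
  have "conj (gen v) \<in> P" if v: "v \<in> V" for v
  proof (cases "V \<subseteq> st \<Gamma> v")
    case True
    then show ?thesis using conj_gen_central v P subgroup.one_closed by fastforce
  next
    case False
    then obtain x where x: "x \<in> V - st \<Gamma> v" by blast
    obtain C where C: "C \<in> components_minus_star \<Gamma> v" using component_exists[OF x] by blast
    obtain s where s: "s \<in> S" "acts s v (ind C) (\<lambda>u. - ind C u)" using partial_conjugation[OF v C] .
    have sc: "s \<in> carrier Aut" using S_carrier s(1) by blast
    have "s (gen v) = gen v" using acts_fix[OF s(2) v] s(2) unfolding acts_def by simp
    then have "s \<odot> conj (gen v) = conj (gen v) \<odot> s" using conj_equivariant[OF sc] v by simp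
    then show ?thesis
      using commuting_in_malnormal[OF mal, of s "conj (gen v)"] s(1) SP S_torsion_free conj_Aut v by blast
  qed
  then have all: "conj a \<in> P" if "a \<in> carrier A" for a using conj_in_subgroup P that by blast
  interpret c: group_hom A Aut conj by (rule conj_group_hom)
  let ?k = "conj (gen w)"
  have "torsion_free ?k"
    unfolding torsion_free_def
  proof (intro allI impI)
    fix n :: nat assume n: "?k [^]\<^bsub>Aut\<^esub> n = \<one>\<^bsub>Aut\<^esub>"
    then have "conj (gen w \<up> int n) = \<one>\<^bsub>Aut\<^esub>"
      using c.hom_int_pow[of "gen w" "int n"] w(1) by (simp add: int_pow_int)
    then have "conj (gen w \<up> int n) (gen u) = gen u" using Aut_one w by simp
    then have "gen w \<up> int n \<cdot> gen u \<cdot> gen w \<up> (- int n) = gen u"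
      using w by (simp add: conj_def A.int_pow_neg)
    then show "n = 0" using conj_power_nontrivial[of w u "int n"] w by simp
  qed
  moreover have "g \<odot> ?k \<odot> inv\<^bsub>Aut\<^esub> g = conj (g (gen w))"
    using conj_equivariant[OF g, of "gen w"] g w conj_Aut Aut_apply_closed[OF g]
    by (simp add: Aut.m_assoc)
  moreover have "?k \<in> P" "conj (g (gen w)) \<in> P" using all w Aut_apply_closed[OF g] by auto
  ultimately show ?thesis
    using mal g unfolding malnormal_subgroup_def by metis
qed

text \<open>Transvections of an abelian group commute if they share the vector or the functional.
  The chain changes the functional, the vector and the functional again, and leads from
  \<open>transv (gen w) ez\<close> to its conjugate by \<open>g\<close>. The functional in the
  middle has to vanish on both vectors, \<open>gen w\<close> and \<open>c\<close>.\<close>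

lemma malnormal_complete:
  assumes mal: "malnormal_subgroup P" and SP: "S \<subseteq> P"
    and complete: "\<forall>w\<in>V. V \<subseteq> st \<Gamma> w" and n: "card V \<ge> 3" and g: "g \<in> carrier Aut"
  shows "g \<in> P"
proof -
  have P: "subgroup P Aut" using mal unfolding malnormal_subgroup_def by blast
  have "x \<cdot> y = y \<cdot> x" if xy: "x \<in> carrier A" "y \<in> carrier A" for x y
  proof -
    have "conj x \<in> {\<one>\<^bsub>Aut\<^esub>}"
      by (rule conj_in_subgroup[OF Aut.triv_subgroup _ xy(1)]) (use conj_gen_central complete in simp)
    then have "conj x y = y" using Aut_one xy(2) by simp
    then have "x \<cdot> y \<cdot> inv\<^bsub>A\<^esub> x = y" using xy(2) by (simp add: conj_def)
    then show ?thesis using xy by (metis A.inv_solve_right A.m_closed)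
  qed
  then have comm: "\<forall>x\<in>carrier A. \<forall>y\<in>carrier A. x \<cdot> y = y \<cdot> x" by blast
  obtain z where z: "z \<in> V" using another_vertex[OF n] by metis
  obtain w where w: "w \<in> V" "w \<noteq> z" using another_vertex[OF n, of z z] by metis
  obtain y where y: "y \<in> V" "y \<noteq> z" "y \<noteq> w" using another_vertex[OF n] by metis
  obtain ez where ez: "ez \<in> hom A integer_group" "\<And>v. v \<in> V \<Longrightarrow> ez (gen v) = (if v = z then 1 else 0)"
    using exponent_hom[of z] by blast
  obtain ey where ey: "ey \<in> hom A integer_group" "\<And>v. v \<in> V \<Longrightarrow> ey (gen v) = (if v = y then 1 else 0)"
    using exponent_hom[of y] by blast
  interpret g: group_hom A A g using Aut_hom[OF g] .
  define c where "c = g (gen w)"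
  have cc: "c \<in> carrier A" unfolding c_def using w by simp
  let ?gi = "inv\<^bsub>Aut\<^esub> g"
  have gi: "?gi \<in> carrier Aut" using g by simp
  interpret gi: group_hom A A ?gi using Aut_hom[OF gi] .
  define e where "e x = ez (?gi x)" for x
  have e: "e \<in> hom A integer_group"
    unfolding e_def using ez(1) gi.homh by (intro homI) (auto simp: hom_int_mult)
  have ec: "e c = 0" unfolding e_def c_def using Aut_inv_apply(1)[OF g] w ez(2) by simp
  \<comment> \<open>a nonzero functional vanishing on both \<open>w\<close> and \<open>c\<close>; this needs a third vertex\<close>
  obtain \<alpha> \<beta> :: int where ab: "\<alpha> \<noteq> 0 \<or> \<beta> \<noteq> 0" "\<alpha> * ey c + \<beta> * ez c = 0"
  proof (cases "ey c = 0")
    case True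
    then show thesis using that[of 1 0] by simp
  next
    case False
    then show thesis using that[of "ez c" "- ey c"] by simp
  qed
  define f where "f x = \<alpha> * ey x + \<beta> * ez x" for x
  have f: "f \<in> hom A integer_group"
    unfolding f_def using ey(1) ez(1) by (intro homI) (auto simp: hom_int_mult algebra_simps)
  have fw: "f (gen w) = 0" "ez (gen w) = 0" "f c = 0"
    using ey(2) ez(2) w y ab unfolding f_def by auto
  obtain v where v: "v \<in> V" "f (gen v) \<noteq> 0"
    using that[of y] that[of z] ab(1) y z ey(2) ez(2) unfolding f_def by auto
  have gw: "gen w \<in> carrier A" "gen v \<in> carrier A" "gen z \<in> carrier A" using w v z by auto
  have wtf: "\<forall>k :: int. gen w \<up> k = \<one>\<^bsub>A\<^esub> \<longrightarrow> k = 0" using gen_torsion_free w(1) by blast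
  have "k = 0" if "c \<up> k = \<one>\<^bsub>A\<^esub>" for k :: int
  proof -
    have "g (gen w \<up> k) = \<one>\<^bsub>A\<^esub>" using that g.hom_int_pow[of "gen w" k] gw unfolding c_def by simp
    then have "gen w \<up> k = \<one>\<^bsub>A\<^esub>"
      using Aut_inv_apply(1)[OF g, of "gen w \<up> k"] gw gi.hom_one by simp
    then show ?thesis using gen_torsion_free w by blast
  qed
  then have ctf: "\<forall>k :: int. c \<up> k = \<one>\<^bsub>A\<^esub> \<longrightarrow> k = 0" by blast
  let ?s = "transv (gen w) ez" and ?s1 = "transv (gen w) f" and ?s2 = "transv c f" and ?s3 = "transv c e"
  have car: "?s \<in> carrier Aut" "?s1 \<in> carrier Aut" "?s2 \<in> carrier Aut" "?s3 \<in> carrier Aut"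
    using transv_Aut[OF comm] ez(1) f e gw cc fw ec by auto
  have tf: "torsion_free ?s" "torsion_free ?s1" "torsion_free ?s2"
    using transv_torsion_free[OF comm ez(1) gw(1) fw(2) wtf gw(3)]
      transv_torsion_free[OF comm f gw(1) fw(1) wtf gw(2) v(2)]
      transv_torsion_free[OF comm f cc fw(3) ctf gw(2) v(2)] ez(2)[OF z] by auto
  have "lk \<Gamma> z \<subseteq> st \<Gamma> w" using complete w(1) unfolding lk_def by blast
  moreover have "?s (gen z) = gen z \<cdot> gen w" using ez(2)[OF z] gw by (simp add: transv_apply)
  moreover have "\<forall>u\<in>V - {z}. ?s (gen u) = gen u" using ez(2) by (simp add: transv_apply)
  ultimately have "?s \<in> right_transvections \<Gamma>"
    unfolding right_transvections_def using car(1) w(1) w(2)[symmetric] z by blast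
  then have sP: "?s \<in> P" using SP unfolding transvections_and_partial_conjugations_def by blast
  have s1P: "?s1 \<in> P"
    using commuting_in_malnormal[OF mal sP tf(1) car(2)] transv_commute[OF comm ez(1) gw(1) fw(2) f gw(1) fw(1) fw(2,1)] by simp
  have s2P: "?s2 \<in> P"
    using commuting_in_malnormal[OF mal s1P tf(2) car(3)] transv_commute[OF comm f gw(1) fw(1) f cc fw(3) fw(3,1)] by simp
  have s3P: "?s3 \<in> P"
    using commuting_in_malnormal[OF mal s2P tf(3) car(4)] transv_commute[OF comm f cc fw(3) e cc ec fw(3) ec] by simp
  \<comment> \<open>Conjugation by \<open>g\<close> moves the vector of a transvection by
    \<open>g\<close> and composes its functional with the inverse of \<open>g\<close>.\<close>
  have "g \<odot> ?s \<odot> ?gi = ?s3"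
  proof (rule Aut_eqI)
    show "g \<odot> ?s \<odot> ?gi \<in> carrier Aut" "?s3 \<in> carrier Aut" using g car by auto
    fix v assume "v \<in> V"
    then have x: "gen v \<in> carrier A" by simp
    have "(g \<odot> ?s \<odot> ?gi) (gen v) = g (?s (?gi (gen v)))"
      using Aut_mult[of "g \<odot> ?s" ?gi "gen v"] Aut_mult[OF g car(1), of "?gi (gen v)"] g car(1) x by simp
    also have "\<dots> = g (?gi (gen v)) \<cdot> c \<up> ez (?gi (gen v))"
      using x gw(1) g.hom_int_pow by (simp add: transv_apply c_def)
    also have "\<dots> = ?s3 (gen v)" using Aut_inv_apply(2)[OF g x] x by (simp add: transv_apply e_def)
    finally show "(g \<odot> ?s \<odot> ?gi) (gen v) = ?s3 (gen v)" .
  qed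
  then show ?thesis using mal sP g tf(1) s3P unfolding malnormal_subgroup_def by metis
qed

theorem Aut_not_relatively_hyperbolic:
  assumes n: "card V \<ge> 3"
  shows "\<not> relatively_hyperbolic Aut"
proof
  assume rh: "relatively_hyperbolic Aut"
  obtain s t where st: "s \<in> S" "t \<in> S" "s \<odot> t = t \<odot> s"
    and ind: "\<forall>(i :: int) (j :: int). s [^]\<^bsub>Aut\<^esub> i \<odot> t [^]\<^bsub>Aut\<^esub> j = \<one>\<^bsub>Aut\<^esub> \<longrightarrow> i = 0 \<and> j = 0"
    using independent_pair[OF n] by blast
  note r2 = Aut.rank_two_subgroup[OF S_carrier[OF st(1)] S_carrier[OF st(2)] st(3) ind]
  let ?B = "range (\<lambda>(i :: int, j :: int). s [^]\<^bsub>Aut\<^esub> i \<odot> t [^]\<^bsub>Aut\<^esub> j)"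
  have "\<exists>P. subgroup P Aut \<and> P \<noteq> carrier Aut \<and> ?B \<subseteq> P \<and>
    (\<forall>c\<in>P. \<forall>t\<in>carrier Aut. (\<forall>n :: nat. c [^]\<^bsub>Aut\<^esub> n = \<one>\<^bsub>Aut\<^esub> \<longrightarrow> n = 0) \<and>
      t \<odot> c \<odot> inv\<^bsub>Aut\<^esub> t \<in> P \<longrightarrow> t \<in> P)"
    by (rule relatively_hyperbolic_peripheral[OF Aut.group_axioms rh, of ?B s t])
      (fact r2(1), fact r2(2), fact r2(3), fact r2(4), fact r2(5), fact r2(6))
  then obtain P where P: "subgroup P Aut" "P \<noteq> carrier Aut" "?B \<subseteq> P"
    and mal0: "\<forall>c\<in>P. \<forall>t\<in>carrier Aut. torsion_free c \<and> t \<odot> c \<odot> inv\<^bsub>Aut\<^esub> t \<in> P \<longrightarrow> t \<in> P"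
    unfolding torsion_free_def by blast
  have mal: "malnormal_subgroup P" using P(1) mal0 unfolding malnormal_subgroup_def by blast
  have PA: "P \<subseteq> carrier Aut" using P(1) subgroup.subset by blast
  have "S \<subseteq> P"
  proof
    fix r assume "r \<in> S"
    then have "(s, r) \<in> commuting\<^sup>*" using S_connected[OF n st(1)] by blast
    then show "r \<in> P"
    proof (induction rule: rtrancl_induct)
      case base
      then show ?case using r2(4) P(3) by blast
    next
      case (step a b)
      then have "a \<in> S" "b \<in> S" "a \<odot> b = b \<odot> a" unfolding commuting_def by auto
      then show ?case
        using commuting_in_malnormal[OF mal step.IH S_torsion_free S_carrier] by blast
    qed
  qed
  have "carrier Aut \<subseteq> P"
  proof
    fix g assume g: "g \<in> carrier Aut"
    show "g \<in> P"
    proof (cases "\<exists>w\<in>V. \<exists>u. u \<in> V - st \<Gamma> w")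
      case True
      then show ?thesis using malnormal_noncomplete[OF mal \<open>S \<subseteq> P\<close> _ _ g] by blast
    next
      case False
      then show ?thesis using malnormal_complete[OF mal \<open>S \<subseteq> P\<close> _ n g] by blast
    qed
  qed
  then show False using PA P(2) by blast
qed

end

theorem theorem3p1:
  fixes \<Gamma> :: "'v pair_pre_digraph"
  assumes "pair_graph \<Gamma>"
    and "card (pverts \<Gamma>) \<ge> 3"
  shows "Digraph_Component.connected (with_proj
           (commutativity_graph (Aut_star \<Gamma>) (transvections_and_partial_conjugations \<Gamma>)))
       \<and> \<not> relatively_hyperbolic (AutoGroup (raag \<Gamma>))"
proof -
  interpret raag_graph \<Gamma> using assms(1) by (rule raag_graph.intro)
  show ?thesis using commutativity_graph_connected Aut_not_relatively_hyperbolic assms(2) by blast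
qed

end
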